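(* The Ricci form $\rho$ of a para-Kähler manifold $(M,K,\omega,g)$ is a closed $(1,1)$-form and in local para-holomorphic coordinates can be represented by $$\rho=e\,\partial\overline\partial\log(\det(g_{\alpha\overline\beta})).$$ In particular, the Ricci tensor satisfies $$\mathrm{Ric}_{\alpha\overline\beta}=-\frac{\partial^2\log(\det(g_{\lambda\overline\mu}))}{\partial z^\alpha\,\partial\overline z^\beta}.$$
   Context: $C=\mathbb R+e\mathbb R$ with $e^2=1$ is the algebra of para-complex numbers, $\overline{x+ey}=x-ey$. A para-complex structure on a $2n$-manifold is a field $K$ of endomorphisms of $TM$, $K^2=\mathrm{Id}$, with involutive $\pm1$-eigendistributions of rank $n$. A para-Kähler manifold is a pseudo-Riemannian manifold $(M,g)$ with a $g$-skew-symmetric para-complex structure $K$ parallel for the Levi-Civita connection; $\omega=g\circ K$. All tensors are extended $C$-multilinearly to $T^CM=TM\otimes C$. Local para-holomorphic coordinates are $C$-valued functions $z^\alpha=x^\alpha+ey^\alpha$ ($\alpha=1,\dots,n$) with $(x^\alpha,y^\alpha)$ real coordinates and $dz^\alpha\circ K=e\,dz^\alpha$; $\partial_\alpha=\frac{\partial}{\partial z^\alpha}=\frac12(\partial_{x^\alpha}+e\partial_{y^\alpha})$ and $\partial_{\overline\alpha}=\frac{\partial}{\partial\overline z^\alpha}=\frac12(\partial_{x^\alpha}-e\partial_{y^\alpha})$. $(p,q)$-forms are generated by wedge products of $p$ of the $dz^\alpha$ and $q$ of the $d\overline z^\beta$; $d=\partial+\overline\partial$ with $\partial,\overline\partial$ of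 bidegree $(1,0),(0,1)$. Components: $g_{\alpha\overline\beta}=g(\partial_\alpha,\partial_{\overline\beta})$, $\mathrm{Ric}_{\alpha\overline\beta}=\mathrm{Ric}(\partial_\alpha,\partial_{\overline\beta})$. The Ricci tensor is $\mathrm{Ric}(X,Y)=\mathrm{tr}(V\mapsto R(V,X)Y)$ with $R(X,Y)=[\nabla_X,\nabla_Y]-\nabla_{[X,Y]}$. The Ricci form is $\rho=\mathrm{Ric}\circ K$, meaning $\rho(X,Y)=\mathrm{Ric}(X,KY)$, extended $C$-bilinearly. The wedge convention is $(\alpha\wedge\beta)(X,Y)=\alpha(X)\beta(Y)-\alpha(Y)\beta(X)$. $\det(g_{\alpha\overline\beta})$ is real and nowhere zero, and $\log$ is the logarithm of its absolute value. *)

theory Defs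
  imports "HOL-Analysis.Analysis" "HOL-Library.Function_Algebras"
begin

section \<open>The algebra of para-complex numbers\<close>

datatype para = PC (para_re: real) (para_im: real)

lemma para_eqI: "para_re a = para_re b \<Longrightarrow> para_im a = para_im b \<Longrightarrow> a = b"
  by (rule para.expand) simp

instantiation para :: comm_ring_1
begin

definition "0 = PC 0 0"
definition "1 = PC 1 0"
definition "a + b = PC (para_re a + para_re b) (para_im a + para_im b)"
definition "- a = PC (- para_re a) (- para_im a)"
definition "a - b = PC (para_re a - para_re b) (para_im a - para_im b)"
definition "a * b = PC (para_re a * para_re b + para_im a * para_im b)
                       (para_re a * para_im b + para_im a * para_re b)"

instance
  by standard
    (auto simp: zero_para_def one_para_def plus_para_def uminus_para_def minus_para_def
       times_para_def algebra_simps)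

end

instantiation para :: real_algebra_1
begin

definition "scaleR r a = PC (r * para_re a) (r * para_im a)"

instance
  by standard
    (auto simp: scaleR_para_def plus_para_def times_para_def algebra_simps intro: para_eqI)

end

definition para_e :: para where
  "para_e = PC 0 1"

definition para_cnj :: "para \<Rightarrow> para" where
  "para_cnj a = PC (para_re a) (- para_im a)"


section \<open>Pointwise real vector space structure on functions\<close>

text \<open>The additive structure comes from \<^theory>\<open>HOL-Library.Function_Algebras\<close>.\<close>

instantiation "fun" :: (type, real_vector) real_vector
begin

definition "scaleR r f = (\<lambda>x. r *\<^sub>R f x)"

instance
  by standard (auto simp: scaleR_fun_def plus_fun_def scaleR_add_left scaleR_add_right)

end

definition linear_within :: "'a::real_vector set \<Rightarrow> ('a \<Rightarrow> 'b::real_vector) \<Rightarrow> bool" where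
  "linear_within V F \<longleftrightarrow>
     (\<forall>u\<in>V. \<forall>v\<in>V. \<forall>a b. F (a *\<^sub>R u + b *\<^sub>R v) = a *\<^sub>R F u + b *\<^sub>R F v)"

definition bilinear_within :: "'a::real_vector set \<Rightarrow> ('a \<Rightarrow> 'a \<Rightarrow> real) \<Rightarrow> bool" where
  "bilinear_within V t \<longleftrightarrow>
     (\<forall>u\<in>V. linear_within V (t u)) \<and> (\<forall>v\<in>V. linear_within V (\<lambda>u. t u v))"

text \<open>Trace of an endomorphism of a finite-dimensional subspace.\<close>

definition trace_on :: "'a::real_vector set \<Rightarrow> ('a \<Rightarrow> 'a) \<Rightarrow> real" where
  "trace_on V F =
     (let B = (SOME B. B \<subseteq> V \<and> independent B \<and> V \<subseteq> span B)
      in \<Sum>b\<in>B. representation B (F b) b)"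


section \<open>Smooth manifolds\<close>

text \<open>\<open>C\<^sup>k\<close> and smooth maps on an open set of a Euclidean space.\<close>

fun Ck_on :: "nat \<Rightarrow> 'a::euclidean_space set \<Rightarrow> ('a \<Rightarrow> 'b::real_normed_vector) \<Rightarrow> bool" where
  "Ck_on 0 S f \<longleftrightarrow> continuous_on S f"
| "Ck_on (Suc k) S f \<longleftrightarrow>
     (\<forall>x\<in>S. f differentiable (at x)) \<and> (\<forall>v. Ck_on k S (\<lambda>x. frechet_derivative f (at x) v))"

definition smooth_on :: "'a::euclidean_space set \<Rightarrow> ('a \<Rightarrow> 'b::real_normed_vector) \<Rightarrow> bool" where
  "smooth_on S f \<longleftrightarrow> (\<forall>k. Ck_on k S f)"

text \<open>The manifold is a whole type \<open>'m\<close>. A chart is a pair of an open domain and a coordinate map;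
  the values of the coordinate map outside the domain are irrelevant.\<close>

type_synonym ('m, 'e) chart = "'m set \<times> ('m \<Rightarrow> 'e)"

definition is_chart :: "('m::topological_space, 'e::euclidean_space) chart \<Rightarrow> bool" where
  "is_chart c \<longleftrightarrow> (case c of (U, \<phi>) \<Rightarrow>
     open U \<and> open (\<phi> ` U) \<and> homeomorphism U (\<phi> ` U) \<phi> (inv_into U \<phi>))"

definition compatible_charts ::
  "('m::topological_space, 'e::euclidean_space) chart \<Rightarrow> ('m, 'e) chart \<Rightarrow> bool" where
  "compatible_charts c d \<longleftrightarrow> (case (c, d) of ((U, \<phi>), (V, \<psi>)) \<Rightarrow>
     smooth_on (\<phi> ` (U \<inter> V)) (\<psi> \<circ> inv_into U \<phi>) \<and>
     smooth_on (\<psi> ` (U \<inter> V)) (\<phi> \<circ> inv_into V \<psi>))"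

text \<open>A smooth structure is a maximal smooth atlas.\<close>

definition smooth_structure ::
  "('m::{t2_space, second_countable_topology}, 'e::euclidean_space) chart set \<Rightarrow> bool" where
  "smooth_structure A \<longleftrightarrow>
     (\<forall>c\<in>A. is_chart c) \<and> (\<Union>c\<in>A. fst c) = UNIV \<and>
     (\<forall>c\<in>A. \<forall>d\<in>A. compatible_charts c d) \<and>
     (\<forall>c. is_chart c \<and> (\<forall>d\<in>A. compatible_charts c d) \<longrightarrow> c \<in> A)"

definition smooth_fun ::
  "('m::topological_space, 'e::euclidean_space) chart set \<Rightarrow> 'm set \<Rightarrow> ('m \<Rightarrow> real) \<Rightarrow> bool" where
  "smooth_fun A V f \<longleftrightarrow> (\<forall>(U, \<phi>)\<in>A. smooth_on (\<phi> ` (U \<inter> V)) (f \<circ> inv_into U \<phi>))"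

definition smooth_near ::
  "('m::topological_space, 'e::euclidean_space) chart set \<Rightarrow> 'm \<Rightarrow> ('m \<Rightarrow> real) \<Rightarrow> bool" where
  "smooth_near A p f \<longleftrightarrow> (\<exists>V. open V \<and> p \<in> V \<and> smooth_fun A V f)"

text \<open>Tangent vectors at \<open>p\<close> are the directional derivatives acting on the functions that are smooth
  near \<open>p\<close>. On all other functions they are given the value 0, so that a tangent vector is determined
  by its action on smooth functions.\<close>

type_synonym 'm tvec = "('m \<Rightarrow> real) \<Rightarrow> real"

definition chart_vec ::
  "('m::topological_space, 'e::euclidean_space) chart set \<Rightarrow> ('m, 'e) chart \<Rightarrow> 'e \<Rightarrow> 'm \<Rightarrow> 'm tvec" where
  "chart_vec A c w p = (\<lambda>f. if smooth_near A p f
     then frechet_derivative (f \<circ> inv_into (fst c) (snd c)) (at (snd c p)) w else 0)"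

definition tangent ::
  "('m::topological_space, 'e::euclidean_space) chart set \<Rightarrow> 'm \<Rightarrow> 'm tvec set" where
  "tangent A p = {chart_vec A c w p | c w. c \<in> A \<and> p \<in> fst c}"

definition vector_fields ::
  "('m::topological_space, 'e::euclidean_space) chart set \<Rightarrow> 'm set \<Rightarrow> ('m \<Rightarrow> 'm tvec) set" where
  "vector_fields A U = {X. (\<forall>p\<in>U. X p \<in> tangent A p) \<and>
     (\<forall>V f. open V \<and> V \<subseteq> U \<and> smooth_fun A V f \<longrightarrow> smooth_fun A V (\<lambda>p. X p f))}"

definition lie_bracket ::
  "('m::topological_space, 'e::euclidean_space) chart set \<Rightarrow>
   ('m \<Rightarrow> 'm tvec) \<Rightarrow> ('m \<Rightarrow> 'm tvec) \<Rightarrow> 'm \<Rightarrow> 'm tvec" where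
  "lie_bracket A X Y p = (\<lambda>f. if smooth_near A p f
     then X p (\<lambda>q. Y q f) - Y p (\<lambda>q. X q f) else 0)"

text \<open>Smooth covariant 2-tensor fields and smooth endomorphism fields.\<close>

definition tensor_field2 ::
  "('m::topological_space, 'e::euclidean_space) chart set \<Rightarrow> ('m \<Rightarrow> 'm tvec \<Rightarrow> 'm tvec \<Rightarrow> real) \<Rightarrow> bool"
  where
  "tensor_field2 A t \<longleftrightarrow> (\<forall>p. bilinear_within (tangent A p) (t p)) \<and>
     (\<forall>U. open U \<longrightarrow> (\<forall>X\<in>vector_fields A U. \<forall>Y\<in>vector_fields A U.
        smooth_fun A U (\<lambda>p. t p (X p) (Y p))))"

definition endo_field ::
  "('m::topological_space, 'e::euclidean_space) chart set \<Rightarrow> ('m \<Rightarrow> 'm tvec \<Rightarrow> 'm tvec) \<Rightarrow> bool" where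
  "endo_field A K \<longleftrightarrow>
     (\<forall>p. K p ` tangent A p \<subseteq> tangent A p \<and> linear_within (tangent A p) (K p)) \<and>
     (\<forall>U. open U \<longrightarrow> (\<forall>X\<in>vector_fields A U. (\<lambda>p. K p (X p)) \<in> vector_fields A U))"

definition two_form ::
  "('m::topological_space, 'e::euclidean_space) chart set \<Rightarrow> ('m \<Rightarrow> 'm tvec \<Rightarrow> 'm tvec \<Rightarrow> real) \<Rightarrow> bool"
  where
  "two_form A t \<longleftrightarrow> tensor_field2 A t \<and>
     (\<forall>p. \<forall>u\<in>tangent A p. \<forall>v\<in>tangent A p. t p u v = - t p v u)"

text \<open>\<open>d t = 0\<close>, by the invariant formula for the exterior derivative.\<close>

definition closed_two_form ::
  "('m::topological_space, 'e::euclidean_space) chart set \<Rightarrow> ('m \<Rightarrow> 'm tvec \<Rightarrow> 'm tvec \<Rightarrow> real) \<Rightarrow> bool"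
  where
  "closed_two_form A t \<longleftrightarrow> two_form A t \<and>
     (\<forall>U. open U \<longrightarrow>
       (\<forall>X\<in>vector_fields A U. \<forall>Y\<in>vector_fields A U. \<forall>Z\<in>vector_fields A U. \<forall>p\<in>U.
          X p (\<lambda>q. t q (Y q) (Z q)) + Y p (\<lambda>q. t q (Z q) (X q)) + Z p (\<lambda>q. t q (X q) (Y q))
          - t p (lie_bracket A X Y p) (Z p) - t p (lie_bracket A Y Z p) (X p)
          - t p (lie_bracket A Z X p) (Y p) = 0))"


section \<open>Pseudo-Riemannian metrics, Levi-Civita connection and curvature\<close>

definition pseudo_riemannian ::
  "('m::topological_space, 'e::euclidean_space) chart set \<Rightarrow> ('m \<Rightarrow> 'm tvec \<Rightarrow> 'm tvec \<Rightarrow> real) \<Rightarrow> bool"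
  where
  "pseudo_riemannian A g \<longleftrightarrow> tensor_field2 A g \<and>
     (\<forall>p. \<forall>u\<in>tangent A p. \<forall>v\<in>tangent A p. g p u v = g p v u) \<and>
     (\<forall>p. \<forall>u\<in>tangent A p. (\<forall>v\<in>tangent A p. g p u v = 0) \<longrightarrow> u = 0)"

text \<open>A connection acts on vector fields defined on arbitrary open sets \<open>U\<close>. The axioms force locality:
  by the Leibniz rule with a function \<open>f\<close> equal to 1 on \<open>U\<close>, the restriction of \<open>D X Y\<close> to \<open>U\<close> does not
  depend on the values of \<open>X\<close> and \<open>Y\<close> outside \<open>U\<close>.\<close>

definition affine_connection ::
  "('m::topological_space, 'e::euclidean_space) chart set \<Rightarrow>
   (('m \<Rightarrow> 'm tvec) \<Rightarrow> ('m \<Rightarrow> 'm tvec) \<Rightarrow> 'm \<Rightarrow> 'm tvec) \<Rightarrow> bool" where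
  "affine_connection A D \<longleftrightarrow>
     (\<forall>U. open U \<longrightarrow>
       (\<forall>X\<in>vector_fields A U. \<forall>Y\<in>vector_fields A U.
          D X Y \<in> vector_fields A U \<and>
          (\<forall>X'\<in>vector_fields A U. \<forall>p\<in>U. D (\<lambda>q. X q + X' q) Y p = D X Y p + D X' Y p) \<and>
          (\<forall>Y'\<in>vector_fields A U. \<forall>p\<in>U. D X (\<lambda>q. Y q + Y' q) p = D X Y p + D X Y' p) \<and>
          (\<forall>f. smooth_fun A U f \<longrightarrow>
            (\<forall>p\<in>U. D (\<lambda>q. f q *\<^sub>R X q) Y p = f p *\<^sub>R D X Y p \<and>
                    D X (\<lambda>q. f q *\<^sub>R Y q) p = X p f *\<^sub>R Y p + f p *\<^sub>R D X Y p))))"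

definition levi_civita ::
  "('m::topological_space, 'e::euclidean_space) chart set \<Rightarrow> ('m \<Rightarrow> 'm tvec \<Rightarrow> 'm tvec \<Rightarrow> real) \<Rightarrow>
   (('m \<Rightarrow> 'm tvec) \<Rightarrow> ('m \<Rightarrow> 'm tvec) \<Rightarrow> 'm \<Rightarrow> 'm tvec) \<Rightarrow> bool" where
  "levi_civita A g D \<longleftrightarrow> affine_connection A D \<and>
     (\<forall>U. open U \<longrightarrow>
       (\<forall>X\<in>vector_fields A U. \<forall>Y\<in>vector_fields A U. \<forall>p\<in>U.
          D X Y p - D Y X p = lie_bracket A X Y p \<and>
          (\<forall>Z\<in>vector_fields A U.
             X p (\<lambda>q. g q (Y q) (Z q)) = g p (D X Y p) (Z p) + g p (Y p) (D X Z p))))"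

definition curvature ::
  "('m::topological_space, 'e::euclidean_space) chart set \<Rightarrow>
   (('m \<Rightarrow> 'm tvec) \<Rightarrow> ('m \<Rightarrow> 'm tvec) \<Rightarrow> 'm \<Rightarrow> 'm tvec) \<Rightarrow>
   ('m \<Rightarrow> 'm tvec) \<Rightarrow> ('m \<Rightarrow> 'm tvec) \<Rightarrow> ('m \<Rightarrow> 'm tvec) \<Rightarrow> 'm \<Rightarrow> 'm tvec" where
  "curvature A D X Y Z p = D X (D Y Z) p - D Y (D X Z) p - D (lie_bracket A X Y) Z p"

text \<open>The value of the curvature tensor on tangent vectors at \<open>p\<close>: the common value of
  \<open>R(X,Y)Z\<close> at \<open>p\<close> for all local extensions of the vectors to vector fields.\<close>

definition curvature_at ::
  "('m::topological_space, 'e::euclidean_space) chart set \<Rightarrow>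
   (('m \<Rightarrow> 'm tvec) \<Rightarrow> ('m \<Rightarrow> 'm tvec) \<Rightarrow> 'm \<Rightarrow> 'm tvec) \<Rightarrow>
   'm \<Rightarrow> 'm tvec \<Rightarrow> 'm tvec \<Rightarrow> 'm tvec \<Rightarrow> 'm tvec" where
  "curvature_at A D p u v w =
     (THE r. \<exists>U X Y Z. open U \<and> p \<in> U \<and>
        X \<in> vector_fields A U \<and> Y \<in> vector_fields A U \<and> Z \<in> vector_fields A U \<and>
        X p = u \<and> Y p = v \<and> Z p = w \<and> r = curvature A D X Y Z p)"

definition ricci ::
  "('m::topological_space, 'e::euclidean_space) chart set \<Rightarrow>
   (('m \<Rightarrow> 'm tvec) \<Rightarrow> ('m \<Rightarrow> 'm tvec) \<Rightarrow> 'm \<Rightarrow> 'm tvec) \<Rightarrow>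
   'm \<Rightarrow> 'm tvec \<Rightarrow> 'm tvec \<Rightarrow> real" where
  "ricci A D p u v = trace_on (tangent A p) (\<lambda>w. curvature_at A D p w u v)"


section \<open>Para-complex and para-Kaehler structures\<close>

text \<open>The model space \<open>real ^ 'n \<times> real ^ 'n\<close> has dimension \<open>2n\<close>, \<open>n = CARD('n)\<close>.\<close>

definition para_complex ::
  "('m::topological_space, (real ^ 'n) \<times> (real ^ 'n)) chart set \<Rightarrow>
   ('m \<Rightarrow> 'm tvec \<Rightarrow> 'm tvec) \<Rightarrow> bool" where
  "para_complex A K \<longleftrightarrow> endo_field A K \<and>
     (\<forall>p. \<forall>u\<in>tangent A p. K p (K p u) = u) \<and>
     (\<forall>p. \<forall>s\<in>{1, -1}. dim {u \<in> tangent A p. K p u = s *\<^sub>R u} = CARD('n)) \<and>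
     (\<forall>U. open U \<longrightarrow> (\<forall>s\<in>{1, -1}. \<forall>X\<in>vector_fields A U. \<forall>Y\<in>vector_fields A U.
        (\<forall>p\<in>U. K p (X p) = s *\<^sub>R X p \<and> K p (Y p) = s *\<^sub>R Y p) \<longrightarrow>
        (\<forall>p\<in>U. K p (lie_bracket A X Y p) = s *\<^sub>R lie_bracket A X Y p)))"

text \<open>\<open>D\<close> is the Levi-Civita connection of \<open>g\<close>, hence determined by \<open>A\<close> and \<open>g\<close> (on smooth fields).\<close>

definition para_kaehler ::
  "('m::{t2_space, second_countable_topology}, (real ^ 'n) \<times> (real ^ 'n)) chart set \<Rightarrow>
   ('m \<Rightarrow> 'm tvec \<Rightarrow> 'm tvec) \<Rightarrow>
   ('m \<Rightarrow> 'm tvec \<Rightarrow> 'm tvec \<Rightarrow> real) \<Rightarrow> ('m \<Rightarrow> 'm tvec \<Rightarrow> 'm tvec \<Rightarrow> real) \<Rightarrow>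
   (('m \<Rightarrow> 'm tvec) \<Rightarrow> ('m \<Rightarrow> 'm tvec) \<Rightarrow> 'm \<Rightarrow> 'm tvec) \<Rightarrow> bool" where
  "para_kaehler A K \<omega> g D \<longleftrightarrow>
     smooth_structure A \<and> pseudo_riemannian A g \<and> levi_civita A g D \<and> para_complex A K \<and>
     (\<forall>p. \<forall>u\<in>tangent A p. \<forall>v\<in>tangent A p. g p (K p u) v = - g p u (K p v)) \<and>
     (\<forall>U. open U \<longrightarrow> (\<forall>X\<in>vector_fields A U. \<forall>Y\<in>vector_fields A U. \<forall>p\<in>U.
        D X (\<lambda>q. K q (Y q)) p = K p (D X Y p))) \<and>
     (\<forall>p. \<forall>u\<in>tangent A p. \<forall>v\<in>tangent A p. \<omega> p u v = g p u (K p v))"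

definition ricci_form ::
  "('m::topological_space, 'e::euclidean_space) chart set \<Rightarrow> ('m \<Rightarrow> 'm tvec \<Rightarrow> 'm tvec) \<Rightarrow>
   (('m \<Rightarrow> 'm tvec) \<Rightarrow> ('m \<Rightarrow> 'm tvec) \<Rightarrow> 'm \<Rightarrow> 'm tvec) \<Rightarrow>
   'm \<Rightarrow> 'm tvec \<Rightarrow> 'm tvec \<Rightarrow> real" where
  "ricci_form A K D p u v = ricci A D p u (K p v)"


section \<open>Para-complexification\<close>

text \<open>An element \<open>u + e v\<close> of the para-complexified tangent space is encoded as the para-complex valued
  derivation \<open>f \<mapsto> u f + e (v f)\<close> on real functions; \<open>capply\<close> is its extension to para-complex
  valued functions.\<close>

type_synonym 'm ctvec = "('m \<Rightarrow> real) \<Rightarrow> para"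

definition ctangent ::
  "('m::topological_space, 'e::euclidean_space) chart set \<Rightarrow> 'm \<Rightarrow> 'm ctvec set" where
  "ctangent A p = {W. para_re \<circ> W \<in> tangent A p \<and> para_im \<circ> W \<in> tangent A p}"

definition capply :: "'m ctvec \<Rightarrow> ('m \<Rightarrow> para) \<Rightarrow> para" where
  "capply W f = W (para_re \<circ> f) + para_e * W (para_im \<circ> f)"

text \<open>Para-complex bilinear extension of a real bilinear form, and para-complex linear extension of a
  real endomorphism.\<close>

definition cbilinear_ext :: "('m tvec \<Rightarrow> 'm tvec \<Rightarrow> real) \<Rightarrow> 'm ctvec \<Rightarrow> 'm ctvec \<Rightarrow> para" where
  "cbilinear_ext t W W' =
     of_real (t (para_re \<circ> W) (para_re \<circ> W') + t (para_im \<circ> W) (para_im \<circ> W')) +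
     para_e * of_real (t (para_re \<circ> W) (para_im \<circ> W') + t (para_im \<circ> W) (para_re \<circ> W'))"

definition clinear_ext :: "('m tvec \<Rightarrow> 'm tvec) \<Rightarrow> 'm ctvec \<Rightarrow> 'm ctvec" where
  "clinear_ext F W = (\<lambda>f. of_real (F (para_re \<circ> W) f) + para_e * of_real (F (para_im \<circ> W) f))"

definition wedge :: "('m ctvec \<Rightarrow> para) \<Rightarrow> ('m ctvec \<Rightarrow> para) \<Rightarrow> 'm ctvec \<Rightarrow> 'm ctvec \<Rightarrow> para" where
  "wedge \<alpha> \<beta> W W' = \<alpha> W * \<beta> W' - \<alpha> W' * \<beta> W"

text \<open>Para-complex covectors at \<open>p\<close> with \<open>\<theta> \<circ> K = c \<theta>\<close>: those with \<open>c = e\<close> are of type (1,0), those with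
  \<open>c = - e\<close> of type (0,1).\<close>

definition ccovector_type ::
  "('m::topological_space, 'e::euclidean_space) chart set \<Rightarrow> ('m \<Rightarrow> 'm tvec \<Rightarrow> 'm tvec) \<Rightarrow>
   para \<Rightarrow> 'm \<Rightarrow> ('m ctvec \<Rightarrow> para) \<Rightarrow> bool" where
  "ccovector_type A K c p \<theta> \<longleftrightarrow>
     (\<forall>W\<in>ctangent A p. \<forall>W'\<in>ctangent A p. \<forall>a b.
        \<theta> (\<lambda>f. a * W f + b * W' f) = a * \<theta> W + b * \<theta> W') \<and>
     (\<forall>W\<in>ctangent A p. \<theta> (clinear_ext (K p) W) = c * \<theta> W)"


section \<open>Local para-holomorphic coordinates\<close>

definition real_chart :: "'m set \<Rightarrow> ('m \<Rightarrow> para ^ 'n) \<Rightarrow> ('m, (real ^ 'n) \<times> (real ^ 'n)) chart" where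
  "real_chart U z = (U, \<lambda>q. (\<chi> \<alpha>. para_re (z q $ \<alpha>), \<chi> \<alpha>. para_im (z q $ \<alpha>)))"

definition dz :: "('m \<Rightarrow> para ^ 'n) \<Rightarrow> 'n \<Rightarrow> 'm ctvec \<Rightarrow> para" where
  "dz z \<alpha> W = capply W (\<lambda>q. z q $ \<alpha>)"

definition dzbar :: "('m \<Rightarrow> para ^ 'n) \<Rightarrow> 'n \<Rightarrow> 'm ctvec \<Rightarrow> para" where
  "dzbar z \<alpha> W = capply W (\<lambda>q. para_cnj (z q $ \<alpha>))"

definition para_hol_coords ::
  "('m::topological_space, (real ^ 'n) \<times> (real ^ 'n)) chart set \<Rightarrow>
   ('m \<Rightarrow> 'm tvec \<Rightarrow> 'm tvec) \<Rightarrow> 'm set \<Rightarrow> ('m \<Rightarrow> para ^ 'n) \<Rightarrow> bool" where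
  "para_hol_coords A K U z \<longleftrightarrow> real_chart U z \<in> A \<and>
     (\<forall>p\<in>U. \<forall>W\<in>ctangent A p. \<forall>\<alpha>. dz z \<alpha> (clinear_ext (K p) W) = para_e * dz z \<alpha> W)"

text \<open>The para-complex coordinate fields \<open>1/2 (\<partial>/\<partial>x + e \<partial>/\<partial>y)\<close> and \<open>1/2 (\<partial>/\<partial>x - e \<partial>/\<partial>y)\<close>.\<close>

definition vec_z ::
  "('m::topological_space, (real ^ 'n) \<times> (real ^ 'n)) chart set \<Rightarrow> 'm set \<Rightarrow> ('m \<Rightarrow> para ^ 'n) \<Rightarrow>
   'n \<Rightarrow> 'm \<Rightarrow> 'm ctvec" where
  "vec_z A U z \<alpha> p = (\<lambda>f. (1/2) *\<^sub>R
     (of_real (chart_vec A (real_chart U z) (axis \<alpha> 1, 0) p f) +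
      para_e * of_real (chart_vec A (real_chart U z) (0, axis \<alpha> 1) p f)))"

definition vec_zbar ::
  "('m::topological_space, (real ^ 'n) \<times> (real ^ 'n)) chart set \<Rightarrow> 'm set \<Rightarrow> ('m \<Rightarrow> para ^ 'n) \<Rightarrow>
   'n \<Rightarrow> 'm \<Rightarrow> 'm ctvec" where
  "vec_zbar A U z \<alpha> p = (\<lambda>f. (1/2) *\<^sub>R
     (of_real (chart_vec A (real_chart U z) (axis \<alpha> 1, 0) p f) -
      para_e * of_real (chart_vec A (real_chart U z) (0, axis \<alpha> 1) p f)))"

definition partial_z ::
  "('m::topological_space, (real ^ 'n) \<times> (real ^ 'n)) chart set \<Rightarrow> 'm set \<Rightarrow> ('m \<Rightarrow> para ^ 'n) \<Rightarrow>
   'n \<Rightarrow> ('m \<Rightarrow> para) \<Rightarrow> 'm \<Rightarrow> para" where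
  "partial_z A U z \<alpha> f p = capply (vec_z A U z \<alpha> p) f"

definition partial_zbar ::
  "('m::topological_space, (real ^ 'n) \<times> (real ^ 'n)) chart set \<Rightarrow> 'm set \<Rightarrow> ('m \<Rightarrow> para ^ 'n) \<Rightarrow>
   'n \<Rightarrow> ('m \<Rightarrow> para) \<Rightarrow> 'm \<Rightarrow> para" where
  "partial_zbar A U z \<alpha> f p = capply (vec_zbar A U z \<alpha> p) f"

text \<open>The operators \<open>\<partial>\<close> and \<open>\<partial>bar\<close> on functions, i.e. the (1,0) and (0,1) parts of \<open>df\<close>, and \<open>\<partial>\<close> on
  1-forms: \<open>\<partial> (\<Sum> a\<^sub>\<alpha> dz\<^sup>\<alpha> + \<Sum> b\<^sub>\<alpha> dzbar\<^sup>\<alpha>) = \<Sum> \<partial>a\<^sub>\<alpha> \<and> dz\<^sup>\<alpha> + \<Sum> \<partial>b\<^sub>\<alpha> \<and> dzbar\<^sup>\<alpha>\<close>, where \<open>a\<^sub>\<alpha>\<close> and \<open>b\<^sub>\<alpha>\<close> are the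
  values of the form on the coordinate fields.\<close>

definition del_fun ::
  "('m::topological_space, (real ^ 'n) \<times> (real ^ 'n)) chart set \<Rightarrow> 'm set \<Rightarrow> ('m \<Rightarrow> para ^ 'n) \<Rightarrow>
   ('m \<Rightarrow> para) \<Rightarrow> 'm \<Rightarrow> 'm ctvec \<Rightarrow> para" where
  "del_fun A U z f p W = (\<Sum>\<alpha>\<in>UNIV. partial_z A U z \<alpha> f p * dz z \<alpha> W)"

definition delbar_fun ::
  "('m::topological_space, (real ^ 'n) \<times> (real ^ 'n)) chart set \<Rightarrow> 'm set \<Rightarrow> ('m \<Rightarrow> para ^ 'n) \<Rightarrow>
   ('m \<Rightarrow> para) \<Rightarrow> 'm \<Rightarrow> 'm ctvec \<Rightarrow> para" where
  "delbar_fun A U z f p W = (\<Sum>\<alpha>\<in>UNIV. partial_zbar A U z \<alpha> f p * dzbar z \<alpha> W)"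

definition del_form ::
  "('m::topological_space, (real ^ 'n) \<times> (real ^ 'n)) chart set \<Rightarrow> 'm set \<Rightarrow> ('m \<Rightarrow> para ^ 'n) \<Rightarrow>
   ('m \<Rightarrow> 'm ctvec \<Rightarrow> para) \<Rightarrow> 'm \<Rightarrow> 'm ctvec \<Rightarrow> 'm ctvec \<Rightarrow> para" where
  "del_form A U z \<theta> p W W' =
     (\<Sum>\<alpha>\<in>UNIV. wedge (del_fun A U z (\<lambda>q. \<theta> q (vec_z A U z \<alpha> q)) p) (dz z \<alpha>) W W') +
     (\<Sum>\<alpha>\<in>UNIV. wedge (del_fun A U z (\<lambda>q. \<theta> q (vec_zbar A U z \<alpha> q)) p) (dzbar z \<alpha>) W W')"

text \<open>A 2-form of type (1,1) is generated by wedge products of a (1,0) and a (0,1) covector. The first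
  clause says this pointwise and does not presuppose local para-holomorphic coordinates; the second
  one says it in terms of \<open>dz\<^sup>\<alpha> \<and> dzbar\<^sup>\<beta>\<close> with smooth coefficients.\<close>

definition type_1_1 ::
  "('m::topological_space, (real ^ 'n) \<times> (real ^ 'n)) chart set \<Rightarrow> ('m \<Rightarrow> 'm tvec \<Rightarrow> 'm tvec) \<Rightarrow>
   ('m \<Rightarrow> 'm tvec \<Rightarrow> 'm tvec \<Rightarrow> real) \<Rightarrow> bool" where
  "type_1_1 A K t \<longleftrightarrow>
     (\<forall>p. \<exists>(m::nat) \<theta> \<eta>.
        (\<forall>i<m. ccovector_type A K para_e p (\<theta> i) \<and> ccovector_type A K (- para_e) p (\<eta> i)) \<and>
        (\<forall>W\<in>ctangent A p. \<forall>W'\<in>ctangent A p.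
           cbilinear_ext (t p) W W' = (\<Sum>i<m. wedge (\<theta> i) (\<eta> i) W W'))) \<and>
     (\<forall>U z. para_hol_coords A K U z \<longrightarrow>
        (\<exists>c. (\<forall>\<alpha> \<beta>. smooth_fun A U (para_re \<circ> c \<alpha> \<beta>) \<and> smooth_fun A U (para_im \<circ> c \<alpha> \<beta>)) \<and>
           (\<forall>p\<in>U. \<forall>W\<in>ctangent A p. \<forall>W'\<in>ctangent A p.
              cbilinear_ext (t p) W W' =
              (\<Sum>\<alpha>\<in>UNIV. \<Sum>\<beta>\<in>UNIV. c \<alpha> \<beta> p * wedge (dz z \<alpha>) (dzbar z \<beta>) W W'))))"

text \<open>The function \<open>log (det g)\<close>, with \<open>log\<close> the logarithm of the absolute value. The determinant is
  a real and nowhere vanishing para-complex number, so it is identified with its real part.\<close>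

definition metric_det ::
  "('m::topological_space, (real ^ 'n) \<times> (real ^ 'n)) chart set \<Rightarrow> 'm set \<Rightarrow> ('m \<Rightarrow> para ^ 'n) \<Rightarrow>
   ('m \<Rightarrow> 'm tvec \<Rightarrow> 'm tvec \<Rightarrow> real) \<Rightarrow> 'm \<Rightarrow> para" where
  "metric_det A U z g p =
     det (\<chi> \<alpha> \<beta>. cbilinear_ext (g p) (vec_z A U z \<alpha> p) (vec_zbar A U z \<beta> p))"

definition log_metric_det ::
  "('m::topological_space, (real ^ 'n) \<times> (real ^ 'n)) chart set \<Rightarrow> 'm set \<Rightarrow> ('m \<Rightarrow> para ^ 'n) \<Rightarrow>
   ('m \<Rightarrow> 'm tvec \<Rightarrow> 'm tvec \<Rightarrow> real) \<Rightarrow> 'm \<Rightarrow> para" where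
  "log_metric_det A U z g p = of_real (ln \<bar>para_re (metric_det A U z g p)\<bar>)"

end

theory Submission
  imports Defs
begin

text \<open>
The Kaehler argument carries over. It rests on one formula for the Ricci form \<open>\<rho>(u, v) = Ric(u, K v)\<close>,
namely \<open>\<rho>(u, v) = - tr (K R(u, v)) / 2\<close>. The formula is linear algebra at a point: \<open>K\<close> is parallel and skew,
so the curvature commutes with \<open>K\<close>, and pair symmetry gives \<open>R(K u, K v) = - R(u, v)\<close>; this makes \<open>\<rho>\<close> skew, and
the first Bianchi identity finishes the proof (\<open>ric_K_eq_trace\<close>, \<open>ricci_form_trace\<close>). The same symmetries
yield \<open>\<rho>(K u, K v) = - \<rho>(u, v)\<close>, which says that \<open>\<rho>\<close> pairs only vectors of type (1,0) with vectors of type (0,1),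
i.e. that \<open>\<rho>\<close> is of type (1,1) (\<open>ricci_form_type_1_1_at\<close>).

Closedness is the second Bianchi identity. For vector fields \<open>X, Y, Z\<close>, differentiating \<open>tr (K R(Y, Z))\<close>
along \<open>X\<close> gives \<open>tr (K [D\<^sub>X, R(Y, Z)])\<close>, because the trace and \<open>K\<close> are parallel (\<open>trace_derivative\<close>). The cyclic sum
that defines the exterior derivative is then the trace of \<open>K\<close> times an operator that vanishes by the Jacobi
identity (\<open>second_bianchi\<close>, \<open>ricci_form_closed\<close>).

In para-holomorphic coordinates \<open>z = x + e y\<close> the map \<open>K\<close> interchanges \<open>\<partial>/\<partial>x\<close> and \<open>\<partial>/\<partial>y\<close>. The real fields
\<open>\<xi> = \<partial>/\<partial>x + \<partial>/\<partial>y\<close> and \<open>\<eta> = \<partial>/\<partial>x - \<partial>/\<partial>y\<close> span the eigenspaces of \<open>K\<close>, and they commute. So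
\<open>D\<^sub>\<eta> \<xi> = D\<^sub>\<xi> \<eta> = 0\<close>, since this field lies in both eigenspaces of the parallel \<open>K\<close>.
Therefore the connection on the span of the \<open>\<xi>\<close> is \<open>(\<xi> h) h\<^sup>-\<^sup>1\<close> with \<open>h = g(\<xi>, \<eta>) / 4\<close>, its trace is the
logarithmic derivative of \<open>det h\<close> by Jacobi's formula, and the curvature trace becomes
\<open>\<rho>(\<xi>, \<eta>) = \<eta> (\<xi> (log |det h|))\<close> (\<open>ricci_form_\<xi>_\<eta>\<close>). The ring of para-complex numbers is \<open>\<real> \<times> \<real>\<close> by
\<open>a + e b \<mapsto> (a + b, a - b)\<close>; under this isomorphism the matrix of the \<open>g(\<partial>/\<partial>z, \<partial>/\<partial>zbar)\<close> corresponds to \<open>h\<close> and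
its transpose, so that its determinant is \<open>det h\<close>, and the real formula translates into the formulas for \<open>\<rho>\<close>
and Ric with \<open>\<partial>/\<partial>z\<close> and \<open>\<partial>/\<partial>zbar\<close>.

Tangent vectors are derivations here, and fields live on arbitrary open sets. Locality and tensoriality of
connection and curvature, the independence of the trace of a basis, and the calculus of smooth functions
behind the Lie bracket are therefore established first.
\<close>

section \<open>Calculus of smooth functions on open sets\<close>

lemma Ck_on_cong:
  assumes "open S" "\<And>x. x \<in> S \<Longrightarrow> f x = g x" "Ck_on k S f"
  shows "Ck_on k S g"
  using assms(2,3)
proof (induction k arbitrary: f g)
  case 0
  then show ?case by (simp cong: continuous_on_cong)
next
  case (Suc k)
  have hd: "(g has_derivative frechet_derivative f (at x)) (at x)" if "x \<in> S" for x
    using Suc.prems that assms(1)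
    by (intro has_derivative_transform_within_open[of f _ x UNIV S g]) (auto simp: frechet_derivative_works)
  then have eq: "frechet_derivative f (at x) = frechet_derivative g (at x)" if "x \<in> S" for x
    using frechet_derivative_at that by blast
  show ?case
    unfolding Ck_on.simps
  proof (intro conjI ballI allI)
    show "g differentiable (at x)" if "x \<in> S" for x
      using hd[OF that] by (auto simp: differentiable_def)
    show "Ck_on k S (\<lambda>x. frechet_derivative g (at x) v)" for v
      using Suc.IH[of "\<lambda>x. frechet_derivative f (at x) v" "\<lambda>x. frechet_derivative g (at x) v"]
        Suc.prems eq by auto
  qed
qed

text \<open>The closure properties of \<open>Ck_on\<close> go by induction on the order; with this rule the induction
  step only has to exhibit a derivative, whichever way it is written.\<close>

lemma Ck_on_SucI:
  assumes "open S" "\<And>x. x \<in> S \<Longrightarrow> (f has_derivative f' x) (at x)"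
    and "\<And>v. Ck_on k S (\<lambda>x. f' x v)"
  shows "Ck_on (Suc k) S f"
  unfolding Ck_on.simps
proof (intro conjI ballI allI)
  show "f differentiable (at x)" if "x \<in> S" for x
    using assms(2)[OF that] by (auto simp: differentiable_def)
  show "Ck_on k S (\<lambda>x. frechet_derivative f (at x) v)" for v
    by (rule Ck_on_cong[OF assms(1) _ assms(3)[of v]]) (use assms(2) frechet_derivative_at in metis)
qed

lemma Ck_on_subset: "Ck_on k S f \<Longrightarrow> T \<subseteq> S \<Longrightarrow> Ck_on k T f"
  by (induction k arbitrary: f) (auto intro: continuous_on_subset)

lemma Ck_on_SucD: "Ck_on (Suc k) S f \<Longrightarrow> Ck_on k S f"
proof (induction k arbitrary: f)
  case 0
  then show ?case
    by (auto intro!: differentiable_imp_continuous_on differentiable_at_imp_differentiable_on)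
next
  case (Suc k)
  then show ?case by (metis Ck_on.simps(2))
qed

lemma Ck_on_local:
  assumes "\<And>x. x \<in> S \<Longrightarrow> \<exists>T. open T \<and> x \<in> T \<and> Ck_on k T f"
  shows "Ck_on k S f"
  using assms
proof (induction k arbitrary: f)
  case 0
  have "continuous (at x) f" if "x \<in> S" for x
    using 0[OF that] continuous_on_eq_continuous_at by auto
  then show ?case by (simp add: continuous_at_imp_continuous_on)
next
  case (Suc k)
  show ?case
    unfolding Ck_on.simps
  proof (intro conjI ballI allI)
    show "f differentiable (at x)" if "x \<in> S" for x
      using Suc.prems[OF that] by auto
    show "Ck_on k S (\<lambda>x. frechet_derivative f (at x) v)" for v
      by (rule Suc.IH) (use Suc.prems in force)
  qed
qed

lemma Ck_on_const: "Ck_on k S (\<lambda>x. c)"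
  by (induction k arbitrary: c) auto

lemma Ck_on_bounded_linear:
  assumes "bounded_linear L" "open S" "Ck_on k S f"
  shows "Ck_on k S (\<lambda>x. L (f x))"
  using assms(3)
proof (induction k arbitrary: f)
  case 0
  then show ?case by (simp add: bounded_linear.continuous_on[OF assms(1)])
next
  case (Suc k)
  have hd: "((\<lambda>x. L (f x)) has_derivative (\<lambda>v. L (frechet_derivative f (at x) v))) (at x)"
    if "x \<in> S" for x
    using Suc.prems that
    by (intro bounded_linear.has_derivative[OF assms(1)]) (auto simp: frechet_derivative_works)
  show ?case
    by (rule Ck_on_SucI[OF assms(2) hd]) (use Suc in auto)
qed

lemma Ck_on_bounded_linear_id:
  assumes "bounded_linear L" "open S"
  shows "Ck_on k S L"
proof (cases k)
  case 0
  then show ?thesis using assms by (simp add: linear_continuous_on)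
next
  case (Suc l)
  have "frechet_derivative L (at x) = L" for x
    using bounded_linear_imp_has_derivative[OF assms(1)] frechet_derivative_at by metis
  then show ?thesis
    unfolding Suc using bounded_linear_imp_differentiable[OF assms(1)] by (simp add: Ck_on_const)
qed

lemma Ck_on_add:
  fixes f g :: "'a::euclidean_space \<Rightarrow> 'b::real_normed_vector"
  assumes "open S" "Ck_on k S f" "Ck_on k S g"
  shows "Ck_on k S (\<lambda>x. f x + g x)"
  using assms(2,3)
proof (induction k arbitrary: f g)
  case 0
  then show ?case by (simp add: continuous_on_add)
next
  case (Suc k)
  have hd: "((\<lambda>x. f x + g x) has_derivative
      (\<lambda>v. frechet_derivative f (at x) v + frechet_derivative g (at x) v)) (at x)" if "x \<in> S" for x
    using Suc.prems that by (intro has_derivative_add) (auto simp: frechet_derivative_works)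
  show ?case
    by (rule Ck_on_SucI[OF assms(1) hd]) (use Suc in auto)
qed

lemma Ck_on_mult:
  fixes f g :: "'a::euclidean_space \<Rightarrow> real"
  assumes "open S" "Ck_on k S f" "Ck_on k S g"
  shows "Ck_on k S (\<lambda>x. f x * g x)"
  using assms(2,3)
proof (induction k arbitrary: f g)
  case 0
  then show ?case by (simp add: continuous_on_mult)
next
  case (Suc k)
  have hd: "((\<lambda>x. f x * g x) has_derivative
      (\<lambda>v. f x * frechet_derivative g (at x) v + frechet_derivative f (at x) v * g x)) (at x)"
    if "x \<in> S" for x
    using Suc.prems that by (intro has_derivative_mult) (auto simp: frechet_derivative_works)
  have "Ck_on k S f" "Ck_on k S g" using Suc.prems by (auto intro: Ck_on_SucD)
  then show ?case
    using Suc by (intro Ck_on_SucI[OF assms(1) hd] Ck_on_add[OF assms(1)] Suc.IH) auto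
qed

lemma Ck_on_sum:
  fixes f :: "'i \<Rightarrow> 'a::euclidean_space \<Rightarrow> 'b::real_normed_vector"
  assumes "open S" "\<And>i. i \<in> I \<Longrightarrow> Ck_on k S (f i)"
  shows "Ck_on k S (\<lambda>x. \<Sum>i\<in>I. f i x)"
  using assms(2)
  by (induction I rule: infinite_finite_induct) (auto intro: Ck_on_const Ck_on_add[OF assms(1)])

lemma Ck_on_inverse:
  fixes f :: "'a::euclidean_space \<Rightarrow> real"
  assumes "open S" "\<And>x. x \<in> S \<Longrightarrow> f x \<noteq> 0" "Ck_on k S f"
  shows "Ck_on k S (\<lambda>x. inverse (f x))"
  using assms(3)
proof (induction k)
  case 0
  then show ?case using assms(2) by (auto intro: continuous_on_inverse)
next
  case (Suc k)
  have hd: "((\<lambda>x. inverse (f x)) has_derivative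
      (\<lambda>v. (-1) * (inverse (f x) * frechet_derivative f (at x) v * inverse (f x)))) (at x)"
    if "x \<in> S" for x
    using Suc.prems that assms(2) 
    by (auto intro!: derivative_eq_intros simp: frechet_derivative_works)
  have "Ck_on k S f" using Suc.prems by (auto intro: Ck_on_SucD)
  then show ?case
    using Suc by (intro Ck_on_SucI[OF assms(1) hd] Ck_on_mult[OF assms(1)] Ck_on_const) auto
qed

lemma has_derivative_ln_abs:
  fixes f :: "'a::real_normed_vector \<Rightarrow> real"
  assumes "(f has_derivative f') (at x)" "f x \<noteq> 0"
  shows "((\<lambda>x. ln \<bar>f x\<bar>) has_derivative (\<lambda>v. f' v * inverse (f x))) (at x)"
proof (cases "f x > 0")
  case True
  have "\<forall>\<^sub>F y in at x. f y > 0"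
    using has_derivative_continuous[OF assms(1)] True
    by (metis continuous_within order_tendstoD(1))
  then have ev: "\<forall>\<^sub>F y in at x. ln (f y) = ln \<bar>f y\<bar>"
    by eventually_elim simp
  have "((\<lambda>x. ln (f x)) has_derivative (\<lambda>v. f' v * inverse (f x))) (at x)"
    using assms(1) True by (auto intro!: derivative_eq_intros simp: field_simps)
  then show ?thesis
    by (rule has_derivative_transform_eventually[OF _ ev]) (use True in auto)
next
  case False
  then have neg: "f x < 0" using assms(2) by simp
  have "\<forall>\<^sub>F y in at x. f y < 0"
    using has_derivative_continuous[OF assms(1)] neg
    by (metis continuous_within order_tendstoD(2))
  then have ev: "\<forall>\<^sub>F y in at x. ln (- f y) = ln \<bar>f y\<bar>"
    by eventually_elim simp
  have "((\<lambda>x. ln (- f x)) has_derivative (\<lambda>v. f' v * inverse (f x))) (at x)"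
    using assms(1) neg by (auto intro!: derivative_eq_intros simp: field_simps)
  then show ?thesis
    by (rule has_derivative_transform_eventually[OF _ ev]) (use neg in auto)
qed

lemma Ck_on_ln_abs:
  fixes f :: "'a::euclidean_space \<Rightarrow> real"
  assumes "open S" "\<And>x. x \<in> S \<Longrightarrow> f x \<noteq> 0" "Ck_on k S f"
  shows "Ck_on k S (\<lambda>x. ln \<bar>f x\<bar>)"
proof (cases k)
  case 0
  then show ?thesis using assms by (auto intro!: continuous_intros)
next
  case (Suc l)
  have hd: "((\<lambda>x. ln \<bar>f x\<bar>) has_derivative
      (\<lambda>v. frechet_derivative f (at x) v * inverse (f x))) (at x)" if "x \<in> S" for x
    by (rule has_derivative_ln_abs) (use assms that Suc in \<open>auto simp: frechet_derivative_works\<close>)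
  have "Ck_on l S f" using assms Suc by (auto intro: Ck_on_SucD)
  then show ?thesis
    unfolding Suc using assms Suc
    by (intro Ck_on_SucI[OF assms(1) hd] Ck_on_mult[OF assms(1)] Ck_on_inverse) auto
qed

text \<open>The derivative of the outer map is needed in a direction that varies with the point, but
  \<open>Ck_on\<close> only speaks about constant directions; hence the expansion of the chain rule in a basis.\<close>

lemma Ck_on_compose:
  fixes f :: "'b::euclidean_space \<Rightarrow> real" and h :: "'a::euclidean_space \<Rightarrow> 'b"
  assumes "open S" "h ` S \<subseteq> T" "Ck_on k S h" "Ck_on k T f"
  shows "Ck_on k S (\<lambda>x. f (h x))"
  using assms(3,4)
proof (induction k arbitrary: f)
  case 0
  then show ?case
    using assms(2) continuous_on_compose2[of T f S h] by auto
next
  case (Suc k)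
  let ?D = "\<lambda>x v. \<Sum>b\<in>Basis. (frechet_derivative h (at x) v \<bullet> b) * frechet_derivative f (at (h x)) b"
  have hd: "((\<lambda>x. f (h x)) has_derivative ?D x) (at x)" if x: "x \<in> S" for x
  proof -
    have f': "(f has_derivative frechet_derivative f (at (h x))) (at (h x))"
      using Suc.prems x assms(2) by (auto simp: frechet_derivative_works)
    have h': "(h has_derivative frechet_derivative h (at x)) (at x)"
      using Suc.prems x by (auto simp: frechet_derivative_works)
    interpret F: bounded_linear "frechet_derivative f (at (h x))"
      using f' has_derivative_bounded_linear by blast
    have "frechet_derivative f (at (h x)) w = (\<Sum>b\<in>Basis. (w \<bullet> b) * frechet_derivative f (at (h x)) b)" for w
      by (subst euclidean_representation[of w, symmetric]) (simp only: F.sum F.scaleR real_scaleR_def)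
    then have "(\<lambda>v. frechet_derivative f (at (h x)) (frechet_derivative h (at x) v)) = ?D x"
      by (intro ext)
    then show ?thesis
      using diff_chain_at[OF h' f'] unfolding o_def by simp
  qed
  have "Ck_on k S h" using Suc.prems by (auto intro: Ck_on_SucD)
  then show ?case
    using Suc.prems
    by (intro Ck_on_SucI[OF assms(1) hd] Ck_on_sum[OF assms(1)] Ck_on_mult[OF assms(1)] Suc.IH
          Ck_on_bounded_linear[OF bounded_linear_inner_left assms(1)]) auto
qed

lemma smooth_on_differentiable: "smooth_on S f \<Longrightarrow> x \<in> S \<Longrightarrow> f differentiable (at x)"
  unfolding smooth_on_def by (metis Ck_on.simps(2))

lemma smooth_on_frechet_derivative:
  "smooth_on S f \<Longrightarrow> smooth_on S (\<lambda>x. frechet_derivative f (at x) v)"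
  unfolding smooth_on_def by (metis Ck_on.simps(2))

text \<open>The increment \<open>f(x+tv+tw) - f(x+tv) - f(x+tw) + f(x)\<close> is by two applications of the mean
  value theorem \<open>t\<^sup>2\<close> times a second derivative at a nearby point; it is symmetric in \<open>v\<close> and \<open>w\<close>.\<close>

lemma second_difference_mean_value:
  fixes f :: "'a::euclidean_space \<Rightarrow> real"
  assumes C: "Ck_on 2 S f" and t: "t > 0"
    and S: "\<And>r s. 0 \<le> r \<Longrightarrow> r \<le> t \<Longrightarrow> 0 \<le> s \<Longrightarrow> s \<le> t \<Longrightarrow> x + r *\<^sub>R v + s *\<^sub>R w \<in> S"
  obtains r s where "0 \<le> r" "r \<le> t" "0 \<le> s" "s \<le> t"
    "f (x + t *\<^sub>R v + t *\<^sub>R w) - f (x + t *\<^sub>R v) - f (x + t *\<^sub>R w) + f x =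
     t\<^sup>2 * frechet_derivative (\<lambda>y. frechet_derivative f (at y) v) (at (x + r *\<^sub>R v + s *\<^sub>R w)) w"
proof -
  have f1: "(f has_derivative frechet_derivative f (at y)) (at y)" if "y \<in> S" for y
    using C that by (simp add: numeral_2_eq_2 frechet_derivative_works)
  let ?g = "\<lambda>y. frechet_derivative f (at y) v"
  have f2: "(?g has_derivative frechet_derivative ?g (at y)) (at y)" if "y \<in> S" for y
    using C that by (simp add: numeral_2_eq_2 frechet_derivative_works)
  have line: "((\<lambda>s. F (a + s *\<^sub>R u)) has_real_derivative F' u) (at s)"
    if "(F has_derivative F') (at (a + s *\<^sub>R u))" for F :: "'a \<Rightarrow> real" and F' a u s
  proof -
    have "((\<lambda>s. a + s *\<^sub>R u) has_derivative (\<lambda>h. h *\<^sub>R u)) (at s)"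
      by (auto intro!: derivative_eq_intros)
    from diff_chain_at[OF this that] have "((\<lambda>s. F (a + s *\<^sub>R u)) has_derivative (\<lambda>h. F' (h *\<^sub>R u))) (at s)"
      by (simp add: o_def)
    moreover have "F' (h *\<^sub>R u) = F' u * h" for h
      using that by (simp add: linear_cmul[OF has_derivative_linear])
    ultimately show ?thesis by (simp add: has_field_derivative_def)
  qed
  let ?\<phi> = "\<lambda>r. f (x + t *\<^sub>R w + r *\<^sub>R v) - f (x + r *\<^sub>R v)"
  have "\<exists>r>0. r < t \<and> ?\<phi> t - ?\<phi> 0 =
      (t - 0) * (frechet_derivative f (at (x + t *\<^sub>R w + r *\<^sub>R v)) v - frechet_derivative f (at (x + r *\<^sub>R v)) v)"
  proof (rule MVT2[OF t])
    fix r assume r: "0 \<le> r" "r \<le> t"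
    have "x + t *\<^sub>R w + r *\<^sub>R v \<in> S" "x + r *\<^sub>R v \<in> S"
      using S[of r t] S[of r 0] r t by (simp_all add: algebra_simps)
    then show "(?\<phi> has_real_derivative
       frechet_derivative f (at (x + t *\<^sub>R w + r *\<^sub>R v)) v - frechet_derivative f (at (x + r *\<^sub>R v)) v) (at r)"
      by (intro DERIV_diff line f1)
  qed
  then obtain r where r: "0 < r" "r < t" and \<phi>: "?\<phi> t - ?\<phi> 0 =
      t * (?g (x + t *\<^sub>R w + r *\<^sub>R v) - ?g (x + r *\<^sub>R v))" by auto
  have "\<exists>s>0. s < t \<and> ?g (x + r *\<^sub>R v + t *\<^sub>R w) - ?g (x + r *\<^sub>R v + 0 *\<^sub>R w) =
      (t - 0) * frechet_derivative ?g (at (x + r *\<^sub>R v + s *\<^sub>R w)) w"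
  proof (rule MVT2[OF t])
    fix s assume s: "0 \<le> s" "s \<le> t"
    have "x + r *\<^sub>R v + s *\<^sub>R w \<in> S" using S[of r s] r s by simp
    then show "((\<lambda>s. ?g (x + r *\<^sub>R v + s *\<^sub>R w)) has_real_derivative
       frechet_derivative ?g (at (x + r *\<^sub>R v + s *\<^sub>R w)) w) (at s)"
      by (intro line f2)
  qed
  then obtain s where s: "0 < s" "s < t" and g: "?g (x + r *\<^sub>R v + t *\<^sub>R w) - ?g (x + r *\<^sub>R v) =
      t * frechet_derivative ?g (at (x + r *\<^sub>R v + s *\<^sub>R w)) w" by auto
  have "f (x + t *\<^sub>R v + t *\<^sub>R w) - f (x + t *\<^sub>R v) - f (x + t *\<^sub>R w) + f x = ?\<phi> t - ?\<phi> 0"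
    by (simp add: algebra_simps)
  also have "\<dots> = t * (t * frechet_derivative ?g (at (x + r *\<^sub>R v + s *\<^sub>R w)) w)"
    using \<phi> g by (simp add: algebra_simps)
  finally show thesis
    using that[of r s] r s by (simp add: power2_eq_square)
qed

text \<open>The second difference quotients converge to both mixed derivatives: if these differed,
  continuity would keep them apart near \<open>x\<close>, although some of their values there coincide.\<close>

lemma second_derivative_symmetric:
  fixes f :: "'a::euclidean_space \<Rightarrow> real"
  assumes S: "open S" "x \<in> S" and C: "Ck_on 2 S f"
  shows "frechet_derivative (\<lambda>y. frechet_derivative f (at y) v) (at x) w =
         frechet_derivative (\<lambda>y. frechet_derivative f (at y) w) (at x) v"
proof (rule ccontr)
  let ?D = "\<lambda>v w y. frechet_derivative (\<lambda>y. frechet_derivative f (at y) v) (at y) w"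
  assume ne: "?D v w x \<noteq> ?D w v x"
  define \<epsilon> where "\<epsilon> = \<bar>?D v w x - ?D w v x\<bar> / 2"
  have "\<epsilon> > 0" using ne by (simp add: \<epsilon>_def)
  have cont: "continuous (at x) (?D a b)" for a b
    using C S by (auto simp: numeral_2_eq_2 continuous_on_eq_continuous_at)
  obtain d1 where d1: "d1 > 0" "\<And>y. dist y x < d1 \<Longrightarrow> \<bar>?D v w y - ?D v w x\<bar> < \<epsilon>"
    using cont[of v w] \<open>\<epsilon> > 0\<close> unfolding continuous_at_eps_delta dist_real_def by blast
  obtain d2 where d2: "d2 > 0" "\<And>y. dist y x < d2 \<Longrightarrow> \<bar>?D w v y - ?D w v x\<bar> < \<epsilon>"
    using cont[of w v] \<open>\<epsilon> > 0\<close> unfolding continuous_at_eps_delta dist_real_def by blast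
  obtain d3 where d3: "d3 > 0" "ball x d3 \<subseteq> S"
    using S open_contains_ball by blast
  define d where "d = min d1 (min d2 d3)"
  have "d > 0" using d1 d2 d3 by (simp add: d_def)
  define t where "t = d / (norm v + norm w + 1)"
  have n1: "norm v + norm w + 1 > 0"
    by (smt (verit) norm_ge_zero)
  have t: "t > 0" using \<open>d > 0\<close> n1 unfolding t_def by (rule divide_pos_pos)
  have near: "dist (x + r *\<^sub>R v + s *\<^sub>R w) x < d" if "0 \<le> r" "r \<le> t" "0 \<le> s" "s \<le> t" for r s
  proof -
    have "dist (x + r *\<^sub>R v + s *\<^sub>R w) x = norm (r *\<^sub>R v + s *\<^sub>R w)"
      by (simp add: dist_norm algebra_simps)
    also have "\<dots> \<le> r * norm v + s * norm w"
      using that norm_triangle_ineq[of "r *\<^sub>R v" "s *\<^sub>R w"] by simp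
    also have "\<dots> \<le> t * norm v + t * norm w"
      using that by (intro add_mono mult_right_mono) auto
    also have "\<dots> < t * (norm v + norm w + 1)"
      using t by (simp add: algebra_simps)
    also have "\<dots> = d" using n1 by (simp add: t_def)
    finally show ?thesis .
  qed
  have inS: "x + r *\<^sub>R v + s *\<^sub>R w \<in> S" if "0 \<le> r" "r \<le> t" "0 \<le> s" "s \<le> t" for r s
    using near[OF that] d3 unfolding d_def by (auto simp: dist_commute subset_iff)
  obtain r s where rs: "0 \<le> r" "r \<le> t" "0 \<le> s" "s \<le> t"
    and 1: "f (x + t *\<^sub>R v + t *\<^sub>R w) - f (x + t *\<^sub>R v) - f (x + t *\<^sub>R w) + f x =
     t\<^sup>2 * ?D v w (x + r *\<^sub>R v + s *\<^sub>R w)"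
    using second_difference_mean_value[OF C t inS] by blast
  have inS': "x + r *\<^sub>R w + s *\<^sub>R v \<in> S" if "0 \<le> r" "r \<le> t" "0 \<le> s" "s \<le> t" for r s
    using inS[OF that(3,4,1,2)] by (simp add: algebra_simps)
  obtain r' s' where rs': "0 \<le> r'" "r' \<le> t" "0 \<le> s'" "s' \<le> t"
    and 2: "f (x + t *\<^sub>R w + t *\<^sub>R v) - f (x + t *\<^sub>R w) - f (x + t *\<^sub>R v) + f x =
     t\<^sup>2 * ?D w v (x + r' *\<^sub>R w + s' *\<^sub>R v)"
    using second_difference_mean_value[OF C t inS'] by blast
  have comm: "x + t *\<^sub>R w + t *\<^sub>R v = x + t *\<^sub>R v + t *\<^sub>R w" "x + r' *\<^sub>R w + s' *\<^sub>R v = x + s' *\<^sub>R v + r' *\<^sub>R w"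
    by (simp_all add: algebra_simps)
  have "t\<^sup>2 * ?D v w (x + r *\<^sub>R v + s *\<^sub>R w) = t\<^sup>2 * ?D w v (x + s' *\<^sub>R v + r' *\<^sub>R w)"
    using 1 2 unfolding comm by linarith
  then have "?D v w (x + r *\<^sub>R v + s *\<^sub>R w) = ?D w v (x + s' *\<^sub>R v + r' *\<^sub>R w)"
    using t by simp
  moreover have "\<bar>?D v w (x + r *\<^sub>R v + s *\<^sub>R w) - ?D v w x\<bar> < \<epsilon>"
    by (rule d1(2)) (use near[OF rs] in \<open>simp add: d_def\<close>)
  moreover have "\<bar>?D w v (x + s' *\<^sub>R v + r' *\<^sub>R w) - ?D w v x\<bar> < \<epsilon>"
    by (rule d2(2)) (use near[of s' r'] rs' in \<open>simp add: d_def\<close>)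
  moreover have "\<bar>?D v w x - ?D w v x\<bar> = 2 * \<epsilon>"
    by (simp add: \<epsilon>_def)
  ultimately show False
    by linarith
qed


section \<open>Smooth functions and tangent vectors on a manifold\<close>

lemma sum_fun_apply: "(\<Sum>i\<in>I. F i) x = (\<Sum>i\<in>I. F i x)"
  by (induction I rule: infinite_finite_induct) auto

lemma scaleR_fun_apply [simp]: "(r *\<^sub>R F) x = r *\<^sub>R F x"
  by (simp add: scaleR_fun_def)

locale smooth_atlas =
  fixes A :: "('m::topological_space, 'e::euclidean_space) chart set"
  assumes chart: "c \<in> A \<Longrightarrow> is_chart c"
    and charts_cover: "\<exists>c\<in>A. p \<in> fst c"
    and charts_compatible: "c \<in> A \<Longrightarrow> d \<in> A \<Longrightarrow> compatible_charts c d"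
begin

abbreviation chart_inv :: "('m, 'e) chart \<Rightarrow> 'e \<Rightarrow> 'm" where
  "chart_inv c \<equiv> inv_into (fst c) (snd c)"

abbreviation smooth :: "'m set \<Rightarrow> ('m \<Rightarrow> real) \<Rightarrow> bool" where
  "smooth \<equiv> smooth_fun A"

abbreviation VF :: "'m set \<Rightarrow> ('m \<Rightarrow> 'm tvec) set" where
  "VF \<equiv> vector_fields A"

lemma chart_open: "c \<in> A \<Longrightarrow> open (fst c)"
  using chart[of c] by (auto simp: is_chart_def)

lemma chart_homeomorphism:
  "c \<in> A \<Longrightarrow> homeomorphism (fst c) (snd c ` fst c) (snd c) (chart_inv c)"
  using chart[of c] by (auto simp: is_chart_def split_beta)

lemma chart_inv_chart: "c \<in> A \<Longrightarrow> p \<in> fst c \<Longrightarrow> chart_inv c (snd c p) = p"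
  using chart_homeomorphism[of c] by (simp add: homeomorphism_def)

lemma chart_image_open:
  assumes "c \<in> A" "open V"
  shows "open (snd c ` (fst c \<inter> V))"
proof -
  have "openin (top_of_set (snd c ` fst c)) (snd c ` (fst c \<inter> V))"
    using homeomorphism_imp_open_map[OF chart_homeomorphism[OF assms(1)]] assms(2)
    by (simp add: openin_open_Int)
  moreover have "open (snd c ` fst c)"
    using chart[OF assms(1)] by (auto simp: is_chart_def)
  ultimately show ?thesis
    by (simp add: openin_open_eq)
qed

lemma chart_image_open_subset:
  "c \<in> A \<Longrightarrow> open V \<Longrightarrow> V \<subseteq> fst c \<Longrightarrow> open (snd c ` V)"
  using chart_image_open[of c V] by (simp add: Int_absorb1)

lemma smooth_funD:
  "smooth V f \<Longrightarrow> c \<in> A \<Longrightarrow> smooth_on (snd c ` (fst c \<inter> V)) (f \<circ> chart_inv c)"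
  by (auto simp: smooth_fun_def split_beta)

lemma smooth_funI:
  "(\<And>c. c \<in> A \<Longrightarrow> smooth_on (snd c ` (fst c \<inter> V)) (f \<circ> chart_inv c)) \<Longrightarrow> smooth V f"
  by (auto simp: smooth_fun_def split_beta)

lemma transition_smooth:
  assumes "c \<in> A" "d \<in> A"
  shows "smooth_on (snd d ` (fst d \<inter> fst c)) (snd c \<circ> chart_inv d)"
  using charts_compatible[OF assms] by (auto simp: compatible_charts_def split_beta Int_commute)

text \<open>Transition maps are smooth, so a single chart containing \<open>V\<close> decides smoothness in all charts.\<close>

lemma smooth_fun_chartI:
  assumes c: "c \<in> A" and V: "open V" "V \<subseteq> fst c"
    and f: "smooth_on (snd c ` V) (f \<circ> chart_inv c)"
  shows "smooth V f"
proof (rule smooth_funI)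
  fix d assume d: "d \<in> A"
  let ?S = "snd d ` (fst d \<inter> V)" and ?h = "snd c \<circ> chart_inv d"
  have S: "open ?S" using chart_image_open[OF d V(1)] .
  have eq: "(f \<circ> chart_inv c) (?h x) = (f \<circ> chart_inv d) x" and im: "?h x \<in> snd c ` V" if "x \<in> ?S" for x
    using that V(2) chart_inv_chart[OF c] chart_inv_chart[OF d] by auto
  show "smooth_on ?S (f \<circ> chart_inv d)"
    unfolding smooth_on_def
  proof
    fix k
    have h: "Ck_on k ?S ?h"
      using transition_smooth[OF c d] V(2) unfolding smooth_on_def
      by (auto intro: Ck_on_subset)
    have fk: "Ck_on k (snd c ` V) (f \<circ> chart_inv c)"
      using f by (simp only: smooth_on_def)
    have "?h ` ?S \<subseteq> snd c ` V" using im by (rule image_subsetI)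
    from Ck_on_compose[OF S this h fk] have "Ck_on k ?S (\<lambda>x. (f \<circ> chart_inv c) (?h x))" .
    then show "Ck_on k ?S (f \<circ> chart_inv d)"
      by (rule Ck_on_cong[OF S _, rotated]) (rule eq)
  qed
qed

lemma smooth_fun_local:
  assumes "\<And>p. p \<in> V \<Longrightarrow> \<exists>W. open W \<and> p \<in> W \<and> smooth W f"
  shows "smooth V f"
proof (rule smooth_funI)
  fix c assume c: "c \<in> A"
  show "smooth_on (snd c ` (fst c \<inter> V)) (f \<circ> chart_inv c)"
    unfolding smooth_on_def
  proof (intro allI Ck_on_local)
    fix k x assume "x \<in> snd c ` (fst c \<inter> V)"
    then obtain p where p: "p \<in> fst c" "p \<in> V" "x = snd c p" by auto
    then obtain W where W: "open W" "p \<in> W" "smooth W f" using assms by blast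
    show "\<exists>T. open T \<and> x \<in> T \<and> Ck_on k T (f \<circ> chart_inv c)"
      by (rule exI[of _ "snd c ` (fst c \<inter> W)"])
        (use W p c chart_image_open smooth_funD in \<open>auto simp: smooth_on_def\<close>)
  qed
qed

lemma smooth_fun_subset:
  assumes "smooth V f" "W \<subseteq> V"
  shows "smooth W f"
proof (rule smooth_funI)
  fix c assume c: "c \<in> A"
  then show "smooth_on (snd c ` (fst c \<inter> W)) (f \<circ> chart_inv c)"
    using smooth_funD[OF assms(1) c] assms(2) unfolding smooth_on_def
    by (blast intro: Ck_on_subset)
qed

lemma smooth_fun_cong:
  assumes V: "open V" and eq: "\<And>p. p \<in> V \<Longrightarrow> f p = g p" and f: "smooth V f"
  shows "smooth V g"
proof (rule smooth_funI)
  fix c assume c: "c \<in> A"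
  have S: "open (snd c ` (fst c \<inter> V))" using chart_image_open[OF c V] .
  show "smooth_on (snd c ` (fst c \<inter> V)) (g \<circ> chart_inv c)"
    unfolding smooth_on_def
  proof
    fix k
    have "Ck_on k (snd c ` (fst c \<inter> V)) (f \<circ> chart_inv c)"
      using smooth_funD[OF f c] by (simp add: smooth_on_def)
    then show "Ck_on k (snd c ` (fst c \<inter> V)) (g \<circ> chart_inv c)"
      by (rule Ck_on_cong[OF S, rotated]) (use eq chart_inv_chart[OF c] in auto)
  qed
qed

lemma smooth_fun_const: "smooth V (\<lambda>p. a)"
  by (rule smooth_funI) (simp add: smooth_on_def o_def Ck_on_const)

lemma smooth_fun_add:
  assumes "open V" "smooth V f" "smooth V g"
  shows "smooth V (\<lambda>p. f p + g p)"
  by (rule smooth_funI)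
    (use assms in \<open>auto simp: smooth_on_def o_def intro!: Ck_on_add chart_image_open dest!: smooth_funD\<close>)

lemma smooth_fun_mult:
  assumes "open V" "smooth V f" "smooth V g"
  shows "smooth V (\<lambda>p. f p * g p)"
  by (rule smooth_funI)
    (use assms in \<open>auto simp: smooth_on_def o_def intro!: Ck_on_mult chart_image_open dest!: smooth_funD\<close>)

lemma smooth_fun_minus: "open V \<Longrightarrow> smooth V f \<Longrightarrow> smooth V (\<lambda>p. - f p)"
  using smooth_fun_mult[OF _ smooth_fun_const[of V "- 1"], of f] by simp

lemma smooth_fun_diff: "open V \<Longrightarrow> smooth V f \<Longrightarrow> smooth V g \<Longrightarrow> smooth V (\<lambda>p. f p - g p)"
  using smooth_fun_add[OF _ _ smooth_fun_minus, of V f g] by simp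

lemma smooth_fun_sum:
  assumes "open V" "\<And>i. i \<in> I \<Longrightarrow> smooth V (f i)"
  shows "smooth V (\<lambda>p. \<Sum>i\<in>I. f i p)"
  using assms(2)
  by (induction I rule: infinite_finite_induct)
    (auto intro: smooth_fun_const smooth_fun_add[OF assms(1)])

lemma smooth_fun_prod:
  assumes "open V" "\<And>i. i \<in> I \<Longrightarrow> smooth V (f i)"
  shows "smooth V (\<lambda>p. \<Prod>i\<in>I. f i p)"
  using assms(2)
  by (induction I rule: infinite_finite_induct)
    (auto intro: smooth_fun_const smooth_fun_mult[OF assms(1)])

lemma smooth_fun_ln_abs:
  assumes "open V" "smooth V f" "\<And>p. p \<in> V \<Longrightarrow> f p \<noteq> 0"
  shows "smooth V (\<lambda>p. ln \<bar>f p\<bar>)"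
proof (rule smooth_funI)
  fix c assume c: "c \<in> A"
  have "(f \<circ> chart_inv c) x \<noteq> 0" if "x \<in> snd c ` (fst c \<inter> V)" for x
    using that assms(3) chart_inv_chart[OF c] by auto
  then show "smooth_on (snd c ` (fst c \<inter> V)) ((\<lambda>p. ln \<bar>f p\<bar>) \<circ> chart_inv c)"
    using smooth_funD[OF assms(2) c] chart_image_open[OF c assms(1)]
    by (auto simp: smooth_on_def o_def intro!: Ck_on_ln_abs)
qed

lemma smooth_near_cong:
  assumes "open V" "p \<in> V" "\<And>q. q \<in> V \<Longrightarrow> f q = g q" "smooth_near A p f"
  shows "smooth_near A p g"
proof -
  obtain W where W: "open W" "p \<in> W" "smooth W f"
    using assms(4) by (auto simp: smooth_near_def)
  have "smooth (V \<inter> W) g"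
    by (rule smooth_fun_cong[of _ f])
      (use assms W in \<open>auto intro: smooth_fun_subset[OF W(3)]\<close>)
  then show ?thesis
    unfolding smooth_near_def using W assms by (intro exI[of _ "V \<inter> W"]) auto
qed

lemma smooth_nearI: "open V \<Longrightarrow> p \<in> V \<Longrightarrow> smooth V f \<Longrightarrow> smooth_near A p f"
  by (auto simp: smooth_near_def)

lemma smooth_near_obtain:
  assumes "smooth_near A p f" "open W" "p \<in> W"
  obtains V where "open V" "p \<in> V" "V \<subseteq> W" "smooth V f"
proof -
  obtain V where "open V" "p \<in> V" "smooth V f" using assms(1) by (auto simp: smooth_near_def)
  then show thesis
    using that[of "V \<inter> W"] assms smooth_fun_subset[of V f "V \<inter> W"] by auto
qed

lemma chart_vec_has_derivative:
  assumes "c \<in> A" "p \<in> fst c" "smooth_near A p f"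
  shows "((f \<circ> chart_inv c) has_derivative (\<lambda>w. chart_vec A c w p f)) (at (snd c p))"
proof -
  obtain V where V: "open V" "p \<in> V" "smooth V f" using assms(3) by (auto simp: smooth_near_def)
  have "(f \<circ> chart_inv c) differentiable (at (snd c p))"
    by (rule smooth_on_differentiable[OF smooth_funD[OF V(3) assms(1)]]) (use V assms in auto)
  then show ?thesis
    using assms(3) by (simp add: chart_vec_def frechet_derivative_works)
qed

lemma chart_vec_eqI:
  assumes "c \<in> A" "p \<in> fst c" "smooth_near A p f"
    and "((f \<circ> chart_inv c) has_derivative F) (at (snd c p))"
  shows "chart_vec A c w p f = F w"
  using has_derivative_unique[OF chart_vec_has_derivative[OF assms(1-3)] assms(4)] by metis

lemma chart_vec_linear:
  assumes "c \<in> A" "p \<in> fst c"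
  shows "linear (\<lambda>w. chart_vec A c w p)"
proof (rule linearI)
  have lin: "linear (\<lambda>w. chart_vec A c w p f)" for f
  proof (cases "smooth_near A p f")
    case True
    then show ?thesis using chart_vec_has_derivative[OF assms] has_derivative_linear by blast
  next
    case False
    then show ?thesis by (simp add: chart_vec_def linear_iff)
  qed
  show "chart_vec A c (v + w) p = chart_vec A c v p + chart_vec A c w p" for v w
    using linear_add[OF lin] by (auto simp: fun_eq_iff)
  show "chart_vec A c (r *\<^sub>R v) p = r *\<^sub>R chart_vec A c v p" for r v
    using linear_cmul[OF lin] by (auto simp: fun_eq_iff)
qed

lemma tangentE:
  assumes "v \<in> tangent A p"
  obtains c w where "c \<in> A" "p \<in> fst c" "v = chart_vec A c w p"
  using assms by (auto simp: tangent_def)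

lemma chart_vec_tangent: "c \<in> A \<Longrightarrow> p \<in> fst c \<Longrightarrow> chart_vec A c w p \<in> tangent A p"
  unfolding tangent_def by blast

lemma tangent_not_smooth: "v \<in> tangent A p \<Longrightarrow> \<not> smooth_near A p f \<Longrightarrow> v f = 0"
  by (auto simp: tangent_def chart_vec_def)

text \<open>Tangent vectors have the default value 0 on functions that are not smooth near \<open>p\<close>. Being
  smooth near \<open>p\<close> is a property of the germ, so the default does not disturb locality.\<close>

lemma tangent_germ:
  assumes v: "v \<in> tangent A p" and V: "open V" "p \<in> V" and eq: "\<And>q. q \<in> V \<Longrightarrow> f q = g q"
  shows "v f = v g"
proof (cases "smooth_near A p f")
  case True
  obtain c w where c: "c \<in> A" "p \<in> fst c" "v = chart_vec A c w p" using tangentE[OF v] .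
  have g: "smooth_near A p g" using smooth_near_cong[OF V eq True] .
  have "((g \<circ> chart_inv c) has_derivative (\<lambda>w. chart_vec A c w p f)) (at (snd c p))"
    by (rule has_derivative_transform_within_open[OF chart_vec_has_derivative[OF c(1,2) True]
          chart_image_open[OF c(1) V(1)]])
      (use c V eq chart_inv_chart[OF c(1)] in auto)
  from chart_vec_eqI[OF c(1,2) g this] show ?thesis by (simp add: c(3))
next
  case False
  moreover have "\<not> smooth_near A p g"
    using smooth_near_cong[OF V, of g f] eq False by metis
  ultimately show ?thesis using tangent_not_smooth[OF v] by simp
qed

lemma smooth_near_add:
  assumes f: "smooth_near A p f" and g: "smooth_near A p g"
  shows "smooth_near A p (\<lambda>q. f q + g q)"
proof -
  obtain V where V: "open V" "p \<in> V" "smooth V f" using f by (auto simp: smooth_near_def)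
  obtain W where W: "open W" "p \<in> W" "W \<subseteq> V" "smooth W g" using smooth_near_obtain[OF g V(1,2)] .
  show ?thesis
    by (rule smooth_nearI[OF W(1,2)]) (use W smooth_fun_subset[OF V(3)] in \<open>auto intro: smooth_fun_add\<close>)
qed

lemma smooth_near_mult:
  assumes f: "smooth_near A p f" and g: "smooth_near A p g"
  shows "smooth_near A p (\<lambda>q. f q * g q)"
proof -
  obtain V where V: "open V" "p \<in> V" "smooth V f" using f by (auto simp: smooth_near_def)
  obtain W where W: "open W" "p \<in> W" "W \<subseteq> V" "smooth W g" using smooth_near_obtain[OF g V(1,2)] .
  show ?thesis
    by (rule smooth_nearI[OF W(1,2)]) (use W smooth_fun_subset[OF V(3)] in \<open>auto intro: smooth_fun_mult\<close>)
qed

lemma smooth_near_const: "smooth_near A p (\<lambda>q. a)"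
  by (rule smooth_nearI[of UNIV]) (auto intro: smooth_fun_const)

lemma tangent_const: assumes v: "v \<in> tangent A p" shows "v (\<lambda>q. a) = 0"
proof -
  obtain c w where c: "c \<in> A" "p \<in> fst c" "v = chart_vec A c w p" using tangentE[OF v] .
  from chart_vec_eqI[OF c(1,2) smooth_near_const, where F = "\<lambda>_. 0"] show ?thesis by (simp add: c(3) o_def)
qed

lemma tangent_add:
  assumes v: "v \<in> tangent A p" and f: "smooth_near A p f" and g: "smooth_near A p g"
  shows "v (\<lambda>q. f q + g q) = v f + v g"
proof -
  obtain c w where c: "c \<in> A" "p \<in> fst c" "v = chart_vec A c w p" using tangentE[OF v] .
  from chart_vec_eqI[OF c(1,2) smooth_near_add[OF f g],
      of "\<lambda>w. chart_vec A c w p f + chart_vec A c w p g" w] show ?thesis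
    using has_derivative_add[OF chart_vec_has_derivative[OF c(1,2) f] chart_vec_has_derivative[OF c(1,2) g]]
    by (simp add: c(3) o_def)
qed

lemma tangent_mult:
  assumes v: "v \<in> tangent A p" and f: "smooth_near A p f" and g: "smooth_near A p g"
  shows "v (\<lambda>q. f q * g q) = v f * g p + f p * v g"
proof -
  obtain c w where c: "c \<in> A" "p \<in> fst c" "v = chart_vec A c w p" using tangentE[OF v] .
  from chart_vec_eqI[OF c(1,2) smooth_near_mult[OF f g],
      of "\<lambda>w. f p * chart_vec A c w p g + chart_vec A c w p f * g p" w] show ?thesis
    using has_derivative_mult[OF chart_vec_has_derivative[OF c(1,2) f] chart_vec_has_derivative[OF c(1,2) g]]
    by (simp add: c(3) o_def chart_inv_chart[OF c(1,2)])
qed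

lemma tangent_cmult:
  assumes v: "v \<in> tangent A p" and f: "smooth_near A p f"
  shows "v (\<lambda>q. a * f q) = a * v f"
  using tangent_mult[OF v smooth_near_const f] by (simp add: tangent_const[OF v])

lemma tangent_ln_abs:
  assumes v: "v \<in> tangent A p" and V: "open V" "p \<in> V" and f: "smooth V f"
    and nz: "\<And>q. q \<in> V \<Longrightarrow> f q \<noteq> 0"
  shows "v (\<lambda>q. ln \<bar>f q\<bar>) = v f / f p"
proof -
  obtain c w where c: "c \<in> A" "p \<in> fst c" "v = chart_vec A c w p" using tangentE[OF v] .
  have ln: "smooth_near A p (\<lambda>q. ln \<bar>f q\<bar>)"
    by (rule smooth_nearI[OF V smooth_fun_ln_abs[OF V(1) f nz]])
  have "(f \<circ> chart_inv c) (snd c p) \<noteq> 0" using nz V by (simp add: chart_inv_chart[OF c(1,2)])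
  from has_derivative_ln_abs[OF chart_vec_has_derivative[OF c(1,2) smooth_nearI[OF V f]] this]
  show ?thesis
    using chart_vec_eqI[OF c(1,2) ln] by (simp add: c o_def chart_inv_chart[OF c(1,2)] divide_inverse)
qed

definition coord :: "('m, 'e) chart \<Rightarrow> 'e \<Rightarrow> 'm \<Rightarrow> real" where
  "coord c b = (\<lambda>q. snd c q \<bullet> b)"

lemma coord_comp: "c \<in> A \<Longrightarrow> x \<in> snd c ` fst c \<Longrightarrow> (coord c b \<circ> chart_inv c) x = x \<bullet> b"
  by (auto simp: coord_def chart_inv_chart)

lemma coord_smooth:
  assumes "c \<in> A"
  shows "smooth (fst c) (coord c b)"
proof (rule smooth_fun_chartI[OF assms chart_open[OF assms] subset_refl])
  have S: "open (snd c ` fst c)" using chart_image_open[OF assms, of UNIV] by simp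
  show "smooth_on (snd c ` fst c) (coord c b \<circ> chart_inv c)"
    unfolding smooth_on_def
    by (intro allI Ck_on_cong[OF S _ Ck_on_bounded_linear_id[OF bounded_linear_inner_left S, of _ b]])
      (rule coord_comp[OF assms, symmetric])
qed

lemma coord_smooth_near: "c \<in> A \<Longrightarrow> p \<in> fst c \<Longrightarrow> smooth_near A p (coord c b)"
  using smooth_nearI[OF chart_open _ coord_smooth] by blast

lemma chart_vec_coord:
  assumes "c \<in> A" "p \<in> fst c"
  shows "chart_vec A c w p (coord c b) = w \<bullet> b"
proof (rule chart_vec_eqI[OF assms coord_smooth_near[OF assms]])
  have S: "open (snd c ` fst c)" using chart_image_open[OF assms(1), of UNIV] by simp
  have "((\<lambda>x. x \<bullet> b) has_derivative (\<lambda>w. w \<bullet> b)) (at (snd c p))"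
    by (auto intro!: derivative_eq_intros)
  then show "((coord c b \<circ> chart_inv c) has_derivative (\<lambda>w. w \<bullet> b)) (at (snd c p))"
    by (rule has_derivative_transform_within_open[OF _ S])
      (use assms in \<open>auto simp only: coord_comp[OF assms(1)]\<close>)
qed

definition components :: "('m, 'e) chart \<Rightarrow> 'm tvec \<Rightarrow> 'e" where
  "components c v = (\<Sum>b\<in>Basis. v (coord c b) *\<^sub>R b)"

lemma components_chart_vec:
  "c \<in> A \<Longrightarrow> p \<in> fst c \<Longrightarrow> components c (chart_vec A c w p) = w"
  by (simp add: components_def chart_vec_coord euclidean_representation)

lemma components_inner: "b \<in> Basis \<Longrightarrow> components c v \<bullet> b = v (coord c b)"
  by (simp add: components_def inner_sum_left inner_Basis if_distrib if_distribR cong: if_cong)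

lemma components_linear: "linear (components c)"
  by (auto simp: components_def linear_iff scaleR_add_left sum.distrib scaleR_sum_right)

text \<open>The chain rule for the transition map between the given chart and the one that was used to
  form \<open>v\<close>. It makes the tangent space at \<open>p\<close> a copy of the model space in every chart around \<open>p\<close>.\<close>

lemma chart_vec_components:
  assumes c: "c \<in> A" "p \<in> fst c" and v: "v \<in> tangent A p"
  shows "chart_vec A c (components c v) p = v"
proof
  fix f
  obtain d w where d: "d \<in> A" "p \<in> fst d" "v = chart_vec A d w p" using tangentE[OF v] .
  show "chart_vec A c (components c v) p f = v f"
  proof (cases "smooth_near A p f")
    case True
    let ?h = "snd c \<circ> chart_inv d"
    let ?H = "frechet_derivative ?h (at (snd d p))"
    have h: "(?h has_derivative ?H) (at (snd d p))"
      using smooth_on_differentiable[OF transition_smooth[OF c(1) d(1)], of "snd d p"] c d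
      by (auto simp: frechet_derivative_works)
    have hp: "?h (snd d p) = snd c p" using chart_inv_chart[OF d(1,2)] by simp
    have S: "open (snd d ` (fst d \<inter> fst c))" using chart_image_open[OF d(1) chart_open[OF c(1)]] .
    have chain: "((g \<circ> chart_inv d) has_derivative (\<lambda>w. chart_vec A c (?H w) p g)) (at (snd d p))"
      if "smooth_near A p g" for g
    proof -
      have "((g \<circ> chart_inv c) \<circ> ?h has_derivative (\<lambda>w. chart_vec A c w p g) \<circ> ?H) (at (snd d p))"
        by (rule diff_chain_at[OF h]) (unfold hp, rule chart_vec_has_derivative[OF c that])
      then have "((g \<circ> chart_inv c) \<circ> ?h has_derivative (\<lambda>w. chart_vec A c (?H w) p g)) (at (snd d p))"
        by (simp add: o_def)
      then show ?thesis
        by (rule has_derivative_transform_within_open[OF _ S])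
          (use c d chart_inv_chart in auto)
    qed
    have "v (coord c b) = ?H w \<bullet> b" for b
      using chart_vec_eqI[OF d(1,2) coord_smooth_near[OF c] chain[OF coord_smooth_near[OF c]]]
      by (simp add: d(3) chart_vec_coord[OF c])
    then have "components c v = ?H w" by (simp add: components_def euclidean_representation)
    then show ?thesis
      using chart_vec_eqI[OF d(1,2) True chain[OF True]] by (simp add: d(3))
  next
    case False
    then show ?thesis using tangent_not_smooth[OF v] by (simp add: chart_vec_def)
  qed
qed

lemma tangent_eq_range:
  assumes "c \<in> A" "p \<in> fst c"
  shows "tangent A p = range (\<lambda>w. chart_vec A c w p)"
proof
  show "tangent A p \<subseteq> range (\<lambda>w. chart_vec A c w p)"
    using chart_vec_components[OF assms] by (metis rangeI subsetI)
  show "range (\<lambda>w. chart_vec A c w p) \<subseteq> tangent A p"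
    using chart_vec_tangent[OF assms] by blast
qed

lemma tangent_subspace: "subspace (tangent A p)"
proof -
  obtain c where "c \<in> A" "p \<in> fst c" using charts_cover by blast
  then show ?thesis
    using linear_subspace_image[OF chart_vec_linear subspace_UNIV] by (simp add: tangent_eq_range)
qed

lemma tangent_expand:
  assumes "c \<in> A" "p \<in> fst c" "v \<in> tangent A p"
  shows "v = (\<Sum>b\<in>Basis. v (coord c b) *\<^sub>R chart_vec A c b p)"
proof -
  have "v = chart_vec A c (components c v) p" using chart_vec_components[OF assms] by simp
  also have "\<dots> = (\<Sum>b\<in>Basis. v (coord c b) *\<^sub>R chart_vec A c b p)"
    by (simp add: components_def linear_sum[OF chart_vec_linear[OF assms(1,2)]]
        linear_cmul[OF chart_vec_linear[OF assms(1,2)]])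
  finally show ?thesis .
qed

lemma tangent_eqI:
  assumes "c \<in> A" "p \<in> fst c" "u \<in> tangent A p" "v \<in> tangent A p"
    and "\<And>b. b \<in> Basis \<Longrightarrow> u (coord c b) = v (coord c b)"
  shows "u = v"
  using tangent_expand[OF assms(1-3)] tangent_expand[OF assms(1,2,4)] assms(5) by simp

end


section \<open>Vector fields and the Lie bracket\<close>

context smooth_atlas
begin

lemma smooth_near_sum:
  "(\<And>i. i \<in> I \<Longrightarrow> smooth_near A p (f i)) \<Longrightarrow> smooth_near A p (\<lambda>q. \<Sum>i\<in>I. f i q)"
  by (induction I rule: infinite_finite_induct) (auto intro: smooth_near_const smooth_near_add)

lemma smooth_near_prod:
  "(\<And>i. i \<in> I \<Longrightarrow> smooth_near A p (f i)) \<Longrightarrow> smooth_near A p (\<lambda>q. \<Prod>i\<in>I. f i q)"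
  by (induction I rule: infinite_finite_induct) (auto intro: smooth_near_const smooth_near_mult)

lemma smooth_near_uminus: "smooth_near A p f \<Longrightarrow> smooth_near A p (\<lambda>q. - f q)"
  using smooth_near_mult[OF smooth_near_const, of p f "- 1"] by simp

lemma tangent_sum:
  assumes v: "v \<in> tangent A p"
  shows "(\<And>i. i \<in> I \<Longrightarrow> smooth_near A p (f i)) \<Longrightarrow> v (\<lambda>q. \<Sum>i\<in>I. f i q) = (\<Sum>i\<in>I. v (f i))"
  by (induction I rule: infinite_finite_induct)
    (auto simp: tangent_const[OF v] tangent_add[OF v] smooth_near_sum)

lemma tangent_uminus:
  "v \<in> tangent A p \<Longrightarrow> smooth_near A p f \<Longrightarrow> v (\<lambda>q. - f q) = - v f"
  using tangent_cmult[of v p f "- 1"] by simp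

lemma tangent_diff:
  assumes "v \<in> tangent A p" "smooth_near A p f" "smooth_near A p g"
  shows "v (\<lambda>q. f q - g q) = v f - v g"
  using tangent_add[OF assms(1,2) smooth_near_uminus[OF assms(3)]] tangent_uminus[OF assms(1,3)]
  by simp

lemma tangent_prod:
  assumes v: "v \<in> tangent A p" and "finite I"
  shows "(\<And>i. i \<in> I \<Longrightarrow> smooth_near A p (f i)) \<Longrightarrow>
    v (\<lambda>q. \<Prod>i\<in>I. f i q) = (\<Sum>i\<in>I. v (f i) * (\<Prod>j\<in>I - {i}. f j p))"
  using \<open>finite I\<close>
proof (induction I rule: finite_induct)
  case empty
  then show ?case by (simp add: tangent_const[OF v])
next
  case (insert k I)
  have "(\<Sum>i\<in>I. v (f i) * (\<Prod>j\<in>insert k I - {i}. f j p)) =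
      (\<Sum>i\<in>I. f k p * (v (f i) * (\<Prod>j\<in>I - {i}. f j p)))"
  proof (rule sum.cong[OF refl])
    fix i assume "i \<in> I"
    then have "insert k I - {i} = insert k (I - {i})" "k \<notin> I - {i}" using insert by auto
    then show "v (f i) * (\<Prod>j\<in>insert k I - {i}. f j p) = f k p * (v (f i) * (\<Prod>j\<in>I - {i}. f j p))"
      using insert by simp
  qed
  moreover have "insert k I - {k} = I" using insert by auto
  ultimately show ?case
    using insert by (simp add: tangent_mult[OF v] smooth_near_prod sum_distrib_left)
qed

lemma VF_tangent: "X \<in> VF U \<Longrightarrow> p \<in> U \<Longrightarrow> X p \<in> tangent A p"
  by (auto simp: vector_fields_def)

lemma VF_smooth:
  "X \<in> VF U \<Longrightarrow> open V \<Longrightarrow> V \<subseteq> U \<Longrightarrow> smooth V f \<Longrightarrow> smooth V (\<lambda>p. X p f)"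
  by (auto simp: vector_fields_def)

lemma VF_I:
  "(\<And>p. p \<in> U \<Longrightarrow> X p \<in> tangent A p) \<Longrightarrow>
   (\<And>V f. open V \<Longrightarrow> V \<subseteq> U \<Longrightarrow> smooth V f \<Longrightarrow> smooth V (\<lambda>p. X p f)) \<Longrightarrow> X \<in> VF U"
  by (auto simp: vector_fields_def)

lemma VF_smooth_near:
  assumes "open U" "X \<in> VF U" "p \<in> U" "smooth_near A p f"
  shows "smooth_near A p (\<lambda>q. X q f)"
proof -
  obtain V where V: "open V" "p \<in> V" "V \<subseteq> U" "smooth V f"
    using smooth_near_obtain[OF assms(4,1,3)] .
  show ?thesis by (rule smooth_nearI[OF V(1,2) VF_smooth[OF assms(2) V(1,3,4)]])
qed

lemma VF_subset: "X \<in> VF U \<Longrightarrow> V \<subseteq> U \<Longrightarrow> X \<in> VF V"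
  by (rule VF_I) (auto intro: VF_tangent VF_smooth)

lemma VF_cong:
  assumes "X \<in> VF U" "\<And>p. p \<in> U \<Longrightarrow> X p = Y p"
  shows "Y \<in> VF U"
proof (rule VF_I)
  show "Y p \<in> tangent A p" if "p \<in> U" for p
    using VF_tangent[OF assms(1) that] assms(2)[OF that] by simp
  show "smooth V (\<lambda>p. Y p f)" if "open V" "V \<subseteq> U" "smooth V f" for V f
    by (rule smooth_fun_cong[OF that(1) _ VF_smooth[OF assms(1) that]]) (use assms(2) that(2) in auto)
qed

lemma VF_add:
  assumes "X \<in> VF U" "Y \<in> VF U"
  shows "(\<lambda>q. X q + Y q) \<in> VF U"
  by (rule VF_I)
    (use assms in \<open>auto intro!: subspace_add[OF tangent_subspace] smooth_fun_add intro: VF_tangent VF_smooth\<close>)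

lemma VF_scale:
  assumes "X \<in> VF U" "smooth U f"
  shows "(\<lambda>q. f q *\<^sub>R X q) \<in> VF U"
proof (rule VF_I)
  show "f p *\<^sub>R X p \<in> tangent A p" if "p \<in> U" for p
    using subspace_scale[OF tangent_subspace VF_tangent[OF assms(1) that]] .
  show "smooth V (\<lambda>p. (f p *\<^sub>R X p) h)" if "open V" "V \<subseteq> U" "smooth V h" for V h
    using smooth_fun_mult[OF that(1) smooth_fun_subset[OF assms(2) that(2)] VF_smooth[OF assms(1) that]]
    by simp
qed

lemma VF_zero: "(\<lambda>q. 0) \<in> VF U"
  by (rule VF_I) (auto simp: subspace_0[OF tangent_subspace] smooth_fun_const)

lemma VF_uminus: "X \<in> VF U \<Longrightarrow> (\<lambda>q. - X q) \<in> VF U"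
  using VF_scale[OF _ smooth_fun_const, of X U "- 1"] by simp

lemma VF_diff: "X \<in> VF U \<Longrightarrow> Y \<in> VF U \<Longrightarrow> (\<lambda>q. X q - Y q) \<in> VF U"
  using VF_add[OF _ VF_uminus, of X U Y] by simp

lemma VF_sum: "(\<And>i. i \<in> I \<Longrightarrow> X i \<in> VF U) \<Longrightarrow> (\<lambda>q. \<Sum>i\<in>I. X i q) \<in> VF U"
  by (induction I rule: infinite_finite_induct) (auto intro: VF_zero VF_add)

lemma VF_coordinate:
  assumes c: "c \<in> A"
  shows "chart_vec A c w \<in> VF (fst c)"
proof (rule VF_I)
  show "chart_vec A c w p \<in> tangent A p" if "p \<in> fst c" for p
    using chart_vec_tangent[OF c that] .
  fix V f assume V: "open V" "V \<subseteq> fst c" and f: "smooth V f"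
  have S: "open (snd c ` V)" using chart_image_open_subset[OF c V] .
  have "smooth_on (snd c ` V) (f \<circ> chart_inv c)"
    using smooth_funD[OF f c] V by (simp add: Int_absorb1)
  then have D: "smooth_on (snd c ` V) (\<lambda>x. frechet_derivative (f \<circ> chart_inv c) (at x) w)"
    by (rule smooth_on_frechet_derivative)
  have eq: "frechet_derivative (f \<circ> chart_inv c) (at x) w = ((\<lambda>p. chart_vec A c w p f) \<circ> chart_inv c) x"
    if "x \<in> snd c ` V" for x
    using that V smooth_nearI[OF V(1) _ f] chart_inv_chart[OF c] by (auto simp: chart_vec_def)
  show "smooth V (\<lambda>p. chart_vec A c w p f)"
  proof (rule smooth_fun_chartI[OF c V], unfold smooth_on_def, rule allI)
    fix k
    have "Ck_on k (snd c ` V) (\<lambda>x. frechet_derivative (f \<circ> chart_inv c) (at x) w)"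
      using D by (simp only: smooth_on_def)
    then show "Ck_on k (snd c ` V) ((\<lambda>p. chart_vec A c w p f) \<circ> chart_inv c)"
      by (rule Ck_on_cong[OF S _, rotated]) (rule eq)
  qed
qed

text \<open>Symmetry of second derivatives enters the whole development through this lemma.\<close>

lemma coordinate_fields_commute:
  assumes c: "c \<in> A" "p \<in> fst c" and f: "smooth_near A p f"
  shows "chart_vec A c v p (\<lambda>q. chart_vec A c w q f) = chart_vec A c w p (\<lambda>q. chart_vec A c v q f)"
proof -
  obtain V where V: "open V" "p \<in> V" "V \<subseteq> fst c" "smooth V f"
    using smooth_near_obtain[OF f chart_open[OF c(1)] c(2)] .
  let ?F = "f \<circ> chart_inv c"
  have S: "open (snd c ` V)" using chart_image_open_subset[OF c(1) V(1,3)] .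
  have F: "smooth_on (snd c ` V) ?F"
    using smooth_funD[OF V(4) c(1)] V by (simp add: Int_absorb1)
  have eq: "frechet_derivative ?F (at x) w = ((\<lambda>q. chart_vec A c w q f) \<circ> chart_inv c) x"
    if "x \<in> snd c ` V" for x w
    using that V smooth_nearI[OF V(1) _ V(4)] chart_inv_chart[OF c(1)] by (auto simp: chart_vec_def)
  have D: "chart_vec A c v p (\<lambda>q. chart_vec A c w q f) =
      frechet_derivative (\<lambda>x. frechet_derivative ?F (at x) w) (at (snd c p)) v" for v w
  proof (rule chart_vec_eqI[OF c])
    show "smooth_near A p (\<lambda>q. chart_vec A c w q f)"
      by (rule VF_smooth_near[OF chart_open VF_coordinate]) (use c f in auto)
    have "((\<lambda>x. frechet_derivative ?F (at x) w) has_derivative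
        frechet_derivative (\<lambda>x. frechet_derivative ?F (at x) w) (at (snd c p))) (at (snd c p))"
      unfolding frechet_derivative_works[symmetric]
      by (rule smooth_on_differentiable[OF smooth_on_frechet_derivative[OF F]]) (use V in auto)
    then show "(((\<lambda>q. chart_vec A c w q f) \<circ> chart_inv c) has_derivative
        frechet_derivative (\<lambda>x. frechet_derivative ?F (at x) w) (at (snd c p))) (at (snd c p))"
      by (rule has_derivative_transform_within_open[OF _ S]) (use V eq in auto)
  qed
  have "Ck_on 2 (snd c ` V) ?F" using F by (simp only: smooth_on_def)
  then show ?thesis
    unfolding D using second_derivative_symmetric[OF S] V by blast
qed

lemma VF_expand:
  "c \<in> A \<Longrightarrow> p \<in> fst c \<Longrightarrow> p \<in> U \<Longrightarrow> X \<in> VF U \<Longrightarrow>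
   X p = (\<Sum>b\<in>Basis. X p (coord c b) *\<^sub>R chart_vec A c b p)"
  using tangent_expand VF_tangent by blast

lemma VF_coeff_smooth:
  "c \<in> A \<Longrightarrow> open U \<Longrightarrow> U \<subseteq> fst c \<Longrightarrow> X \<in> VF U \<Longrightarrow> smooth U (\<lambda>p. X p (coord c b))"
  using VF_smooth[of X U U "coord c b"] smooth_fun_subset[OF coord_smooth] by blast

lemma lie_bracket_apply:
  "smooth_near A p f \<Longrightarrow> lie_bracket A X Y p f = X p (\<lambda>q. Y q f) - Y p (\<lambda>q. X q f)"
  by (simp add: lie_bracket_def)

lemma lie_bracket_not_smooth: "\<not> smooth_near A p f \<Longrightarrow> lie_bracket A X Y p f = 0"
  by (simp add: lie_bracket_def)

text \<open>The second derivatives of the argument cancel by symmetry and leave first derivatives with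
  coefficients that come from differentiating the components. This is what makes the bracket of two
  vector fields a tangent vector.\<close>

lemma lie_bracket_expand:
  assumes U: "open U" "p \<in> U" and c: "c \<in> A" "p \<in> fst c" and X: "X \<in> VF U" and Y: "Y \<in> VF U"
  shows "lie_bracket A X Y p =
    (\<Sum>b\<in>Basis. (X p (\<lambda>q. Y q (coord c b)) - Y p (\<lambda>q. X q (coord c b))) *\<^sub>R chart_vec A c b p)"
proof
  fix f
  show "lie_bracket A X Y p f =
    (\<Sum>b\<in>Basis. (X p (\<lambda>q. Y q (coord c b)) - Y p (\<lambda>q. X q (coord c b))) *\<^sub>R chart_vec A c b p) f"
  proof (cases "smooth_near A p f")
    case True
    let ?E = "chart_vec A c"
    have W: "open (U \<inter> fst c)" "p \<in> U \<inter> fst c" using U c chart_open[OF c(1)] by (auto simp: open_Int)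
    have E: "smooth_near A p (\<lambda>q. ?E b q f)" for b
      by (rule VF_smooth_near[OF chart_open VF_coordinate]) (use c True in auto)
    have co: "smooth_near A p (\<lambda>q. Z q (coord c b))" if "Z \<in> VF U" for Z b
      by (rule VF_smooth_near[OF U(1) that U(2) coord_smooth_near[OF c]])
    have app: "Z p (\<lambda>q. Z' q f) = (\<Sum>b\<in>Basis. Z p (\<lambda>q. Z' q (coord c b)) * ?E b p f) +
        (\<Sum>b\<in>Basis. \<Sum>a\<in>Basis. Z' p (coord c b) * Z p (coord c a) * ?E a p (\<lambda>q. ?E b q f))"
      if Z: "Z \<in> VF U" and Z': "Z' \<in> VF U" for Z Z'
    proof -
      have T: "Z p \<in> tangent A p" using VF_tangent[OF Z U(2)] .
      have ex: "Z p (\<lambda>q. ?E b q f) = (\<Sum>a\<in>Basis. Z p (coord c a) * ?E a p (\<lambda>q. ?E b q f))" for b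
        by (subst VF_expand[OF c U(2) Z]) (simp add: sum_fun_apply)
      have "Z p (\<lambda>q. Z' q f) = Z p (\<lambda>q. \<Sum>b\<in>Basis. Z' q (coord c b) * ?E b q f)"
      proof (rule tangent_germ[OF T W])
        fix q assume "q \<in> U \<inter> fst c"
        then have "Z' q f = (\<Sum>b\<in>Basis. Z' q (coord c b) *\<^sub>R ?E b q) f"
          using VF_expand[OF c(1) _ _ Z', of q] by simp
        then show "Z' q f = (\<Sum>b\<in>Basis. Z' q (coord c b) * ?E b q f)"
          by (simp add: sum_fun_apply)
      qed
      also have "\<dots> = (\<Sum>b\<in>Basis. Z p (\<lambda>q. Z' q (coord c b)) * ?E b p f + Z' p (coord c b) * Z p (\<lambda>q. ?E b q f))"
        using E co[OF Z'] by (simp add: tangent_sum[OF T] tangent_mult[OF T] smooth_near_mult)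
      finally show ?thesis
        unfolding ex by (simp add: sum.distrib sum_distrib_left mult.assoc)
    qed
    have sym: "(\<Sum>b\<in>Basis. \<Sum>a\<in>Basis. Y p (coord c b) * X p (coord c a) * ?E a p (\<lambda>q. ?E b q f)) =
        (\<Sum>b\<in>Basis. \<Sum>a\<in>Basis. X p (coord c b) * Y p (coord c a) * ?E a p (\<lambda>q. ?E b q f))"
      by (subst sum.swap) (simp add: coordinate_fields_commute[OF c True] mult.commute)
    have "lie_bracket A X Y p f = (\<Sum>b\<in>Basis. X p (\<lambda>q. Y q (coord c b)) * ?E b p f) -
        (\<Sum>b\<in>Basis. Y p (\<lambda>q. X q (coord c b)) * ?E b p f)"
      unfolding lie_bracket_apply[OF True] app[OF X Y] app[OF Y X] sym by simp
    then show ?thesis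
      by (simp add: sum_fun_apply sum_subtractf left_diff_distrib)
  next
    case False
    then show ?thesis
      using tangent_not_smooth[OF chart_vec_tangent[OF c]]
      by (simp add: lie_bracket_not_smooth sum_fun_apply)
  qed
qed

lemma lie_bracket_VF:
  assumes U: "open U" and X: "X \<in> VF U" and Y: "Y \<in> VF U"
  shows "lie_bracket A X Y \<in> VF U"
proof (rule VF_I)
  fix p assume p: "p \<in> U"
  obtain c where c: "c \<in> A" "p \<in> fst c" using charts_cover by blast
  show "lie_bracket A X Y p \<in> tangent A p"
    unfolding lie_bracket_expand[OF U p c X Y]
    by (intro subspace_sum subspace_scale tangent_subspace chart_vec_tangent[OF c])
next
  fix V f assume V: "open V" "V \<subseteq> U" and f: "smooth V f"
  have "smooth V (\<lambda>p. X p (\<lambda>q. Y q f) - Y p (\<lambda>q. X q f))"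
    using V f X Y by (intro smooth_fun_diff) (auto intro!: VF_smooth[OF X] VF_smooth[OF Y])
  then show "smooth V (\<lambda>p. lie_bracket A X Y p f)"
    by (rule smooth_fun_cong[OF V(1), rotated])
      (simp add: lie_bracket_apply[OF smooth_nearI[OF V(1) _ f]])
qed

lemma lie_bracket_coordinate:
  assumes "c \<in> A" "p \<in> fst c"
  shows "lie_bracket A (chart_vec A c v) (chart_vec A c w) p = 0"
proof
  fix f
  show "lie_bracket A (chart_vec A c v) (chart_vec A c w) p f = 0 f"
    by (cases "smooth_near A p f")
      (simp_all add: lie_bracket_apply lie_bracket_not_smooth coordinate_fields_commute[OF assms])
qed

lemma lie_bracket_skew: "lie_bracket A Y X p = - lie_bracket A X Y p"
  by (auto simp: lie_bracket_def fun_eq_iff)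

lemma lie_bracket_cong:
  assumes U: "open U" "p \<in> U" and X: "X \<in> VF U" and Y: "Y \<in> VF U"
    and eq: "\<And>q. q \<in> U \<Longrightarrow> X' q = X q" "\<And>q. q \<in> U \<Longrightarrow> Y' q = Y q"
  shows "lie_bracket A X' Y' p = lie_bracket A X Y p"
proof
  fix f
  have "X p (\<lambda>q. Y' q f) = X p (\<lambda>q. Y q f)" "Y p (\<lambda>q. X' q f) = Y p (\<lambda>q. X q f)"
    by (rule tangent_germ[OF VF_tangent[OF _ U(2)] U]; use X Y eq in simp)+
  then show "lie_bracket A X' Y' p f = lie_bracket A X Y p f"
    using eq U by (simp add: lie_bracket_def)
qed

lemma lie_bracket_add_left:
  assumes U: "open U" "p \<in> U" and X: "X \<in> VF U" and X': "X' \<in> VF U" and Y: "Y \<in> VF U"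
  shows "lie_bracket A (\<lambda>q. X q + X' q) Y p = lie_bracket A X Y p + lie_bracket A X' Y p"
proof
  fix f
  show "lie_bracket A (\<lambda>q. X q + X' q) Y p f = (lie_bracket A X Y p + lie_bracket A X' Y p) f"
    using tangent_add[OF VF_tangent[OF Y U(2)] VF_smooth_near[OF U(1) X U(2)] VF_smooth_near[OF U(1) X' U(2)]]
    by (cases "smooth_near A p f") (simp_all add: lie_bracket_apply lie_bracket_not_smooth)
qed

lemma lie_bracket_scale_left:
  assumes U: "open U" "p \<in> U" and X: "X \<in> VF U" and Y: "Y \<in> VF U" and h: "smooth U h"
  shows "lie_bracket A (\<lambda>q. h q *\<^sub>R X q) Y p = h p *\<^sub>R lie_bracket A X Y p - Y p h *\<^sub>R X p"
proof
  fix f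
  show "lie_bracket A (\<lambda>q. h q *\<^sub>R X q) Y p f = (h p *\<^sub>R lie_bracket A X Y p - Y p h *\<^sub>R X p) f"
    using tangent_mult[OF VF_tangent[OF Y U(2)] smooth_nearI[OF U h] VF_smooth_near[OF U(1) X U(2)]]
      tangent_not_smooth[OF VF_tangent[OF X U(2)]]
    by (cases "smooth_near A p f")
      (simp_all add: lie_bracket_apply lie_bracket_not_smooth algebra_simps)
qed

lemma lie_bracket_jacobi:
  assumes U: "open U" "p \<in> U" and X: "X \<in> VF U" and Y: "Y \<in> VF U" and Z: "Z \<in> VF U"
  shows "lie_bracket A X (lie_bracket A Y Z) p + lie_bracket A Y (lie_bracket A Z X) p +
    lie_bracket A Z (lie_bracket A X Y) p = 0"
proof
  fix f
  show "(lie_bracket A X (lie_bracket A Y Z) p + lie_bracket A Y (lie_bracket A Z X) p +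
    lie_bracket A Z (lie_bracket A X Y) p) f = 0 f"
  proof (cases "smooth_near A p f")
    case True
    obtain V where V: "open V" "p \<in> V" "V \<subseteq> U" "smooth V f"
      using smooth_near_obtain[OF True U] .
    have s1: "smooth_near A p (\<lambda>q. B q f)" if "B \<in> VF U" for B
      by (rule VF_smooth_near[OF U(1) that U(2) True])
    have s2: "smooth_near A p (\<lambda>q. B q (\<lambda>r. B' r f))" if "B \<in> VF U" "B' \<in> VF U" for B B'
      by (rule VF_smooth_near[OF U(1) that(1) U(2) s1[OF that(2)]])
    have lie: "lie_bracket A B C p f = B p (\<lambda>q. C q f) - C p (\<lambda>q. B q f)" for B C
      by (rule lie_bracket_apply[OF True])
    have lie': "lie_bracket A B C p (\<lambda>q. B' q f) = B p (\<lambda>q. C q (\<lambda>r. B' r f)) - C p (\<lambda>q. B q (\<lambda>r. B' r f))"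
      if "B' \<in> VF U" for B C B'
      by (rule lie_bracket_apply[OF s1[OF that]])
    have lie2: "B p (\<lambda>q. lie_bracket A B' B'' q f) = B p (\<lambda>q. B' q (\<lambda>r. B'' r f)) - B p (\<lambda>q. B'' q (\<lambda>r. B' r f))"
      if "B \<in> VF U" "B' \<in> VF U" "B'' \<in> VF U" for B B' B''
    proof -
      have lie2: "B p (\<lambda>q. lie_bracket A B' B'' q f) = B p (\<lambda>q. B' q (\<lambda>r. B'' r f) - B'' q (\<lambda>r. B' r f))"
        by (rule tangent_germ[OF VF_tangent[OF that(1) U(2)] V(1,2)])
          (simp add: lie_bracket_apply[OF smooth_nearI[OF V(1) _ V(4)]])
      then show ?thesis
        using tangent_diff[OF VF_tangent[OF that(1) U(2)] s2 s2] that by simp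
    qed
    show ?thesis
      by (simp add: lie lie'[OF X] lie'[OF Y] lie'[OF Z] lie2[OF X Y Z] lie2[OF Y Z X] lie2[OF Z X Y])
  qed (simp add: lie_bracket_not_smooth)
qed

end


section \<open>Traces and the algebra of a para-Kaehler curvature tensor\<close>

definition etr :: "('e::euclidean_space \<Rightarrow> 'e) \<Rightarrow> real" where
  "etr F = (\<Sum>b\<in>Basis. F b \<bullet> b)"

lemma etr_add: "etr (\<lambda>w. F w + H w) = etr F + etr H"
  by (simp add: etr_def inner_add_left sum.distrib)

lemma etr_uminus: "etr (\<lambda>w. - F w) = - etr F"
  by (simp add: etr_def sum_negf)

lemma etr_compose_commute:
  fixes F H :: "'e::euclidean_space \<Rightarrow> 'e"
  assumes "linear F" "linear H"
  shows "etr (\<lambda>w. F (H w)) = etr (\<lambda>w. H (F w))"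
proof -
  have *: "etr (\<lambda>w. F (H w)) = (\<Sum>b\<in>Basis. \<Sum>a\<in>Basis. (H b \<bullet> a) * (F a \<bullet> b))" if "linear F" for F H :: "'e \<Rightarrow> 'e"
    unfolding etr_def
  proof (rule sum.cong[OF refl])
    fix b :: 'e
    have "F (H b) = (\<Sum>a\<in>Basis. (H b \<bullet> a) *\<^sub>R F a)"
      by (subst euclidean_representation[of "H b", symmetric])
        (simp only: linear_sum[OF that] linear_cmul[OF that])
    then show "F (H b) \<bullet> b = (\<Sum>a\<in>Basis. (H b \<bullet> a) * (F a \<bullet> b))"
      by (simp add: inner_sum_left)
  qed
  show ?thesis
    unfolding *[OF assms(1)] *[OF assms(2)] by (subst sum.swap) (simp add: mult.commute)
qed

text \<open>With \<open>G u v = L u \<bullet> v\<close>, skewness says \<open>S = - L\<^sup>-\<^sup>1 S\<^sup>T L\<close>, and \<open>S\<^sup>T\<close> has the same trace as \<open>S\<close>.\<close>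

lemma etr_skew:
  fixes G :: "'e::euclidean_space \<Rightarrow> 'e \<Rightarrow> real"
  assumes G: "bilinear G" and nondegenerate: "\<And>u. (\<And>v. G u v = 0) \<Longrightarrow> u = 0"
    and S: "linear S" and skew: "\<And>u v. G (S u) v = - G u (S v)"
  shows "etr S = 0"
proof -
  have Gl: "linear (\<lambda>u. G u v)" "linear (G u)" for u v
    using G by (auto simp: bilinear_def)
  define L where "L = (\<lambda>u. \<Sum>b\<in>Basis. G u b *\<^sub>R b)"
  have L: "G u v = L u \<bullet> v" for u v
    by (subst euclidean_representation[of v, symmetric], subst (2) inner_commute)
      (simp add: L_def linear_sum[OF Gl(2)] linear_cmul[OF Gl(2)] inner_sum_right mult.commute inner_commute)
  have linL: "linear L"
    unfolding L_def
    by (rule linearI)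
      (simp_all add: linear_add[OF Gl(1)] linear_cmul[OF Gl(1)] scaleR_add_left sum.distrib scaleR_sum_right)
  have "inj L"
    unfolding linear_injective_0[OF linL]
  proof (intro allI impI)
    fix u assume "L u = 0"
    then show "u = 0" using nondegenerate[of u] L by simp
  qed
  then obtain M where M: "linear M" "\<And>w. M (L w) = w" "\<And>w. L (M w) = w"
    using linear_injective_isomorphism[OF linL] by blast
  let ?S' = "adjoint S"
  have S': "linear ?S'" using adjoint_linear[OF S] .
  have "L (S w) = - ?S' (L w)" for w
  proof -
    have "L (S w) \<bullet> v = (- ?S' (L w)) \<bullet> v" for v
      using skew[of w v] adjoint_works[OF S, of v "L w"] by (simp add: L inner_commute)
    then show ?thesis using vector_eq_rdot by blast
  qed
  then have "S w = - M (?S' (L w))" for w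
    using M(2)[of "S w"] by (simp add: linear_neg[OF M(1)])
  then have "S = (\<lambda>w. - M (?S' (L w)))" by (rule ext)
  then have "etr S = - etr (\<lambda>w. M (?S' (L w)))"
    using etr_uminus[of "\<lambda>w. M (?S' (L w))"] by simp
  also have "etr (\<lambda>w. M (?S' (L w))) = etr (\<lambda>w. ?S' (L (M w)))"
    using etr_compose_commute[OF M(1) linear_compose[OF linL S']] by (simp add: o_def)
  also have "\<dots> = etr S"
    using adjoint_works[OF S] by (simp add: etr_def M(3) inner_commute)
  finally show ?thesis by simp
qed

text \<open>The left-hand side uses an arbitrarily chosen basis \<open>B\<close> of the subspace, the right-hand side the
  standard basis transported by \<open>\<phi>\<close>; both traces equal the double sum that arises when the images of
  one basis are expanded in the other.\<close>

lemma trace_on_eq_etr: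
  fixes \<phi> :: "'e::euclidean_space \<Rightarrow> 'v::real_vector"
  assumes \<phi>: "linear \<phi>" and \<psi>: "linear \<psi>" "\<And>w. \<psi> (\<phi> w) = w"
    and F: "linear_within (range \<phi>) F" "F ` range \<phi> \<subseteq> range \<phi>"
  shows "trace_on (range \<phi>) F = etr (\<lambda>w. \<psi> (F (\<phi> w)))"
proof -
  let ?V = "range \<phi>"
  define B where "B = (SOME B. B \<subseteq> ?V \<and> independent B \<and> ?V \<subseteq> span B)"
  have "\<exists>B. B \<subseteq> ?V \<and> independent B \<and> ?V \<subseteq> span B"
    using maximal_independent_subset[of ?V] by metis
  then have B: "B \<subseteq> ?V" "independent B" "?V \<subseteq> span B"
    unfolding B_def by (rule someI2_ex, blast)+
  have V: "?V = span (\<phi> ` Basis)"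
    using linear_span_image[OF \<phi>, of Basis] by (simp add: span_Basis)
  have fin: "finite B"
    using independent_span_bound[of "\<phi> ` Basis" B] B V by auto
  define H where "H = (\<lambda>w. \<psi> (F (\<phi> w)))"
  have H: "linear H"
  proof (rule linearI)
    show "H (x + y) = H x + H y" for x y
      using F(1)[unfolded linear_within_def, rule_format, of "\<phi> x" "\<phi> y" 1 1]
      by (simp add: H_def linear_add[OF \<phi>] linear_add[OF \<psi>(1)])
    show "H (r *\<^sub>R x) = r *\<^sub>R H x" for r x
      using F(1)[unfolded linear_within_def, rule_format, of "\<phi> x" "\<phi> x" r 0]
      by (simp add: H_def linear_cmul[OF \<phi>] linear_cmul[OF \<psi>(1)])
  qed
  have inv: "\<phi> (\<psi> v) = v" if "v \<in> ?V" for v using that \<psi>(2) by auto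
  let ?r = "representation B"
  have rep: "?r (F b) b = (\<Sum>i\<in>Basis. (H (\<psi> b) \<bullet> i) * ?r (\<phi> i) b)" if "b \<in> B" for b
  proof -
    have b: "b \<in> ?V" using that B by blast
    then have Fb: "F b \<in> ?V" using F(2) by blast
    have "F b = \<phi> (\<psi> (F b))" using inv[OF Fb] by simp
    also have "\<psi> (F b) = H (\<psi> b)" by (simp add: H_def inv[OF b])
    also have "\<phi> (H (\<psi> b)) = (\<Sum>i\<in>Basis. (H (\<psi> b) \<bullet> i) *\<^sub>R \<phi> i)"
      by (subst euclidean_representation[of "H (\<psi> b)", symmetric])
        (simp only: linear_sum[OF \<phi>] linear_cmul[OF \<phi>])
    finally have "?r (F b) b = ?r (\<Sum>i\<in>Basis. (H (\<psi> b) \<bullet> i) *\<^sub>R \<phi> i) b" by simp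
    also have "\<dots> = (\<Sum>i\<in>Basis. ?r ((H (\<psi> b) \<bullet> i) *\<^sub>R \<phi> i) b)"
      by (rule representation_sum[OF B(2), THEN fun_cong, simplified sum_fun_apply])
        (intro span_scale subsetD[OF B(3)] rangeI)
    also have "\<dots> = (\<Sum>i\<in>Basis. (H (\<psi> b) \<bullet> i) * ?r (\<phi> i) b)"
      by (rule sum.cong[OF refl], subst representation_scale[OF B(2)]) (use B in auto)
    finally show ?thesis .
  qed
  have "trace_on ?V F = (\<Sum>b\<in>B. ?r (F b) b)"
    by (simp add: trace_on_def B_def[symmetric])
  also have "\<dots> = (\<Sum>b\<in>B. \<Sum>i\<in>Basis. (H (\<psi> b) \<bullet> i) * ?r (\<phi> i) b)"
    using rep by simp
  also have "\<dots> = (\<Sum>i\<in>Basis. H i \<bullet> i)"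
  proof (subst sum.swap, rule sum.cong[OF refl])
    fix i :: 'e
    have "(\<Sum>b\<in>B. ?r (\<phi> i) b *\<^sub>R b) = \<phi> i"
      by (rule sum_representation_eq[OF B(2)]) (use B fin in auto)
    then have "H (\<psi> (\<Sum>b\<in>B. ?r (\<phi> i) b *\<^sub>R b)) = H i" by (simp add: \<psi>(2))
    then have "(\<Sum>b\<in>B. ?r (\<phi> i) b *\<^sub>R H (\<psi> b)) = H i"
      by (simp add: linear_sum[OF \<psi>(1)] linear_cmul[OF \<psi>(1)] linear_sum[OF H] linear_cmul[OF H])
    then have "(\<Sum>b\<in>B. ?r (\<phi> i) b *\<^sub>R H (\<psi> b)) \<bullet> i = H i \<bullet> i" by (rule arg_cong)
    then show "(\<Sum>b\<in>B. (H (\<psi> b) \<bullet> i) * ?r (\<phi> i) b) = H i \<bullet> i"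
      by (simp only: inner_sum_left inner_scaleR_left mult.commute)
  qed
  finally show ?thesis by (simp add: etr_def H_def)
qed

text \<open>The algebraic symmetries of the curvature tensor of a para-Kaehler manifold at one point, on the
  model space of the manifold. \<open>ric\<close> will be its Ricci tensor.\<close>

locale para_kaehler_curvature =
  fixes G :: "'e::euclidean_space \<Rightarrow> 'e \<Rightarrow> real" and K :: "'e \<Rightarrow> 'e" and R :: "'e \<Rightarrow> 'e \<Rightarrow> 'e \<Rightarrow> 'e"
  assumes bilinear: "bilinear G" and sym: "G u v = G v u"
    and nondegenerate: "(\<And>v. G u v = 0) \<Longrightarrow> u = 0"
    and linear_K: "linear K" and K_K: "K (K u) = u" and K_skew: "G (K u) v = - G u (K v)"
    and linear_1: "linear (\<lambda>u. R u v w)" and linear_3: "linear (R u v)"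
    and skew: "R v u w = - R u v w"
    and bianchi: "R u v w + R v w u + R w u v = 0"
    and metric: "G (R u v w) x = - G w (R u v x)"
    and parallel: "R u v (K w) = K (R u v w)"
begin

lemma G_linear: "linear (\<lambda>u. G u v)" "linear (G u)"
  using bilinear by (auto simp: bilinear_def)

text \<open>The first Bianchi identity, summed over the four cyclic shifts of \<open>u, v, w, x\<close>; all terms but two
  cancel by skewness.\<close>

lemma pair_symmetry: "G (R u v w) x = G (R w x u) v"
proof -
  define r where "r = (\<lambda>u v w x. G (R u v w) x)"
  have 1: "r v u w x = - r u v w x" for u v w x
    unfolding r_def skew[of v] by (rule linear_neg[OF G_linear(1)])
  have 2: "r u v x w = - r u v w x" for u v w x
    using metric[of u v x w] sym by (simp add: r_def)
  have 3: "r u v w x + r v w u x + r w u v x = 0" for u v w x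
    unfolding r_def linear_add[OF G_linear(1), symmetric] bianchi by (rule linear_0[OF G_linear(1)])
  have "r w u v x = r v x w u" for u v w x
    using 3[of u v w x] 3[of v w x u] 3[of w x u v] 3[of x u v w]
      2[of u v w x] 2[of v w u x] 2[of w x u v] 2[of x u v w]
      1[of w u x v] 2[of w u v x] 1[of x v u w] 2[of x v w u] 1[of x v w u]
    by linarith
  then show ?thesis by (simp add: r_def)
qed

text \<open>By pair symmetry the first two arguments may be moved into the last two, where \<open>K\<close> commutes with
  the curvature and is skew for the metric.\<close>

lemma curvature_K_K: "R (K u) (K v) w = - R u v w"
proof -
  have "G (R (K u) (K v) w + R u v w) x = 0" for x
  proof -
    have "G (R (K u) (K v) w) x = G (K (R w x u)) (K v)"
      unfolding pair_symmetry[of "K u"] parallel ..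
    also have "\<dots> = - G (R u v w) x"
      by (simp add: K_skew K_K pair_symmetry[of u])
    finally show ?thesis by (simp add: linear_add[OF G_linear(1)])
  qed
  then show ?thesis using nondegenerate eq_neg_iff_add_eq_0 by blast
qed

definition ric :: "'e \<Rightarrow> 'e \<Rightarrow> real" where
  "ric u v = etr (\<lambda>w. R w u v)"

lemma etr_curvature: "etr (R u v) = 0"
proof (rule etr_skew[OF bilinear _ linear_3])
  show "x = 0" if "\<And>y. G x y = 0" for x using nondegenerate that by blast
  show "G (R u v w) x = - G w (R u v x)" for w x by (rule metric)
qed

lemma bianchi_ric: "R w u v = - R u v w + R w v u"
proof -
  have "R w u v = - (R u v w + R v w u)"
    using bianchi[of w u v] by (metis add.assoc eq_neg_iff_add_eq_0)
  then show ?thesis by (simp only: skew[of v w u] minus_add_distrib minus_minus)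
qed

lemma ric_sym: "ric u v = ric v u"
proof -
  have "ric u v = etr (\<lambda>w. - R u v w + R w v u)"
    unfolding ric_def using bianchi_ric by metis
  then show ?thesis by (simp only: etr_add etr_uminus etr_curvature ric_def)
qed

lemma ric_K_K: "ric (K u) (K v) = - ric u v"
proof -
  have "R w (K u) (K v) = - K (R (K w) u v)" for w
    using curvature_K_K[of "K w" u] by (simp add: parallel K_K linear_neg[OF linear_K])
  then have "ric (K u) (K v) = - etr (\<lambda>w. K (R (K w) u v))"
    by (simp add: ric_def etr_uminus)
  also have "etr (\<lambda>w. K (R (K w) u v)) = etr (\<lambda>w. R (K (K w)) u v)"
    by (rule etr_compose_commute[OF linear_K, of "\<lambda>w. R (K w) u v"])
      (use linear_compose[OF linear_K linear_1] in \<open>simp add: o_def\<close>)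
  finally show ?thesis by (simp add: ric_def K_K)
qed

lemma ric_K_skew: "ric u (K v) = - ric v (K u)"
  using ric_K_K[of u "K v"] by (simp add: K_K ric_sym)

text \<open>The first Bianchi identity gives \<open>Ric(u, K v) - Ric(v, K u) = - tr (K R(u, v))\<close>, and the two terms
  on the left are equal because \<open>Ric(u, K v)\<close> is skew in \<open>u\<close> and \<open>v\<close>.\<close>

lemma ric_K_eq_trace: "ric u (K v) = - etr (\<lambda>w. K (R u v w)) / 2"
proof -
  have "ric u (K v) = etr (\<lambda>w. K (- R u v w + R w v u))"
    unfolding ric_def parallel bianchi_ric[symmetric] ..
  also have "\<dots> = - etr (\<lambda>w. K (R u v w)) + ric v (K u)"
    by (simp only: linear_add[OF linear_K] linear_neg[OF linear_K] etr_add etr_uminus ric_def parallel)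
  finally show ?thesis using ric_K_skew[of u v] by simp
qed

end


section \<open>Connections and curvature\<close>

text \<open>An operator that is local and linear over functions depends on the value of the field at the
  point only. The expansion in coordinate fields is the form in which this is used for curvature.\<close>

lemma (in smooth_atlas) tensorial_expand:
  fixes T :: "('m \<Rightarrow> 'm tvec) \<Rightarrow> 'v::real_vector"
  assumes U: "open U" "p \<in> U" and c: "c \<in> A" "U \<subseteq> fst c" and X: "X \<in> VF U"
    and add: "\<And>X Y. X \<in> VF U \<Longrightarrow> Y \<in> VF U \<Longrightarrow> T (\<lambda>q. X q + Y q) = T X + T Y"
    and scale: "\<And>X f. X \<in> VF U \<Longrightarrow> smooth U f \<Longrightarrow> T (\<lambda>q. f q *\<^sub>R X q) = f p *\<^sub>R T X"
    and cong: "\<And>X Y. X \<in> VF U \<Longrightarrow> (\<And>q. q \<in> U \<Longrightarrow> Y q = X q) \<Longrightarrow> T Y = T X"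
  shows "T X = (\<Sum>b\<in>Basis. X p (coord c b) *\<^sub>R T (chart_vec A c b))"
proof -
  let ?E = "chart_vec A c" and ?h = "\<lambda>b q. X q (coord c b)"
  have E: "?E b \<in> VF U" for b using VF_subset[OF VF_coordinate[OF c(1)] c(2)] .
  have h: "smooth U (?h b)" for b using VF_coeff_smooth[OF c(1) U(1) c(2) X] .
  have "T (\<lambda>q. \<Sum>b\<in>I. ?h b q *\<^sub>R ?E b q) = (\<Sum>b\<in>I. ?h b p *\<^sub>R T (?E b))" if "finite I" for I
    using that
  proof (induction I rule: finite_induct)
    case empty
    have "T (\<lambda>q. 0) = 0" using scale[OF E smooth_fun_const, of 0 0] by simp
    then show ?case by (simp only: sum.empty)
  next
    case (insert b I)
    have "(\<lambda>q. \<Sum>b\<in>I. ?h b q *\<^sub>R ?E b q) \<in> VF U" by (intro VF_sum VF_scale E h)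
    from add[OF VF_scale[OF E[of b] h[of b]] this] show ?case
      by (simp only: sum.insert[OF insert.hyps] scale[OF E h] insert.IH)
  qed
  moreover have "T X = T (\<lambda>q. \<Sum>b\<in>Basis. ?h b q *\<^sub>R ?E b q)"
    by (rule cong[OF VF_sum[OF VF_scale[OF E h]]]) (use VF_expand[OF c(1) _ _ X] c(2) in auto)
  ultimately show ?thesis by simp
qed

locale manifold_connection = smooth_atlas A
  for A :: "('m::topological_space, 'e::euclidean_space) chart set" +
  fixes D :: "('m \<Rightarrow> 'm tvec) \<Rightarrow> ('m \<Rightarrow> 'm tvec) \<Rightarrow> 'm \<Rightarrow> 'm tvec"
  assumes connection: "affine_connection A D"
begin

lemma D_VF: "open U \<Longrightarrow> X \<in> VF U \<Longrightarrow> Y \<in> VF U \<Longrightarrow> D X Y \<in> VF U"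
  using connection by (simp add: affine_connection_def)

lemma D_add_left:
  "open U \<Longrightarrow> p \<in> U \<Longrightarrow> X \<in> VF U \<Longrightarrow> X' \<in> VF U \<Longrightarrow> Y \<in> VF U \<Longrightarrow>
   D (\<lambda>q. X q + X' q) Y p = D X Y p + D X' Y p"
  using connection by (simp add: affine_connection_def)

lemma D_add_right:
  "open U \<Longrightarrow> p \<in> U \<Longrightarrow> X \<in> VF U \<Longrightarrow> Y \<in> VF U \<Longrightarrow> Y' \<in> VF U \<Longrightarrow>
   D X (\<lambda>q. Y q + Y' q) p = D X Y p + D X Y' p"
  using connection by (simp add: affine_connection_def)

lemma D_scale_left:
  "open U \<Longrightarrow> p \<in> U \<Longrightarrow> X \<in> VF U \<Longrightarrow> Y \<in> VF U \<Longrightarrow> smooth U f \<Longrightarrow>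
   D (\<lambda>q. f q *\<^sub>R X q) Y p = f p *\<^sub>R D X Y p"
  using connection by (simp add: affine_connection_def)

lemma D_scale_right:
  "open U \<Longrightarrow> p \<in> U \<Longrightarrow> X \<in> VF U \<Longrightarrow> Y \<in> VF U \<Longrightarrow> smooth U f \<Longrightarrow>
   D X (\<lambda>q. f q *\<^sub>R Y q) p = X p f *\<^sub>R Y p + f p *\<^sub>R D X Y p"
  using connection by (simp add: affine_connection_def)

text \<open>A connection takes total functions as arguments, so its locality has to be derived: after
  multiplication by the indicator function \<open>h\<close> of \<open>U\<close>, which is smooth on \<open>U\<close> and has derivative 0 there,
  fields that agree on \<open>U\<close> become equal.\<close>

lemma D_cong:
  assumes U: "open U" "p \<in> U" and X: "X \<in> VF U" and Y: "Y \<in> VF U"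
    and eq: "\<And>q. q \<in> U \<Longrightarrow> X' q = X q" "\<And>q. q \<in> U \<Longrightarrow> Y' q = Y q"
  shows "D X' Y' p = D X Y p"
proof -
  define h :: "'m \<Rightarrow> real" where "h = (\<lambda>q. if q \<in> U then 1 else 0)"
  have h: "smooth U h"
    by (rule smooth_fun_cong[OF U(1) _ smooth_fun_const[of U 1]]) (simp add: h_def)
  have hp: "h p = 1" using U by (simp add: h_def)
  have X': "X' \<in> VF U" and Y': "Y' \<in> VF U"
    by (rule VF_cong[OF X], use eq in simp) (rule VF_cong[OF Y], use eq in simp)
  have "X p h = 0"
    using tangent_germ[OF VF_tangent[OF X U(2)] U, of h "\<lambda>_. 1"] tangent_const[OF VF_tangent[OF X U(2)], of 1]
    by (simp add: h_def)
  have "(\<lambda>q. h q *\<^sub>R X' q) = (\<lambda>q. h q *\<^sub>R X q)" "(\<lambda>q. h q *\<^sub>R Y' q) = (\<lambda>q. h q *\<^sub>R Y q)"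
    using eq by (auto simp: h_def)
  then have "D X' Y' p = D X Y' p" "D X Y' p = D X Y p"
    using D_scale_left[OF U X' Y' h] D_scale_left[OF U X Y' h]
      D_scale_right[OF U X Y' h] D_scale_right[OF U X Y h] \<open>X p h = 0\<close> hp by simp_all
  then show ?thesis by simp
qed

lemma D_zero_left: "open U \<Longrightarrow> p \<in> U \<Longrightarrow> Y \<in> VF U \<Longrightarrow> D (\<lambda>q. 0) Y p = 0"
  using D_scale_left[OF _ _ VF_zero, of U p Y "\<lambda>q. 0"] by (simp add: smooth_fun_const)

lemma D_uminus_right: "open U \<Longrightarrow> p \<in> U \<Longrightarrow> X \<in> VF U \<Longrightarrow> Y \<in> VF U \<Longrightarrow> D X (\<lambda>q. - Y q) p = - D X Y p"
  using D_scale_right[of U p X Y "\<lambda>q. - 1"] by (simp add: smooth_fun_const tangent_const[OF VF_tangent])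

lemma D_uminus_left: "open U \<Longrightarrow> p \<in> U \<Longrightarrow> X \<in> VF U \<Longrightarrow> Y \<in> VF U \<Longrightarrow> D (\<lambda>q. - X q) Y p = - D X Y p"
  using D_scale_left[of U p X Y "\<lambda>q. - 1"] by (simp add: smooth_fun_const)

lemma D_diff_right:
  "open U \<Longrightarrow> p \<in> U \<Longrightarrow> X \<in> VF U \<Longrightarrow> Y \<in> VF U \<Longrightarrow> Y' \<in> VF U \<Longrightarrow>
   D X (\<lambda>q. Y q - Y' q) p = D X Y p - D X Y' p"
  using D_add_right[of U p X Y "\<lambda>q. - Y' q"] by (simp add: VF_uminus D_uminus_right)

lemma D_zero_right: "open U \<Longrightarrow> p \<in> U \<Longrightarrow> X \<in> VF U \<Longrightarrow> D X (\<lambda>q. 0) p = 0"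
  using D_scale_right[OF _ _ _ VF_zero smooth_fun_const[of _ 0], of U p X] by simp

lemma D_sum_right:
  assumes U: "open U" "p \<in> U" and X: "X \<in> VF U" and V: "\<And>i. V i \<in> VF U" and f: "\<And>i. smooth U (f i)"
    and "finite I"
  shows "D X (\<lambda>q. \<Sum>i\<in>I. f i q *\<^sub>R V i q) p = (\<Sum>i\<in>I. X p (f i) *\<^sub>R V i p + f i p *\<^sub>R D X (V i) p)"
  using \<open>finite I\<close>
proof (induction I rule: finite_induct)
  case empty
  show ?case by (simp only: sum.empty D_zero_right[OF U X])
next
  case (insert i I)
  have "(\<lambda>q. \<Sum>i\<in>I. f i q *\<^sub>R V i q) \<in> VF U" by (intro VF_sum VF_scale V f)
  from D_add_right[OF U X VF_scale[OF V[of i] f[of i]] this] show ?case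
    by (simp only: sum.insert[OF insert.hyps] D_scale_right[OF U X V f] insert.IH)
qed

abbreviation curv :: "('m \<Rightarrow> 'm tvec) \<Rightarrow> ('m \<Rightarrow> 'm tvec) \<Rightarrow> ('m \<Rightarrow> 'm tvec) \<Rightarrow> 'm \<Rightarrow> 'm tvec" where
  "curv \<equiv> curvature A D"

lemma curv_VF:
  assumes "open U" "X \<in> VF U" "Y \<in> VF U" "Z \<in> VF U"
  shows "curv X Y Z \<in> VF U"
proof -
  have "(\<lambda>p. D X (D Y Z) p - D Y (D X Z) p - D (lie_bracket A X Y) Z p) \<in> VF U"
    using assms by (intro VF_diff D_VF lie_bracket_VF)
  then show ?thesis by (rule VF_cong) (simp add: curvature_def)
qed

lemma curv_skew:
  assumes U: "open U" "p \<in> U" and X: "X \<in> VF U" and Y: "Y \<in> VF U" and Z: "Z \<in> VF U"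
  shows "curv Y X Z p = - curv X Y Z p"
proof -
  have "D (lie_bracket A Y X) Z p = D (\<lambda>q. - lie_bracket A X Y q) Z p"
    by (rule D_cong[OF U VF_uminus[OF lie_bracket_VF[OF U(1) X Y]] Z]) (auto intro: lie_bracket_skew)
  then show ?thesis
    using D_uminus_left[OF U lie_bracket_VF[OF U(1) X Y] Z] by (simp add: curvature_def)
qed

lemma curv_cong:
  assumes U: "open U" "p \<in> U" and X: "X \<in> VF U" and Y: "Y \<in> VF U" and Z: "Z \<in> VF U"
    and eq: "\<And>q. q \<in> U \<Longrightarrow> X' q = X q" "\<And>q. q \<in> U \<Longrightarrow> Y' q = Y q" "\<And>q. q \<in> U \<Longrightarrow> Z' q = Z q"
  shows "curv X' Y' Z' p = curv X Y Z p"
proof -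
  have 1: "D X' (D Y' Z') p = D X (D Y Z) p"
    by (rule D_cong[OF U X D_VF[OF U(1) Y Z] eq(1) D_cong[OF U(1) _ Y Z eq(2,3)]])
  have 2: "D Y' (D X' Z') p = D Y (D X Z) p"
    by (rule D_cong[OF U Y D_VF[OF U(1) X Z] eq(2) D_cong[OF U(1) _ X Z eq(1,3)]])
  have 3: "D (lie_bracket A X' Y') Z' p = D (lie_bracket A X Y) Z p"
    by (rule D_cong[OF U lie_bracket_VF[OF U(1) X Y] Z lie_bracket_cong[OF U(1) _ X Y eq(1,2)] eq(3)])
  show ?thesis by (simp add: curvature_def 1 2 3)
qed

lemma curv_add_1:
  assumes U: "open U" "p \<in> U" and X: "X \<in> VF U" and X': "X' \<in> VF U" and Y: "Y \<in> VF U" and Z: "Z \<in> VF U"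
  shows "curv (\<lambda>q. X q + X' q) Y Z p = curv X Y Z p + curv X' Y Z p"
proof -
  note vf = X X' Y Z VF_add[OF X X'] D_VF[OF U(1)] lie_bracket_VF[OF U(1)]
  have 1: "D (\<lambda>q. X q + X' q) (D Y Z) p = D X (D Y Z) p + D X' (D Y Z) p"
    by (rule D_add_left[OF U]) (intro vf)+
  have "D Y (D (\<lambda>q. X q + X' q) Z) p = D Y (\<lambda>q. D X Z q + D X' Z q) p"
    by (rule D_cong[OF U]) (intro vf VF_add D_add_left[OF U(1)] refl; assumption)+
  also have "\<dots> = D Y (D X Z) p + D Y (D X' Z) p"
    by (rule D_add_right[OF U]) (intro vf)+
  finally have 2: "D Y (D (\<lambda>q. X q + X' q) Z) p = D Y (D X Z) p + D Y (D X' Z) p" .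
  have "D (lie_bracket A (\<lambda>q. X q + X' q) Y) Z p = D (\<lambda>q. lie_bracket A X Y q + lie_bracket A X' Y q) Z p"
    by (rule D_cong[OF U]) (intro vf VF_add lie_bracket_add_left[OF U(1)] refl; assumption)+
  also have "\<dots> = D (lie_bracket A X Y) Z p + D (lie_bracket A X' Y) Z p"
    by (rule D_add_left[OF U]) (intro vf)+
  finally show ?thesis by (simp add: curvature_def 1 2)
qed

lemma curv_scale_1:
  assumes U: "open U" "p \<in> U" and X: "X \<in> VF U" and Y: "Y \<in> VF U" and Z: "Z \<in> VF U" and f: "smooth U f"
  shows "curv (\<lambda>q. f q *\<^sub>R X q) Y Z p = f p *\<^sub>R curv X Y Z p"
proof -
  note vf = X Y Z VF_scale[OF _ f] D_VF[OF U(1)] lie_bracket_VF[OF U(1)]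
  have Yf: "smooth U (\<lambda>q. - Y q f)"
    by (intro smooth_fun_minus VF_smooth[OF Y] U f subset_refl)
  have 1: "D (\<lambda>q. f q *\<^sub>R X q) (D Y Z) p = f p *\<^sub>R D X (D Y Z) p"
    by (rule D_scale_left[OF U _ _ f]) (intro vf)+
  have "D Y (D (\<lambda>q. f q *\<^sub>R X q) Z) p = D Y (\<lambda>q. f q *\<^sub>R D X Z q) p"
    by (rule D_cong[OF U]) (intro vf D_scale_left[OF U(1) _ _ _ f] refl; assumption)+
  also have "\<dots> = Y p f *\<^sub>R D X Z p + f p *\<^sub>R D Y (D X Z) p"
    by (rule D_scale_right[OF U _ _ f]) (intro vf)+
  finally have 2: "D Y (D (\<lambda>q. f q *\<^sub>R X q) Z) p = Y p f *\<^sub>R D X Z p + f p *\<^sub>R D Y (D X Z) p" .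
  have "D (lie_bracket A (\<lambda>q. f q *\<^sub>R X q) Y) Z p = D (\<lambda>q. f q *\<^sub>R lie_bracket A X Y q + (- Y q f) *\<^sub>R X q) Z p"
    by (rule D_cong[OF U VF_add[OF VF_scale[OF lie_bracket_VF[OF U(1) X Y] f] VF_scale[OF X Yf]] Z])
      (simp_all add: lie_bracket_scale_left[OF U(1) _ X Y f])
  also have "\<dots> = f p *\<^sub>R D (lie_bracket A X Y) Z p + (- Y p f) *\<^sub>R D X Z p"
    by (subst D_add_left[OF U]) (intro vf VF_scale[OF _ Yf] | simp only: D_scale_left[OF U lie_bracket_VF[OF U(1) X Y] Z f] D_scale_left[OF U X Z Yf])+
  finally show ?thesis by (simp add: curvature_def 1 2 scaleR_diff_right)
qed

lemma curv_add_3: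
  assumes U: "open U" "p \<in> U" and X: "X \<in> VF U" and Y: "Y \<in> VF U" and Z: "Z \<in> VF U" and Z': "Z' \<in> VF U"
  shows "curv X Y (\<lambda>q. Z q + Z' q) p = curv X Y Z p + curv X Y Z' p"
proof -
  note vf = X Z' Y Z VF_add[OF Z Z'] D_VF[OF U(1)] lie_bracket_VF[OF U(1)]
  have 1: "D B (D B' (\<lambda>q. Z q + Z' q)) p = D B (D B' Z) p + D B (D B' Z') p"
    if B: "B \<in> VF U" "B' \<in> VF U" for B B'
  proof -
    have "D B (D B' (\<lambda>q. Z q + Z' q)) p = D B (\<lambda>q. D B' Z q + D B' Z' q) p"
      by (rule D_cong[OF U]) (intro vf B VF_add D_add_right[OF U(1)] refl; assumption)+
    also have "\<dots> = D B (D B' Z) p + D B (D B' Z') p"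
      by (rule D_add_right[OF U]) (intro vf B)+
    finally show ?thesis .
  qed
  have 2: "D (lie_bracket A X Y) (\<lambda>q. Z q + Z' q) p = D (lie_bracket A X Y) Z p + D (lie_bracket A X Y) Z' p"
    by (rule D_add_right[OF U]) (intro vf)+
  show ?thesis by (simp add: curvature_def 1 2 X Y)
qed

lemma curv_scale_3:
  assumes U: "open U" "p \<in> U" and X: "X \<in> VF U" and Y: "Y \<in> VF U" and Z: "Z \<in> VF U" and f: "smooth U f"
  shows "curv X Y (\<lambda>q. f q *\<^sub>R Z q) p = f p *\<^sub>R curv X Y Z p"
proof -
  note vf = X Y Z VF_scale[OF _ f] D_VF[OF U(1)] lie_bracket_VF[OF U(1)]
  have 1: "D B (D B' (\<lambda>q. f q *\<^sub>R Z q)) p = B p (\<lambda>q. B' q f) *\<^sub>R Z p + B' p f *\<^sub>R D B Z p +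
      B p f *\<^sub>R D B' Z p + f p *\<^sub>R D B (D B' Z) p"
    if B: "B \<in> VF U" "B' \<in> VF U" for B B'
  proof -
    have Bf: "smooth U (\<lambda>q. B' q f)" by (intro VF_smooth[OF B(2)] U f subset_refl)
    have "D B (D B' (\<lambda>q. f q *\<^sub>R Z q)) p = D B (\<lambda>q. B' q f *\<^sub>R Z q + f q *\<^sub>R D B' Z q) p"
      by (rule D_cong[OF U B(1) VF_add[OF VF_scale[OF Z Bf] VF_scale[OF D_VF[OF U(1) B(2) Z] f]]])
        (simp_all add: D_scale_right[OF U(1) _ B(2) Z f])
    also have "\<dots> = D B (\<lambda>q. B' q f *\<^sub>R Z q) p + D B (\<lambda>q. f q *\<^sub>R D B' Z q) p"
      by (rule D_add_right[OF U]) (intro vf B VF_scale[OF _ Bf])+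
    finally show ?thesis
      using D_scale_right[OF U B(1) Z Bf] D_scale_right[OF U B(1) D_VF[OF U(1) B(2) Z] f]
      by (simp add: algebra_simps)
  qed
  have "D (lie_bracket A X Y) (\<lambda>q. f q *\<^sub>R Z q) p =
      (X p (\<lambda>q. Y q f) - Y p (\<lambda>q. X q f)) *\<^sub>R Z p + f p *\<^sub>R D (lie_bracket A X Y) Z p"
    using D_scale_right[OF U lie_bracket_VF[OF U(1) X Y] Z f]
      lie_bracket_apply[OF smooth_nearI[OF U f], of X Y] by simp
  then show ?thesis
    by (simp add: curvature_def 1 X Y algebra_simps)
qed

lemma curv_expand:
  assumes U: "open U" "p \<in> U" and c: "c \<in> A" "U \<subseteq> fst c"
    and X: "X \<in> VF U" and Y: "Y \<in> VF U" and Z: "Z \<in> VF U"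
  shows "curv X Y Z p = (\<Sum>a\<in>Basis. X p (coord c a) *\<^sub>R (\<Sum>b\<in>Basis. Y p (coord c b) *\<^sub>R
    (\<Sum>d\<in>Basis. Z p (coord c d) *\<^sub>R curv (chart_vec A c a) (chart_vec A c b) (chart_vec A c d) p)))"
proof -
  let ?E = "chart_vec A c"
  have E: "?E b \<in> VF U" for b using VF_subset[OF VF_coordinate[OF c(1)] c(2)] .
  have Z_exp: "curv X Y Z p = (\<Sum>d\<in>Basis. Z p (coord c d) *\<^sub>R curv X Y (?E d) p)"
    if X: "X \<in> VF U" and Y: "Y \<in> VF U" for X Y
    by (rule tensorial_expand[OF U c Z, of "\<lambda>Z. curv X Y Z p"])
      (fact curv_add_3[OF U X Y] curv_scale_3[OF U X Y] curv_cong[OF U X Y _ refl refl])+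
  have X_exp: "curv X Y Z p = (\<Sum>a\<in>Basis. X p (coord c a) *\<^sub>R curv (?E a) Y Z p)"
    if X: "X \<in> VF U" and Y: "Y \<in> VF U" for X Y
    by (rule tensorial_expand[OF U c X, of "\<lambda>X. curv X Y Z p"])
      (fact curv_add_1[OF U _ _ Y Z] curv_scale_1[OF U _ Y Z] curv_cong[OF U _ Y Z _ refl refl])+
  have Y_exp: "curv X Y Z p = (\<Sum>b\<in>Basis. Y p (coord c b) *\<^sub>R curv X (?E b) Z p)"
    if X: "X \<in> VF U" and Y: "Y \<in> VF U" for X Y
    using X_exp[OF Y X] curv_skew[OF U X Y Z] curv_skew[OF U X E Z] by (simp add: sum_negf)
  show ?thesis
    by (simp add: X_exp[OF X Y] Y_exp[OF E Y] Z_exp[OF E E])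
qed

abbreviation curv_at :: "'m \<Rightarrow> 'm tvec \<Rightarrow> 'm tvec \<Rightarrow> 'm tvec \<Rightarrow> 'm tvec" where
  "curv_at \<equiv> curvature_at A D"

text \<open>The description of the curvature tensor by extensions to local fields is unambiguous, since by
  tensoriality two extensions give the same value. So pointwise identities may be checked on
  coordinate fields, which commute.\<close>

lemma curvature_at_eq:
  assumes U: "open U" "p \<in> U" and X: "X \<in> VF U" and Y: "Y \<in> VF U" and Z: "Z \<in> VF U"
  shows "curv_at p (X p) (Y p) (Z p) = curv X Y Z p"
  unfolding curvature_at_def
proof (rule the_equality)
  show "\<exists>U X' Y' Z'. open U \<and> p \<in> U \<and> X' \<in> VF U \<and> Y' \<in> VF U \<and> Z' \<in> VF U \<and>
      X' p = X p \<and> Y' p = Y p \<and> Z' p = Z p \<and> curv X Y Z p = curv X' Y' Z' p"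
    using assms by blast
  fix r
  assume "\<exists>U X' Y' Z'. open U \<and> p \<in> U \<and> X' \<in> VF U \<and> Y' \<in> VF U \<and> Z' \<in> VF U \<and>
      X' p = X p \<and> Y' p = Y p \<and> Z' p = Z p \<and> r = curv X' Y' Z' p"
  then obtain U' X' Y' Z' where U': "open U'" "p \<in> U'"
    and VF': "X' \<in> VF U'" "Y' \<in> VF U'" "Z' \<in> VF U'"
    and eq: "X' p = X p" "Y' p = Y p" "Z' p = Z p" and r: "r = curv X' Y' Z' p"
    by blast
  obtain c where c: "c \<in> A" "p \<in> fst c" using charts_cover by blast
  note co = chart_open[OF c(1)]
  have "curv X Y Z p = (\<Sum>a\<in>Basis. X p (coord c a) *\<^sub>R (\<Sum>b\<in>Basis. Y p (coord c b) *\<^sub>R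
      (\<Sum>d\<in>Basis. Z p (coord c d) *\<^sub>R curv (chart_vec A c a) (chart_vec A c b) (chart_vec A c d) p)))"
    by (rule curv_expand[of "U \<inter> fst c"])
      (use U c co VF_subset[OF X, of "U \<inter> fst c"] VF_subset[OF Y, of "U \<inter> fst c"]
        VF_subset[OF Z, of "U \<inter> fst c"] in \<open>simp_all add: open_Int\<close>)
  moreover have "curv X' Y' Z' p = (\<Sum>a\<in>Basis. X' p (coord c a) *\<^sub>R (\<Sum>b\<in>Basis. Y' p (coord c b) *\<^sub>R
      (\<Sum>d\<in>Basis. Z' p (coord c d) *\<^sub>R curv (chart_vec A c a) (chart_vec A c b) (chart_vec A c d) p)))"
    by (rule curv_expand[of "U' \<inter> fst c"])
      (use U' c co VF_subset[OF VF'(1), of "U' \<inter> fst c"] VF_subset[OF VF'(2), of "U' \<inter> fst c"]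
        VF_subset[OF VF'(3), of "U' \<inter> fst c"] in \<open>simp_all add: open_Int\<close>)
  ultimately show "r = curv X Y Z p" using r eq by simp
qed

lemma curvature_at_coordinate:
  assumes "c \<in> A" "p \<in> fst c"
  shows "curv_at p (chart_vec A c u p) (chart_vec A c v p) (chart_vec A c w p) =
    curv (chart_vec A c u) (chart_vec A c v) (chart_vec A c w) p"
  by (rule curvature_at_eq[OF chart_open[OF assms(1)] assms(2)]) (rule VF_coordinate[OF assms(1)])+

lemma curvature_at_tangent:
  assumes "u \<in> tangent A p" "v \<in> tangent A p" "w \<in> tangent A p"
  shows "curv_at p u v w \<in> tangent A p"
proof -
  obtain c where c: "c \<in> A" "p \<in> fst c" using charts_cover by blast
  show ?thesis
    using curvature_at_coordinate[OF c, of "components c u" "components c v" "components c w"]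
      VF_tangent[OF curv_VF[OF chart_open VF_coordinate VF_coordinate VF_coordinate] c(2)] c(1) assms
    by (simp add: chart_vec_components[OF c])
qed

lemma curvature_at_expand:
  assumes c: "c \<in> A" "p \<in> fst c"
    and "u \<in> tangent A p" "v \<in> tangent A p" "w \<in> tangent A p"
  shows "curv_at p u v w = (\<Sum>a\<in>Basis. u (coord c a) *\<^sub>R (\<Sum>b\<in>Basis. v (coord c b) *\<^sub>R
    (\<Sum>d\<in>Basis. w (coord c d) *\<^sub>R curv (chart_vec A c a) (chart_vec A c b) (chart_vec A c d) p)))"
  using curvature_at_coordinate[OF c, of "components c u" "components c v" "components c w"]
    curv_expand[OF chart_open c(2) c(1) subset_refl VF_coordinate VF_coordinate VF_coordinate,
      of "components c u" "components c v" "components c w"] assms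
  by (simp add: chart_vec_components[OF c])

end


section \<open>The Ricci form as a curvature trace\<close>

lemma linear_withinD:
  assumes "linear_within V F" "u \<in> V" "v \<in> V"
  shows "F (a *\<^sub>R u + b *\<^sub>R v) = a *\<^sub>R F u + b *\<^sub>R F v"
  using assms by (auto simp: linear_within_def)

lemma bilinear_withinD:
  assumes V: "subspace V" and t: "bilinear_within V t" and "u \<in> V" "u' \<in> V" "v \<in> V" "v' \<in> V"
  shows "t (a *\<^sub>R u + b *\<^sub>R u') (c *\<^sub>R v + d *\<^sub>R v') =
    a * c * t u v + a * d * t u v' + b * c * t u' v + b * d * t u' v'"
proof -
  have "c *\<^sub>R v + d *\<^sub>R v' \<in> V" using assms by (intro subspace_add subspace_scale)
  then show ?thesis
    using t assms(3-6) linear_withinD[of V "\<lambda>u. t u (c *\<^sub>R v + d *\<^sub>R v')" u u' a b]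
      linear_withinD[of V "t u" v v' c d] linear_withinD[of V "t u'" v v' c d]
    by (simp add: bilinear_within_def algebra_simps)
qed

context manifold_connection
begin

lemma curvature_at_linear_1:
  assumes "v \<in> tangent A p" "w \<in> tangent A p"
  shows "linear_within (tangent A p) (\<lambda>u. curv_at p u v w)"
proof -
  obtain c where c: "c \<in> A" "p \<in> fst c" using charts_cover by blast
  have "a *\<^sub>R u + b *\<^sub>R u' \<in> tangent A p" if "u \<in> tangent A p" "u' \<in> tangent A p" for u u' a b
    using that by (intro subspace_add subspace_scale tangent_subspace)
  then show ?thesis
    using assms
    by (simp add: linear_within_def curvature_at_expand[OF c] sum.distrib scaleR_sum_right algebra_simps)
qed

lemma curvature_at_linear_3:
  assumes "u \<in> tangent A p" "v \<in> tangent A p"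
  shows "linear_within (tangent A p) (\<lambda>w. curv_at p u v w)"
proof -
  obtain c where c: "c \<in> A" "p \<in> fst c" using charts_cover by blast
  have "a *\<^sub>R u + b *\<^sub>R u' \<in> tangent A p" if "u \<in> tangent A p" "u' \<in> tangent A p" for u u' a b
    using that by (intro subspace_add subspace_scale tangent_subspace)
  then show ?thesis
    using assms
    by (simp add: linear_within_def curvature_at_expand[OF c] sum.distrib scaleR_sum_right algebra_simps)
qed

end

locale para_kaehler_manifold = manifold_connection A D
  for A :: "('m::topological_space, 'e::euclidean_space) chart set" and D +
  fixes K :: "'m \<Rightarrow> 'm tvec \<Rightarrow> 'm tvec" and g :: "'m \<Rightarrow> 'm tvec \<Rightarrow> 'm tvec \<Rightarrow> real"
  assumes metric: "pseudo_riemannian A g" and levi_civita: "levi_civita A g D"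
    and endo: "endo_field A K"
    and K_K: "u \<in> tangent A p \<Longrightarrow> K p (K p u) = u"
    and K_skew: "u \<in> tangent A p \<Longrightarrow> v \<in> tangent A p \<Longrightarrow> g p (K p u) v = - g p u (K p v)"
    and K_parallel: "open U \<Longrightarrow> X \<in> vector_fields A U \<Longrightarrow> Y \<in> vector_fields A U \<Longrightarrow> p \<in> U \<Longrightarrow>
      D X (\<lambda>q. K q (Y q)) p = K p (D X Y p)"
begin

lemma K_tangent: "u \<in> tangent A p \<Longrightarrow> K p u \<in> tangent A p"
  using endo by (auto simp: endo_field_def)

lemma K_linear: "linear_within (tangent A p) (K p)"
  using endo by (auto simp: endo_field_def)

lemma K_add: "u \<in> tangent A p \<Longrightarrow> v \<in> tangent A p \<Longrightarrow> K p (u + v) = K p u + K p v"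
  using linear_withinD[OF K_linear, of u p v 1 1] by simp

lemma K_scale: "u \<in> tangent A p \<Longrightarrow> K p (r *\<^sub>R u) = r *\<^sub>R K p u"
  using linear_withinD[OF K_linear, of u p u r 0] by simp

lemma K_diff: "u \<in> tangent A p \<Longrightarrow> v \<in> tangent A p \<Longrightarrow> K p (u - v) = K p u - K p v"
  using linear_withinD[OF K_linear, of u p v 1 "- 1"] by simp

lemma K_VF: "open U \<Longrightarrow> X \<in> VF U \<Longrightarrow> (\<lambda>q. K q (X q)) \<in> VF U"
  using endo by (auto simp: endo_field_def)

lemma g_bilinear: "bilinear_within (tangent A p) (g p)"
  using metric by (auto simp: pseudo_riemannian_def tensor_field2_def)

lemma g_linear_right: "u \<in> tangent A p \<Longrightarrow> linear_within (tangent A p) (g p u)"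
  using g_bilinear by (auto simp: bilinear_within_def)

lemma g_sym: "u \<in> tangent A p \<Longrightarrow> v \<in> tangent A p \<Longrightarrow> g p u v = g p v u"
  using metric by (auto simp: pseudo_riemannian_def)

lemma g_linear_left: "v \<in> tangent A p \<Longrightarrow> linear_within (tangent A p) (\<lambda>u. g p u v)"
  using g_bilinear by (auto simp: bilinear_within_def)

lemma g_nondegenerate: "u \<in> tangent A p \<Longrightarrow> (\<And>v. v \<in> tangent A p \<Longrightarrow> g p u v = 0) \<Longrightarrow> u = 0"
  using metric by (auto simp: pseudo_riemannian_def)

lemma g_smooth:
  "open U \<Longrightarrow> X \<in> VF U \<Longrightarrow> Y \<in> VF U \<Longrightarrow> smooth U (\<lambda>q. g q (X q) (Y q))"
  using metric by (auto simp: pseudo_riemannian_def tensor_field2_def)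

lemma torsion_free:
  "open U \<Longrightarrow> p \<in> U \<Longrightarrow> X \<in> VF U \<Longrightarrow> Y \<in> VF U \<Longrightarrow> D X Y p - D Y X p = lie_bracket A X Y p"
  using levi_civita by (auto simp: levi_civita_def)

lemma metric_compatible:
  "open U \<Longrightarrow> p \<in> U \<Longrightarrow> X \<in> VF U \<Longrightarrow> Y \<in> VF U \<Longrightarrow> Z \<in> VF U \<Longrightarrow>
   X p (\<lambda>q. g q (Y q) (Z q)) = g p (D X Y p) (Z p) + g p (Y p) (D X Z p)"
  using levi_civita by (auto simp: levi_civita_def)

lemma coordinate_D_sym:
  assumes "c \<in> A" "p \<in> fst c"
  shows "D (chart_vec A c v) (chart_vec A c w) p = D (chart_vec A c w) (chart_vec A c v) p"
  using torsion_free[OF chart_open assms(2) VF_coordinate VF_coordinate] assms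
  by (simp add: lie_bracket_coordinate[OF assms])

lemma curv_coordinate:
  assumes c: "c \<in> A" and p: "p \<in> fst c" and Z: "Z \<in> VF (fst c)"
  shows "curv (chart_vec A c u) (chart_vec A c v) Z p =
    D (chart_vec A c u) (D (chart_vec A c v) Z) p - D (chart_vec A c v) (D (chart_vec A c u) Z) p"
proof -
  note co = chart_open[OF c]
  have "D (lie_bracket A (chart_vec A c u) (chart_vec A c v)) Z p = D (\<lambda>q. 0) Z p"
    by (rule D_cong[OF co p VF_zero Z]) (simp_all add: lie_bracket_coordinate[OF c])
  then show ?thesis
    by (simp add: curvature_def D_zero_left[OF co p Z])
qed

text \<open>For commuting fields \<open>D\<^sub>X Y = D\<^sub>Y X\<close>, which cancels the six second derivatives in pairs.\<close>

lemma coordinate_bianchi: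
  fixes u v w :: 'e
  assumes c: "c \<in> A" and p: "p \<in> fst c"
  defines "E \<equiv> chart_vec A c"
  shows "curv (E u) (E v) (E w) p + curv (E v) (E w) (E u) p + curv (E w) (E u) (E v) p = 0"
proof -
  note co = chart_open[OF c]
  have E: "E a \<in> VF (fst c)" for a unfolding E_def by (rule VF_coordinate[OF c])
  have sym: "D (E a) (D (E b) (E d)) p = D (E a) (D (E d) (E b)) p" for a b d
    by (rule D_cong[OF co p E D_VF[OF co E E]]) (simp_all add: E_def coordinate_D_sym[OF c])
  show ?thesis
    using sym[of u v w] sym[of v w u] sym[of w u v]
    by (simp add: curv_coordinate[OF c p, folded E_def, OF E])
qed

text \<open>Two derivatives of \<open>g(E\<^sub>w, E\<^sub>x)\<close> along commuting fields, taken in both orders.\<close>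

lemma coordinate_curv_metric:
  fixes u v w x :: 'e
  assumes c: "c \<in> A" and p: "p \<in> fst c"
  defines "E \<equiv> chart_vec A c"
  shows "g p (curv (E u) (E v) (E w) p) (E x p) = - g p (E w p) (curv (E u) (E v) (E x) p)"
proof -
  note co = chart_open[OF c]
  have E: "E a \<in> VF (fst c)" for a unfolding E_def by (rule VF_coordinate[OF c])
  note DE = D_VF[OF co E]
  have sn: "smooth_near A p (\<lambda>q. g q (X q) (Y q))" if "X \<in> VF (fst c)" "Y \<in> VF (fst c)" for X Y
    by (rule smooth_nearI[OF co p g_smooth[OF co that]])
  have T: "E a p \<in> tangent A p" for a by (rule VF_tangent[OF E p])
  have second: "E a p (\<lambda>q. E b q (\<lambda>r. g r (E w r) (E x r))) =
      g p (D (E a) (D (E b) (E w)) p) (E x p) + g p (D (E b) (E w) p) (D (E a) (E x) p) +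
      (g p (D (E a) (E w) p) (D (E b) (E x) p) + g p (E w p) (D (E a) (D (E b) (E x)) p))" for a b
  proof -
    have "E a p (\<lambda>q. E b q (\<lambda>r. g r (E w r) (E x r))) =
        E a p (\<lambda>q. g q (D (E b) (E w) q) (E x q) + g q (E w q) (D (E b) (E x) q))"
      by (rule tangent_germ[OF T co p]) (rule metric_compatible[OF co _ E E E])
    also have "\<dots> = E a p (\<lambda>q. g q (D (E b) (E w) q) (E x q)) + E a p (\<lambda>q. g q (E w q) (D (E b) (E x) q))"
      by (rule tangent_add[OF T sn[OF DE[OF E] E] sn[OF E DE[OF E]]])
    finally show ?thesis
      using metric_compatible[OF co p E DE[OF E] E] metric_compatible[OF co p E E DE[OF E]] by simp
  qed
  have DD: "D (E a) (D (E b) (E d)) p \<in> tangent A p" for a b d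
    by (rule VF_tangent[OF DE[OF DE[OF E]] p])
  have comm: "E u p (\<lambda>q. E v q (\<lambda>r. g r (E w r) (E x r))) = E v p (\<lambda>q. E u q (\<lambda>r. g r (E w r) (E x r)))"
    unfolding E_def by (rule coordinate_fields_commute[OF c p sn[OF E E, unfolded E_def]])
  have l: "g p (D (E u) (D (E v) (E w)) p - D (E v) (D (E u) (E w)) p) (E x p) =
      g p (D (E u) (D (E v) (E w)) p) (E x p) - g p (D (E v) (D (E u) (E w)) p) (E x p)"
    using linear_withinD[OF g_linear_left[OF T[of x]] DD[of u v w] DD[of v u w], of 1 "- 1"] by simp
  have r: "g p (E w p) (D (E u) (D (E v) (E x)) p - D (E v) (D (E u) (E x)) p) =
      g p (E w p) (D (E u) (D (E v) (E x)) p) - g p (E w p) (D (E v) (D (E u) (E x)) p)"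
    using linear_withinD[OF g_linear_right[OF T[of w]] DD[of u v x] DD[of v u x], of 1 "- 1"] by simp
  show ?thesis
    using comm unfolding second curv_coordinate[OF c p, folded E_def, OF E] l r by simp
qed

lemma curv_K:
  assumes U: "open U" "p \<in> U" and X: "X \<in> VF U" and Y: "Y \<in> VF U" and Z: "Z \<in> VF U"
  shows "curv X Y (\<lambda>q. K q (Z q)) p = K p (curv X Y Z p)"
proof -
  have 1: "D B (D B' (\<lambda>q. K q (Z q))) p = K p (D B (D B' Z) p)" if B: "B \<in> VF U" "B' \<in> VF U" for B B'
  proof -
    have "D B (D B' (\<lambda>q. K q (Z q))) p = D B (\<lambda>q. K q (D B' Z q)) p"
      by (rule D_cong[OF U B(1) K_VF[OF U(1) D_VF[OF U(1) B(2) Z]] refl K_parallel[OF U(1) B(2) Z]])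
    then show ?thesis by (simp add: K_parallel[OF U(1) B(1) D_VF[OF U(1) B(2) Z] U(2)])
  qed
  have T: "D B (D B' Z) p \<in> tangent A p" "D B Z p \<in> tangent A p" if "B \<in> VF U" "B' \<in> VF U" for B B'
    using VF_tangent[OF _ U(2)] D_VF[OF U(1)] that Z by auto
  have L: "lie_bracket A X Y \<in> VF U" by (rule lie_bracket_VF[OF U(1) X Y])
  show ?thesis
    using T[OF X Y] T[OF Y X] T(2)[OF L L]
    by (simp add: curvature_def 1[OF X Y] 1[OF Y X] K_parallel[OF U(1) L Z U(2)] K_diff
        subspace_diff[OF tangent_subspace])
qed

abbreviation coord_metric :: "('m, 'e) chart \<Rightarrow> 'm \<Rightarrow> 'e \<Rightarrow> 'e \<Rightarrow> real" where
  "coord_metric c p \<equiv> \<lambda>u v. g p (chart_vec A c u p) (chart_vec A c v p)"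

abbreviation coord_K :: "('m, 'e) chart \<Rightarrow> 'm \<Rightarrow> 'e \<Rightarrow> 'e" where
  "coord_K c p \<equiv> \<lambda>u. components c (K p (chart_vec A c u p))"

abbreviation coord_curv :: "('m, 'e) chart \<Rightarrow> 'm \<Rightarrow> 'e \<Rightarrow> 'e \<Rightarrow> 'e \<Rightarrow> 'e" where
  "coord_curv c p \<equiv> \<lambda>u v w. components c
     (curv_at p (chart_vec A c u p) (chart_vec A c v p) (chart_vec A c w p))"

lemma curvature_tensor:
  assumes c: "c \<in> A" and p: "p \<in> fst c"
  shows "para_kaehler_curvature (coord_metric c p) (coord_K c p) (coord_curv c p)"
proof -
  let ?E = "chart_vec A c"
  note co = chart_open[OF c] and E = VF_coordinate[OF c] and lin = chart_vec_linear[OF c p]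
  note T = chart_vec_tangent[OF c p]
  have R: "curv_at p (?E u p) (?E v p) (?E w p) \<in> tangent A p" for u v w
    by (rule curvature_at_tangent[OF T T T])
  have inv: "?E (components c t) p = t" if "t \<in> tangent A p" for t
    by (rule chart_vec_components[OF c p that])
  have lw: "linear (\<lambda>w. F (?E w p))" if "linear_within (tangent A p) F" for F :: "'m tvec \<Rightarrow> 'v::real_vector"
    by (rule linearI)
      (use linear_withinD[OF that T T, of 1 _ 1] linear_withinD[OF that T T, of _ _ 0]
        in \<open>simp_all add: linear_add[OF lin] linear_cmul[OF lin]\<close>)
  show ?thesis
  proof (rule para_kaehler_curvature.intro)
    fix u v w x :: 'e
    show "bilinear (coord_metric c p)"
      unfolding bilinear_def using lw g_linear_left[OF T] g_linear_right[OF T] by blast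
    show "g p (?E u p) (?E v p) = g p (?E v p) (?E u p)" by (rule g_sym[OF T T])
    show "u = 0" if "\<And>v. g p (?E u p) (?E v p) = 0"
    proof -
      have "?E u p = 0"
      proof (rule g_nondegenerate[OF T])
        show "g p (?E u p) t = 0" if "t \<in> tangent A p" for t
          using \<open>\<And>v. g p (?E u p) (?E v p) = 0\<close>[of "components c t"] inv[OF that] by simp
      qed
      then show "u = 0"
        using components_chart_vec[OF c p, of u] linear_0[OF components_linear, of c] by simp
    qed
    show "linear (coord_K c p)"
      using linear_compose[OF lw[OF K_linear] components_linear] by (simp add: o_def)
    show "coord_K c p (coord_K c p u) = u"
      by (simp add: inv K_tangent T K_K components_chart_vec[OF c p])
    show "coord_metric c p (coord_K c p u) v = - coord_metric c p u (coord_K c p v)"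
      by (simp add: inv K_tangent T K_skew)
    show "linear (\<lambda>u. coord_curv c p u v w)"
      using linear_compose[OF lw[OF curvature_at_linear_1[OF T T]] components_linear] by (simp add: o_def)
    show "linear (coord_curv c p u v)"
      using linear_compose[OF lw[OF curvature_at_linear_3[OF T T]] components_linear] by (simp add: o_def)
    show "coord_curv c p v u w = - coord_curv c p u v w"
      by (simp add: curvature_at_coordinate[OF c p] curv_skew[OF co p E E E, of v u] linear_neg[OF components_linear])
    show "coord_curv c p u v w + coord_curv c p v w u + coord_curv c p w u v = 0"
      using coordinate_bianchi[OF c p, of u v w] linear_0[OF components_linear, of c]
      by (simp add: curvature_at_coordinate[OF c p] linear_add[OF components_linear, symmetric])
    show "coord_metric c p (coord_curv c p u v w) x = - coord_metric c p w (coord_curv c p u v x)"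
      using coordinate_curv_metric[OF c p, of u v w x] R
      by (simp add: inv curvature_at_coordinate[OF c p])
    show "coord_curv c p u v (coord_K c p w) = coord_K c p (coord_curv c p u v w)"
      using curvature_at_eq[OF co p E E K_VF[OF co E], of u v w] curv_K[OF co p E E E, of u v w] R
      by (simp add: inv K_tangent T curvature_at_coordinate[OF c p])
  qed
qed

lemma ricci_coordinate:
  assumes c: "c \<in> A" and p: "p \<in> fst c" and u: "u \<in> tangent A p" and v: "v \<in> tangent A p"
  shows "ricci A D p u v = para_kaehler_curvature.ric (coord_curv c p) (components c u) (components c v)"
proof -
  have r: "range (\<lambda>w. chart_vec A c w p) = tangent A p" using tangent_eq_range[OF c p] by simp
  have "ricci A D p u v = etr (\<lambda>w. components c (curv_at p (chart_vec A c w p) u v))"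
    unfolding ricci_def
    by (rule trace_on_eq_etr[where \<phi> = "\<lambda>w. chart_vec A c w p" and \<psi> = "components c", unfolded r])
      (use curvature_at_linear_1[OF u v] curvature_at_tangent u v chart_vec_linear[OF c p]
        components_linear components_chart_vec[OF c p] in auto)
  then show ?thesis
    by (simp add: para_kaehler_curvature.ric_def[OF curvature_tensor[OF c p]]
        chart_vec_components[OF c p u] chart_vec_components[OF c p v])
qed

text \<open>This expression for \<open>- tr (K R(u, v)) / 2\<close> is the key to everything that follows: unlike
  \<open>Ric(u, K v)\<close>, where \<open>u\<close> is tied up in the trace, it has both arguments outside the trace, as a
  first Chern form does.\<close>

lemma ricci_form_trace:
  assumes c: "c \<in> A" and p: "p \<in> fst c" and u: "u \<in> tangent A p" and v: "v \<in> tangent A p"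
  shows "ricci_form A K D p u v =
    - (\<Sum>b\<in>Basis. K p (curv_at p u v (chart_vec A c b p)) (coord c b)) / 2"
proof -
  interpret R: para_kaehler_curvature "coord_metric c p" "coord_K c p" "coord_curv c p"
    by (rule curvature_tensor[OF c p])
  note inv = chart_vec_components[OF c p] and T = chart_vec_tangent[OF c p]
  have "ricci_form A K D p u v = R.ric (components c u) (coord_K c p (components c v))"
    by (simp add: ricci_form_def ricci_coordinate[OF c p u K_tangent[OF v]] inv[OF v])
  also have "\<dots> = - etr (\<lambda>w. components c (K p (curv_at p u v (chart_vec A c w p)))) / 2"
    unfolding R.ric_K_eq_trace using u v T by (simp add: inv curvature_at_tangent)
  finally show ?thesis by (simp add: etr_def components_inner)
qed

lemma curvature_trace_zero:
  assumes c: "c \<in> A" and p: "p \<in> fst c" and u: "u \<in> tangent A p" and v: "v \<in> tangent A p"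
  shows "(\<Sum>b\<in>Basis. curv_at p u v (chart_vec A c b p) (coord c b)) = 0"
proof -
  interpret R: para_kaehler_curvature "coord_metric c p" "coord_K c p" "coord_curv c p"
    by (rule curvature_tensor[OF c p])
  show ?thesis
    using R.etr_curvature[of "components c u" "components c v"] chart_vec_components[OF c p] u v
    by (simp add: etr_def components_inner)
qed

lemma ricci_form_skew:
  assumes u: "u \<in> tangent A p" and v: "v \<in> tangent A p"
  shows "ricci_form A K D p u v = - ricci_form A K D p v u"
proof -
  obtain c where c: "c \<in> A" "p \<in> fst c" using charts_cover by blast
  interpret R: para_kaehler_curvature "coord_metric c p" "coord_K c p" "coord_curv c p"
    by (rule curvature_tensor[OF c])
  show ?thesis
    using R.ric_K_skew[of "components c u" "components c v"] chart_vec_components[OF c] u v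
    by (simp add: ricci_form_def ricci_coordinate[OF c] K_tangent)
qed

lemma ricci_form_K_K:
  assumes u: "u \<in> tangent A p" and v: "v \<in> tangent A p"
  shows "ricci_form A K D p (K p u) (K p v) = - ricci_form A K D p u v"
proof -
  obtain c where c: "c \<in> A" "p \<in> fst c" using charts_cover by blast
  interpret R: para_kaehler_curvature "coord_metric c p" "coord_K c p" "coord_curv c p"
    by (rule curvature_tensor[OF c])
  show ?thesis
    using R.ric_K_K[of "components c u" "components c (K p v)"] chart_vec_components[OF c] u v
    by (simp add: ricci_form_def ricci_coordinate[OF c] K_tangent)
qed

lemma ricci_form_bilinear: "bilinear_within (tangent A p) (ricci_form A K D p)"
proof -
  let ?T = "tangent A p"
  obtain c where c: "c \<in> A" "p \<in> fst c" using charts_cover by blast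
  note T = chart_vec_tangent[OF c]
  have left: "linear_within ?T (\<lambda>u. ricci_form A K D p u v)" if v: "v \<in> ?T" for v
    unfolding linear_within_def
  proof (intro ballI allI)
    fix u u' a b assume u: "u \<in> ?T" "u' \<in> ?T"
    have s: "a *\<^sub>R u + b *\<^sub>R u' \<in> ?T"
      using u by (intro subspace_add subspace_scale tangent_subspace)
    have "K p (curv_at p (a *\<^sub>R u + b *\<^sub>R u') v (chart_vec A c d p)) =
        a *\<^sub>R K p (curv_at p u v (chart_vec A c d p)) + b *\<^sub>R K p (curv_at p u' v (chart_vec A c d p))" for d
      using linear_withinD[OF curvature_at_linear_1[OF v T] u]
        linear_withinD[OF K_linear curvature_at_tangent[OF u(1) v T] curvature_at_tangent[OF u(2) v T]]
      by simp
    then show "ricci_form A K D p (a *\<^sub>R u + b *\<^sub>R u') v =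
        a *\<^sub>R ricci_form A K D p u v + b *\<^sub>R ricci_form A K D p u' v"
      by (simp add: ricci_form_trace[OF c _ v] u s sum.distrib sum_distrib_left[symmetric] field_simps)
  qed
  have right: "linear_within ?T (ricci_form A K D p u)" if u: "u \<in> ?T" for u
    unfolding linear_within_def
  proof (intro ballI allI)
    fix v v' a b assume v: "v \<in> ?T" "v' \<in> ?T"
    have s: "a *\<^sub>R v + b *\<^sub>R v' \<in> ?T"
      using v by (intro subspace_add subspace_scale tangent_subspace)
    show "ricci_form A K D p u (a *\<^sub>R v + b *\<^sub>R v') =
        a *\<^sub>R ricci_form A K D p u v + b *\<^sub>R ricci_form A K D p u v'"
      using linear_withinD[OF left[OF u] v, of a b] ricci_form_skew[OF u s]
        ricci_form_skew[OF u v(1)] ricci_form_skew[OF u v(2)] by simp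
  qed
  show ?thesis unfolding bilinear_within_def using left right by blast
qed

lemma ricci_form_fields:
  assumes c: "c \<in> A" and U: "open U" "U \<subseteq> fst c" "p \<in> U" and X: "X \<in> VF U" and Y: "Y \<in> VF U"
  shows "ricci_form A K D p (X p) (Y p) =
    - (\<Sum>b\<in>Basis. K p (curv X Y (chart_vec A c b) p) (coord c b)) / 2"
proof -
  have p: "p \<in> fst c" using U by blast
  have "curv_at p (X p) (Y p) (chart_vec A c b p) = curv X Y (chart_vec A c b) p" for b
    by (rule curvature_at_eq[OF U(1,3) X Y VF_subset[OF VF_coordinate[OF c] U(2)]])
  then show ?thesis
    using ricci_form_trace[OF c p VF_tangent[OF X U(3)] VF_tangent[OF Y U(3)]] by simp
qed

lemma ricci_form_two_form: "two_form A (ricci_form A K D)"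
proof -
  have "smooth U (\<lambda>p. ricci_form A K D p (X p) (Y p))"
    if U: "open U" and X: "X \<in> VF U" and Y: "Y \<in> VF U" for U X Y
  proof (rule smooth_fun_local)
    fix p assume p: "p \<in> U"
    obtain c where c: "c \<in> A" "p \<in> fst c" using charts_cover by blast
    define W where "W = U \<inter> fst c"
    have W: "open W" "W \<subseteq> fst c" "W \<subseteq> U" "p \<in> W"
      using U p c chart_open[OF c(1)] by (auto simp: W_def open_Int)
    have XW: "X \<in> VF W" "Y \<in> VF W" and E: "chart_vec A c b \<in> VF W" for b
      using VF_subset X Y W VF_coordinate[OF c(1)] by blast+
    have "smooth W (\<lambda>q. (- 1 / 2) * (\<Sum>b\<in>Basis. K q (curv X Y (chart_vec A c b) q) (coord c b)))"
      by (intro smooth_fun_mult smooth_fun_const smooth_fun_sum W(1)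
          VF_coeff_smooth[OF c(1) W(1,2) K_VF[OF W(1) curv_VF[OF W(1) XW E]]])
    then have "smooth W (\<lambda>q. ricci_form A K D q (X q) (Y q))"
      by (rule smooth_fun_cong[OF W(1), rotated])
        (simp add: ricci_form_fields[OF c(1) W(1,2) _ XW])
    then show "\<exists>W. open W \<and> p \<in> W \<and> smooth W (\<lambda>q. ricci_form A K D q (X q) (Y q))"
      using W by blast
  qed
  then show ?thesis
    unfolding two_form_def tensor_field2_def using ricci_form_bilinear ricci_form_skew by blast
qed

end


section \<open>Closedness of the Ricci form\<close>

context manifold_connection
begin

lemma D_expand_right:
  assumes U: "open U" "p \<in> U" and c: "c \<in> A" "U \<subseteq> fst c" and X: "X \<in> VF U" and Y: "Y \<in> VF U"
  shows "D X Y p = (\<Sum>a\<in>Basis. X p (\<lambda>q. Y q (coord c a)) *\<^sub>R chart_vec A c a p +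
    Y p (coord c a) *\<^sub>R D X (chart_vec A c a) p)"
proof -
  let ?E = "chart_vec A c" and ?h = "\<lambda>a q. Y q (coord c a)"
  have E: "?E a \<in> VF U" for a using VF_subset[OF VF_coordinate[OF c(1)] c(2)] .
  have h: "smooth U (?h a)" for a using VF_coeff_smooth[OF c(1) U(1) c(2) Y] .
  have "D X Y p = D X (\<lambda>q. \<Sum>a\<in>Basis. ?h a q *\<^sub>R ?E a q) p"
    by (rule D_cong[OF U X VF_sum[OF VF_scale[OF E h]] refl]) (use VF_expand[OF c(1) _ _ Y] c(2) in auto)
  then show ?thesis by (simp only: D_sum_right[OF U X E h finite_Basis])
qed

text \<open>Taking traces is parallel: \<open>X (tr F) = tr [D\<^sub>X, F]\<close>. With \<open>A'\<close> the matrix of \<open>F\<close> and \<open>\<Gamma>\<close> that of \<open>D\<^sub>X\<close> in a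
  coordinate frame, the two sides differ by \<open>tr (\<Gamma> A') - tr (A' \<Gamma>) = 0\<close>.\<close>

lemma trace_derivative:
  fixes F :: "('m \<Rightarrow> 'm tvec) \<Rightarrow> 'm \<Rightarrow> 'm tvec"
  assumes U: "open U" "p \<in> U" and c: "c \<in> A" "U \<subseteq> fst c" and X: "X \<in> VF U"
    and F: "\<And>Y. Y \<in> VF U \<Longrightarrow> F Y \<in> VF U"
    and add: "\<And>Y Z. Y \<in> VF U \<Longrightarrow> Z \<in> VF U \<Longrightarrow> F (\<lambda>q. Y q + Z q) p = F Y p + F Z p"
    and scale: "\<And>Y f. Y \<in> VF U \<Longrightarrow> smooth U f \<Longrightarrow> F (\<lambda>q. f q *\<^sub>R Y q) p = f p *\<^sub>R F Y p"
    and cong: "\<And>Y Z. Y \<in> VF U \<Longrightarrow> (\<And>q. q \<in> U \<Longrightarrow> Z q = Y q) \<Longrightarrow> F Z p = F Y p"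
  shows "X p (\<lambda>q. \<Sum>b\<in>Basis. F (chart_vec A c b) q (coord c b)) =
    (\<Sum>b\<in>Basis. (D X (F (chart_vec A c b)) p - F (D X (chart_vec A c b)) p) (coord c b))"
proof -
  let ?E = "chart_vec A c"
  have p: "p \<in> fst c" using U c by blast
  have E: "?E b \<in> VF U" for b using VF_subset[OF VF_coordinate[OF c(1)] c(2)] .
  have co: "?E a p (coord c b) = a \<bullet> b" for a b by (rule chart_vec_coord[OF c(1) p])
  have sn: "smooth_near A p (\<lambda>q. F (?E b) q (coord c a))" for a b
    by (rule smooth_nearI[OF U VF_coeff_smooth[OF c(1) U(1) c(2) F[OF E]]])
  define A' where "A' = (\<lambda>a b. F (?E b) p (coord c a))"
  define \<Gamma> where "\<Gamma> = (\<lambda>a b. D X (?E b) p (coord c a))"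
  have 1: "D X (F (?E b)) p (coord c b) =
      X p (\<lambda>q. F (?E b) q (coord c b)) + (\<Sum>a\<in>Basis. A' a b * \<Gamma> b a)" if b: "b \<in> Basis" for b
    unfolding D_expand_right[OF U c X F[OF E]]
    using b by (simp add: sum_fun_apply co sum.distrib inner_Basis if_distrib A'_def \<Gamma>_def cong: if_cong)
  have 2: "F (D X (?E b)) p (coord c b) = (\<Sum>a\<in>Basis. \<Gamma> a b * A' b a)" for b
  proof -
    have "F (D X (?E b)) p = (\<Sum>a\<in>Basis. D X (?E b) p (coord c a) *\<^sub>R F (?E a) p)"
      by (rule tensorial_expand[OF U c D_VF[OF U(1) X E], of "\<lambda>Y. F Y p"]) (fact add scale cong)+
    then show ?thesis by (simp add: sum_fun_apply A'_def \<Gamma>_def)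
  qed
  have "(\<Sum>b\<in>Basis. \<Sum>a\<in>Basis. A' a b * \<Gamma> b a) = (\<Sum>b\<in>Basis. \<Sum>a\<in>Basis. \<Gamma> a b * A' b a)"
    by (subst sum.swap) (simp add: mult.commute)
  then have "(\<Sum>b\<in>Basis. (D X (F (?E b)) p - F (D X (?E b)) p) (coord c b)) =
      (\<Sum>b\<in>Basis. X p (\<lambda>q. F (?E b) q (coord c b)))"
    by (simp add: 1 2 sum.distrib sum_subtractf)
  also have "\<dots> = X p (\<lambda>q. \<Sum>b\<in>Basis. F (?E b) q (coord c b))"
    by (rule tangent_sum[OF VF_tangent[OF X U(2)] sn, symmetric])
  finally show ?thesis by simp
qed

text \<open>The second Bianchi identity as an identity between operators on fields \<open>V\<close>: it is the Jacobi
  identity for the commutators of \<open>D\<^sub>X, D\<^sub>Y, D\<^sub>Z\<close>, with the Jacobi identity for \<open>X, Y, Z\<close> absorbing the rest.\<close>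

lemma second_bianchi:
  assumes U: "open U" "p \<in> U" and X: "X \<in> VF U" and Y: "Y \<in> VF U" and Z: "Z \<in> VF U" and V: "V \<in> VF U"
  shows "(D X (curv Y Z V) p - curv Y Z (D X V) p) + (D Y (curv Z X V) p - curv Z X (D Y V) p) +
    (D Z (curv X Y V) p - curv X Y (D Z V) p) - curv (lie_bracket A X Y) Z V p -
    curv (lie_bracket A Y Z) X V p - curv (lie_bracket A Z X) Y V p = 0"
proof -
  note DV = D_VF[OF U(1)] and lie = lie_bracket_VF[OF U(1)]
  have 1: "D B (curv B' B'' V) p = D B (D B' (D B'' V)) p - D B (D B'' (D B' V)) p -
      D B (D (lie_bracket A B' B'') V) p"
    if B: "B \<in> VF U" "B' \<in> VF U" "B'' \<in> VF U" for B B' B''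
  proof -
    have "D B (curv B' B'' V) p =
        D B (\<lambda>q. D B' (D B'' V) q - D B'' (D B' V) q - D (lie_bracket A B' B'') V q) p"
      by (simp add: curvature_def[abs_def])
    also have "\<dots> = D B (\<lambda>q. D B' (D B'' V) q - D B'' (D B' V) q) p - D B (D (lie_bracket A B' B'') V) p"
      by (rule D_diff_right[OF U B(1)]) (intro VF_diff DV lie B V)+
    also have "D B (\<lambda>q. D B' (D B'' V) q - D B'' (D B' V) q) p = D B (D B' (D B'' V)) p - D B (D B'' (D B' V)) p"
      by (rule D_diff_right[OF U B(1)]) (intro DV B V)+
    finally show ?thesis .
  qed
  let ?L = "\<lambda>B B' B''. lie_bracket A (lie_bracket A B B') B''"
  have "D (?L X Y Z) V p + D (?L Y Z X) V p + D (?L Z X Y) V p =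
      D (\<lambda>q. ?L X Y Z q + ?L Y Z X q + ?L Z X Y q) V p"
    by (simp add: D_add_left[OF U] VF_add lie X Y Z V)
  also have "\<dots> = D (\<lambda>q. 0) V p"
  proof (rule D_cong[OF U VF_zero V _ refl])
    fix q assume q: "q \<in> U"
    show "?L X Y Z q + ?L Y Z X q + ?L Z X Y q = 0"
      using lie_bracket_jacobi[OF U(1) q X Y Z] lie_bracket_skew[of Z "lie_bracket A X Y" q]
        lie_bracket_skew[of X "lie_bracket A Y Z" q] lie_bracket_skew[of Y "lie_bracket A Z X" q]
      by (simp add: algebra_simps eq_neg_iff_add_eq_0 neg_eq_iff_add_eq_0)
  qed
  finally have "D (?L X Y Z) V p + D (?L Y Z X) V p + D (?L Z X Y) V p = 0"
    by (simp add: D_zero_left[OF U V])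
  then show ?thesis
    unfolding 1[OF X Y Z] 1[OF Y Z X] 1[OF Z X Y] curvature_def
    by (simp add: algebra_simps)
qed

end

text \<open>Up to the factor \<open>-1/2\<close>, the Ricci form is \<open>T(X, Y) = tr (K R(X, Y))\<close>. Since \<open>K\<close> and the trace are
  parallel, a derivative of \<open>T\<close> falls on the curvature only, and the exterior derivative of \<open>T\<close> is the trace
  of \<open>K\<close> times the second Bianchi identity.\<close>

lemma (in para_kaehler_manifold) ricci_form_closed: "closed_two_form A (ricci_form A K D)"
proof -
  let ?\<rho> = "ricci_form A K D"
  have "X p (\<lambda>q. ?\<rho> q (Y q) (Z q)) + Y p (\<lambda>q. ?\<rho> q (Z q) (X q)) + Z p (\<lambda>q. ?\<rho> q (X q) (Y q))
          - ?\<rho> p (lie_bracket A X Y p) (Z p) - ?\<rho> p (lie_bracket A Y Z p) (X p)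
          - ?\<rho> p (lie_bracket A Z X p) (Y p) = 0"
    if U: "open U" "p \<in> U" and XU: "X \<in> VF U" and YU: "Y \<in> VF U" and ZU: "Z \<in> VF U" for U X Y Z p
  proof -
    obtain c where c: "c \<in> A" "p \<in> fst c" using charts_cover by blast
    define W where "W = U \<inter> fst c"
    have W: "open W" "p \<in> W" "W \<subseteq> fst c" "W \<subseteq> U"
      using U c chart_open[OF c(1)] by (auto simp: W_def open_Int)
    let ?E = "chart_vec A c"
    have E: "?E b \<in> VF W" for b using VF_subset[OF VF_coordinate[OF c(1)] W(3)] .
    have X: "X \<in> VF W" and Y: "Y \<in> VF W" and Z: "Z \<in> VF W"
      using VF_subset[OF _ W(4)] XU YU ZU by blast+
    \<comment> \<open>\<open>S X Y Z\<close> is the derivative of \<open>T Y Z\<close> along \<open>X\<close> at \<open>p\<close>\<close>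
    define S where "S = (\<lambda>X Y Z. \<Sum>b\<in>Basis. K p (D X (curv Y Z (?E b)) p - curv Y Z (D X (?E b)) p) (coord c b))"
    define T where "T = (\<lambda>X Y q. \<Sum>b\<in>Basis. K q (curv X Y (?E b) q) (coord c b))"
    have T: "?\<rho> q (B q) (B' q) = - T B B' q / 2" if "B \<in> VF W" "B' \<in> VF W" "q \<in> W" for B B' q
      unfolding T_def by (rule ricci_form_fields[OF c(1) W(1,3) that(3,1,2)])
    have T_smooth: "smooth W (T B B')" if "B \<in> VF W" "B' \<in> VF W" for B B'
      unfolding T_def
      by (intro smooth_fun_sum W(1) VF_coeff_smooth[OF c(1) W(1,3) K_VF[OF W(1) curv_VF[OF W(1) that E]]])
    have tan: "B \<in> VF W \<Longrightarrow> B p \<in> tangent A p" for B by (rule VF_tangent[OF _ W(2)])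
    have deriv: "B p (\<lambda>q. ?\<rho> q (B' q) (B'' q)) = - S B B' B'' / 2"
      if B: "B \<in> VF W" "B' \<in> VF W" "B'' \<in> VF W" for B B' B''
    proof -
      have "B p (\<lambda>q. ?\<rho> q (B' q) (B'' q)) = B p (\<lambda>q. (- 1 / 2) * T B' B'' q)"
        by (rule tangent_germ[OF tan[OF B(1)] W(1,2)]) (simp add: T[OF B(2,3)])
      also have "\<dots> = (- 1 / 2) * B p (T B' B'')"
        by (rule tangent_cmult[OF tan[OF B(1)] smooth_nearI[OF W(1,2) T_smooth[OF B(2,3)]]])
      also have "B p (T B' B'') = (\<Sum>b\<in>Basis. (D B (\<lambda>q. K q (curv B' B'' (?E b) q)) p -
          K p (curv B' B'' (D B (?E b)) p)) (coord c b))"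
        unfolding T_def
      proof (rule trace_derivative[OF W(1,2) c(1) W(3) B(1), of "\<lambda>V q. K q (curv B' B'' V q)"])
        fix V V' f assume V: "V \<in> VF W"
        note cT = tan[OF curv_VF[OF W(1) B(2,3)]]
        show "(\<lambda>q. K q (curv B' B'' V q)) \<in> VF W" by (rule K_VF[OF W(1) curv_VF[OF W(1) B(2,3) V]])
        show "K p (curv B' B'' (\<lambda>q. V q + V' q) p) = K p (curv B' B'' V p) + K p (curv B' B'' V' p)"
          if "V' \<in> VF W"
          using curv_add_3[OF W(1,2) B(2,3) V that] K_add[OF cT[OF V] cT[OF that]] by simp
        show "K p (curv B' B'' (\<lambda>q. f q *\<^sub>R V q) p) = f p *\<^sub>R K p (curv B' B'' V p)" if "smooth W f"
          using curv_scale_3[OF W(1,2) B(2,3) V that] K_scale[OF cT[OF V]] by simp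
        show "K p (curv B' B'' V' p) = K p (curv B' B'' V p)" if "\<And>q. q \<in> W \<Longrightarrow> V' q = V q"
          using curv_cong[OF W(1,2) B(2,3) V refl refl that] by simp
      qed
      also have "\<dots> = S B B' B''"
        unfolding S_def
      proof (rule sum.cong[OF refl])
        fix b
        have t: "D B (curv B' B'' (?E b)) p \<in> tangent A p" "curv B' B'' (D B (?E b)) p \<in> tangent A p"
          using tan D_VF[OF W(1)] curv_VF[OF W(1)] B E by auto
        show "(D B (\<lambda>q. K q (curv B' B'' (?E b) q)) p - K p (curv B' B'' (D B (?E b)) p)) (coord c b) =
            K p (D B (curv B' B'' (?E b)) p - curv B' B'' (D B (?E b)) p) (coord c b)"
          by (simp only: K_parallel[OF W(1) B(1) curv_VF[OF W(1) B(2,3) E] W(2)] K_diff[OF t])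
      qed
      finally show ?thesis by simp
    qed
    have "S X Y Z + S Y Z X + S Z X Y - T (lie_bracket A X Y) Z p - T (lie_bracket A Y Z) X p -
        T (lie_bracket A Z X) Y p = (\<Sum>b\<in>Basis. K p 0 (coord c b))"
      unfolding S_def T_def sum.distrib[symmetric] sum_subtractf[symmetric]
    proof (rule sum.cong[OF refl])
      fix b
      let ?r = "\<lambda>B B' B''. D B (curv B' B'' (?E b)) p - curv B' B'' (D B (?E b)) p"
      have r: "?r B B' B'' \<in> tangent A p" if "B \<in> VF W" "B' \<in> VF W" "B'' \<in> VF W" for B B' B''
        using that E by (intro subspace_diff[OF tangent_subspace] tan D_VF curv_VF W(1))
      have l: "curv (lie_bracket A B B') B'' (?E b) p \<in> tangent A p"
        if "B \<in> VF W" "B' \<in> VF W" "B'' \<in> VF W" for B B' B''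
        using that E by (intro tan curv_VF lie_bracket_VF W(1))
      have "K p (?r X Y Z) + K p (?r Y Z X) + K p (?r Z X Y) - K p (curv (lie_bracket A X Y) Z (?E b) p) -
          K p (curv (lie_bracket A Y Z) X (?E b) p) - K p (curv (lie_bracket A Z X) Y (?E b) p) =
          K p (?r X Y Z + ?r Y Z X + ?r Z X Y - curv (lie_bracket A X Y) Z (?E b) p -
          curv (lie_bracket A Y Z) X (?E b) p - curv (lie_bracket A Z X) Y (?E b) p)"
        using r X Y Z l
        by (simp add: K_add K_diff subspace_diff[OF tangent_subspace] subspace_add[OF tangent_subspace]
            del: diff_conv_add_uminus)
      also have "\<dots> = K p 0" unfolding second_bianchi[OF W(1,2) X Y Z E] ..
      finally have "(K p (?r X Y Z) + K p (?r Y Z X) + K p (?r Z X Y) - K p (curv (lie_bracket A X Y) Z (?E b) p) -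
          K p (curv (lie_bracket A Y Z) X (?E b) p) - K p (curv (lie_bracket A Z X) Y (?E b) p)) (coord c b) =
          K p 0 (coord c b)" by (rule fun_cong)
      then show "K p (?r X Y Z) (coord c b) + K p (?r Y Z X) (coord c b) + K p (?r Z X Y) (coord c b) -
          K p (curv (lie_bracket A X Y) Z (?E b) p) (coord c b) -
          K p (curv (lie_bracket A Y Z) X (?E b) p) (coord c b) -
          K p (curv (lie_bracket A Z X) Y (?E b) p) (coord c b) = K p 0 (coord c b)"
        by simp
    qed
    also have "\<dots> = 0"
      using K_scale[OF subspace_0[OF tangent_subspace], of p 0] by simp
    finally show ?thesis
      using deriv[OF X Y Z] deriv[OF Y Z X] deriv[OF Z X Y]
        T[OF lie_bracket_VF[OF W(1) X Y] Z W(2)] T[OF lie_bracket_VF[OF W(1) Y Z] X W(2)]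
        T[OF lie_bracket_VF[OF W(1) Z X] Y W(2)]
      by simp
  qed
  then show ?thesis
    unfolding closed_two_form_def using ricci_form_two_form by blast
qed


section \<open>The Ricci form in para-holomorphic coordinates\<close>

lemma para_re_simps [simp]:
  "para_re 0 = 0" "para_re 1 = 1" "para_re (a + b) = para_re a + para_re b"
  "para_re (a - b) = para_re a - para_re b" "para_re (- a) = - para_re a"
  "para_re (a * b) = para_re a * para_re b + para_im a * para_im b"
  "para_re (r *\<^sub>R a) = r * para_re a" "para_re para_e = 0"
  by (simp_all add: zero_para_def one_para_def plus_para_def minus_para_def uminus_para_def
      times_para_def scaleR_para_def para_e_def)

lemma para_im_simps [simp]:
  "para_im 0 = 0" "para_im 1 = 0" "para_im (a + b) = para_im a + para_im b"
  "para_im (a - b) = para_im a - para_im b" "para_im (- a) = - para_im a"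
  "para_im (a * b) = para_re a * para_im b + para_im a * para_re b"
  "para_im (r *\<^sub>R a) = r * para_im a" "para_im para_e = 1"
  by (simp_all add: zero_para_def one_para_def plus_para_def minus_para_def uminus_para_def
      times_para_def scaleR_para_def para_e_def)

lemma para_of_real [simp]: "para_re (of_real r) = r" "para_im (of_real r) = 0"
  by (simp_all add: of_real_def)

lemma para_eq_iff: "a = b \<longleftrightarrow> para_re a = para_re b \<and> para_im a = para_im b"
  using para_eqI by auto

lemma Basis_real_vec: "(Basis :: (real^'n) set) = range (\<lambda>i. axis i 1)"
  by (auto simp: Basis_vec_def)

abbreviation ux :: "'n::finite \<Rightarrow> (real^'n) \<times> (real^'n)" where
  "ux i \<equiv> (axis i 1, 0)"

abbreviation uy :: "'n::finite \<Rightarrow> (real^'n) \<times> (real^'n)" where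
  "uy i \<equiv> (0, axis i 1)"

lemma sum_Basis_pair:
  fixes f :: "(real^'n) \<times> (real^'n) \<Rightarrow> 'v::comm_monoid_add"
  shows "(\<Sum>b\<in>Basis. f b) = (\<Sum>i\<in>UNIV. f (ux i)) + (\<Sum>i\<in>UNIV. f (uy i))"
proof -
  have B: "(Basis :: ((real^'n) \<times> (real^'n)) set) =
      range ux \<union> range uy"
    by (auto simp: Basis_prod_def Basis_real_vec)
  have inj: "inj (\<lambda>i::'n. (axis i (1::real), 0::real^'n))" "inj (\<lambda>i::'n. (0::real^'n, axis i (1::real)))"
    by (auto simp: inj_def axis_eq_axis)
  have "ux i \<noteq> (0::real^'n, axis j (1::real))" for i j :: 'n
    by (auto simp: axis_eq_0_iff)
  then have "range (\<lambda>i::'n. (axis i (1::real), 0::real^'n)) \<inter> range (\<lambda>i::'n. (0::real^'n, axis i (1::real))) = {}"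
    by blast
  then show ?thesis
    unfolding B by (subst sum.union_disjoint) (simp_all add: sum.reindex[OF inj(1)] sum.reindex[OF inj(2)] o_def)
qed

lemma Basis_pairE:
  fixes b :: "(real^'n) \<times> (real^'n)"
  assumes "b \<in> Basis"
  obtains i where "b = ux i" | i where "b = uy i"
  using assms by (auto simp: Basis_prod_def Basis_real_vec)

text \<open>Jacobi's formula for the derivative of a determinant, for a derivation that replaces the
  matrix \<open>M\<close> by \<open>\<Gamma> M\<close>.\<close>

lemma det_derivation:
  fixes M :: "real^'n^'n" and \<Gamma> :: "'n \<Rightarrow> 'n \<Rightarrow> real"
  shows "(\<Sum>\<sigma> | \<sigma> permutes UNIV. of_int (sign \<sigma>) *
      (\<Sum>i\<in>UNIV. (\<Sum>k\<in>UNIV. \<Gamma> i k * M $ k $ \<sigma> i) * (\<Prod>j\<in>UNIV - {i}. M $ j $ \<sigma> j))) =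
    (\<Sum>i\<in>UNIV. \<Gamma> i i) * det M"
proof -
  let ?P = "{\<sigma>. \<sigma> permutes (UNIV :: 'n set)}"
  have row: "(\<Sum>\<sigma>\<in>?P. of_int (sign \<sigma>) *
      ((\<Sum>k\<in>UNIV. \<Gamma> i k * M $ k $ \<sigma> i) * (\<Prod>j\<in>UNIV - {i}. M $ j $ \<sigma> j))) = \<Gamma> i i * det M" for i
  proof -
    have "(\<Sum>\<sigma>\<in>?P. of_int (sign \<sigma>) *
        ((\<Sum>k\<in>UNIV. \<Gamma> i k * M $ k $ \<sigma> i) * (\<Prod>j\<in>UNIV - {i}. M $ j $ \<sigma> j))) =
        det (\<chi> j. if j = i then \<Sum>k\<in>UNIV. \<Gamma> i k *s M $ k else M $ j)" (is "_ = det ?N")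
      unfolding det_def
    proof (rule sum.cong[OF refl])
      fix \<sigma> :: "'n \<Rightarrow> 'n"
      have "(\<Prod>j\<in>UNIV. ?N $ j $ \<sigma> j) = ?N $ i $ \<sigma> i * (\<Prod>j\<in>UNIV - {i}. ?N $ j $ \<sigma> j)"
        by (rule prod.remove) auto
      also have "(\<Prod>j\<in>UNIV - {i}. ?N $ j $ \<sigma> j) = (\<Prod>j\<in>UNIV - {i}. M $ j $ \<sigma> j)"
        by (rule prod.cong) auto
      finally show "of_int (sign \<sigma>) *
          ((\<Sum>k\<in>UNIV. \<Gamma> i k * M $ k $ \<sigma> i) * (\<Prod>j\<in>UNIV - {i}. M $ j $ \<sigma> j)) =
          of_int (sign \<sigma>) * (\<Prod>j\<in>UNIV. ?N $ j $ \<sigma> j)"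
        by simp
    qed
    also have "\<dots> = (\<Sum>k\<in>UNIV. \<Gamma> i k * det (\<chi> j. if j = i then M $ k else M $ j))"
      by (subst det_linear_row_sum) (simp_all add: det_row_mul)
    also have "\<dots> = (\<Sum>k\<in>UNIV. if k = i then \<Gamma> i i * det M else 0)"
    proof (rule sum.cong[OF refl])
      fix k
      show "\<Gamma> i k * det (\<chi> j. if j = i then M $ k else M $ j) = (if k = i then \<Gamma> i i * det M else 0)"
      proof (cases "k = i")
        case True
        then have "(\<chi> j. if j = i then M $ k else M $ j) = M" by (simp add: vec_eq_iff)
        then show ?thesis using True by simp
      next
        case False
        then have "det (\<chi> j. if j = i then M $ k else M $ j) = 0"
          by (intro det_identical_rows[of k i]) (auto simp: row_def vec_eq_iff)
        then show ?thesis using False by simp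
      qed
    qed
    finally show ?thesis by simp
  qed
  show ?thesis
    unfolding sum_distrib_left by (subst sum.swap, subst sum_distrib_right) (intro sum.cong refl row)
qed

locale para_hol_chart = para_kaehler_manifold A D K g
  for A :: "('m::topological_space, (real ^ 'n) \<times> (real ^ 'n)) chart set" and D K g +
  fixes U :: "'m set" and z :: "'m \<Rightarrow> para ^ 'n"
  assumes para_hol: "para_hol_coords A K U z"
begin

abbreviation zc :: "('m, (real ^ 'n) \<times> (real ^ 'n)) chart" where
  "zc \<equiv> real_chart U z"

lemma zc: "zc \<in> A" and fst_zc [simp]: "fst zc = U"
  using para_hol by (auto simp: para_hol_coords_def real_chart_def)

lemma U_open: "open U"
  using chart_open[OF zc] by simp

lemmas frame_VF = VF_coordinate[OF zc, unfolded fst_zc]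
  and frame_tangent = chart_vec_tangent[OF zc, unfolded fst_zc]
  and frame_linear = chart_vec_linear[OF zc, unfolded fst_zc]
  and frame_coord = chart_vec_coord[OF zc, unfolded fst_zc]
  and coord_near = coord_smooth_near[OF zc, unfolded fst_zc]

lemma coord_zc:
  "coord zc (ux \<alpha>) = (\<lambda>q. para_re (z q $ \<alpha>))"
  "coord zc (uy \<alpha>) = (\<lambda>q. para_im (z q $ \<alpha>))"
  by (auto simp: coord_def real_chart_def inner_axis)

text \<open>The real and para-complex parts of \<open>dz \<circ> K = e dz\<close>: \<open>K\<close> interchanges \<open>dx\<close> and \<open>dy\<close>.\<close>

lemma K_coord:
  assumes p: "p \<in> U" and u: "u \<in> tangent A p"
  shows "K p u (coord zc (ux \<alpha>)) = u (coord zc (uy \<alpha>))"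
    and "K p u (coord zc (uy \<alpha>)) = u (coord zc (ux \<alpha>))"
proof -
  let ?W = "\<lambda>f. of_real (u f) :: para"
  have 0: "0 \<in> tangent A p" by (rule subspace_0[OF tangent_subspace])
  have re: "para_re \<circ> ?W = u" and im: "para_im \<circ> ?W = 0"
    by (auto simp: fun_eq_iff)
  have "K p 0 = 0" using K_scale[OF 0, of 0] by simp
  then have K0: "K p (\<lambda>f. 0) = (\<lambda>f. 0)" by (simp only: zero_fun_def)
  have "?W \<in> ctangent A p" unfolding ctangent_def mem_Collect_eq re im using u 0 by simp
  then have "dz z \<alpha> (clinear_ext (K p) ?W) = para_e * dz z \<alpha> ?W"
    using para_hol p by (simp add: para_hol_coords_def)
  then show "K p u (coord zc (ux \<alpha>)) = u (coord zc (uy \<alpha>))"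
    "K p u (coord zc (uy \<alpha>)) = u (coord zc (ux \<alpha>))"
    by (simp_all add: dz_def capply_def clinear_ext_def re im K0 coord_zc para_eq_iff o_def)
qed

lemma K_frame:
  assumes p: "p \<in> U"
  shows "K p (chart_vec A zc (a, b) p) = chart_vec A zc (b, a) p"
proof (rule tangent_eqI[OF zc])
  fix d :: "(real^'n) \<times> (real^'n)" assume "d \<in> Basis"
  then show "K p (chart_vec A zc (a, b) p) (coord zc d) = chart_vec A zc (b, a) p (coord zc d)"
    by (cases rule: Basis_pairE) (simp_all add: K_coord[OF p frame_tangent[OF p]] frame_coord[OF p])
qed (use p frame_tangent K_tangent in auto)

text \<open>The real null frame \<open>\<partial>/\<partial>x + \<partial>/\<partial>y\<close>, \<open>\<partial>/\<partial>x - \<partial>/\<partial>y\<close>. These commuting eigenfields of \<open>K\<close> take over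
  the roles of \<open>\<partial>/\<partial>z\<close> and \<open>\<partial>/\<partial>zbar\<close>, so that the Kaehler computation can be done with real numbers.\<close>

definition \<xi> :: "'n \<Rightarrow> 'm \<Rightarrow> 'm tvec" where
  "\<xi> \<alpha> = chart_vec A zc (axis \<alpha> 1, axis \<alpha> 1)"

definition \<eta> :: "'n \<Rightarrow> 'm \<Rightarrow> 'm tvec" where
  "\<eta> \<alpha> = chart_vec A zc (axis \<alpha> 1, - axis \<alpha> 1)"

abbreviation Fx :: "'n \<Rightarrow> 'm \<Rightarrow> 'm tvec" where
  "Fx \<alpha> \<equiv> chart_vec A zc (ux \<alpha>)"

abbreviation Fy :: "'n \<Rightarrow> 'm \<Rightarrow> 'm tvec" where
  "Fy \<alpha> \<equiv> chart_vec A zc (uy \<alpha>)"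

lemma \<xi>_eq: "p \<in> U \<Longrightarrow> \<xi> \<alpha> p = Fx \<alpha> p + Fy \<alpha> p"
  using linear_add[OF frame_linear, of p "ux \<alpha>" "uy \<alpha>"] by (simp add: \<xi>_def)

lemma \<eta>_eq: "p \<in> U \<Longrightarrow> \<eta> \<alpha> p = Fx \<alpha> p - Fy \<alpha> p"
  using linear_diff[OF frame_linear, of p "ux \<alpha>" "uy \<alpha>"] by (simp add: \<eta>_def)

lemma \<xi>_VF: "\<xi> \<alpha> \<in> VF U" and \<eta>_VF: "\<eta> \<alpha> \<in> VF U"
  by (simp_all add: \<xi>_def \<eta>_def frame_VF)

lemma \<xi>_tangent: "p \<in> U \<Longrightarrow> \<xi> \<alpha> p \<in> tangent A p" and \<eta>_tangent: "p \<in> U \<Longrightarrow> \<eta> \<alpha> p \<in> tangent A p"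
  by (simp_all add: \<xi>_def \<eta>_def frame_tangent)

lemma K_\<xi>: "p \<in> U \<Longrightarrow> K p (\<xi> \<alpha> p) = \<xi> \<alpha> p"
  by (simp add: \<xi>_def K_frame)

lemma K_\<eta>:
  assumes p: "p \<in> U"
  shows "K p (\<eta> \<alpha> p) = - \<eta> \<alpha> p"
  using linear_neg[OF frame_linear[OF p], of "(axis \<alpha> 1, - axis \<alpha> 1)"] by (simp add: \<eta>_def K_frame[OF p])

lemma frame_expand:
  "p \<in> U \<Longrightarrow> v \<in> tangent A p \<Longrightarrow> v = (\<Sum>\<alpha>\<in>UNIV. v (coord zc (ux \<alpha>)) *\<^sub>R Fx \<alpha> p) +
    (\<Sum>\<alpha>\<in>UNIV. v (coord zc (uy \<alpha>)) *\<^sub>R Fy \<alpha> p)"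
  using tangent_expand[OF zc, of p v] unfolding sum_Basis_pair by simp

lemma plus_expand:
  assumes p: "p \<in> U" and v: "v \<in> tangent A p" and "K p v = v"
  shows "v = (\<Sum>\<alpha>\<in>UNIV. v (coord zc (ux \<alpha>)) *\<^sub>R \<xi> \<alpha> p)"
proof -
  have "v (coord zc (uy \<alpha>)) = v (coord zc (ux \<alpha>))" for \<alpha>
    using K_coord(1)[OF p v] assms(3) by simp
  then have "v = (\<Sum>\<alpha>\<in>UNIV. v (coord zc (ux \<alpha>)) *\<^sub>R Fx \<alpha> p) +
    (\<Sum>\<alpha>\<in>UNIV. v (coord zc (ux \<alpha>)) *\<^sub>R Fy \<alpha> p)"
    using frame_expand[OF p v] by simp
  then show ?thesis by (simp add: \<xi>_eq[OF p] scaleR_add_right sum.distrib)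
qed

text \<open>Both derivatives agree because the fields commute, and they lie in opposite eigenspaces of \<open>K\<close>
  because \<open>K\<close> is parallel.\<close>

lemma D_\<eta>_\<xi>:
  assumes p: "p \<in> U"
  shows "D (\<eta> \<beta>) (\<xi> \<alpha>) p = 0" and "D (\<xi> \<alpha>) (\<eta> \<beta>) p = 0"
proof -
  have sym: "D (\<eta> \<beta>) (\<xi> \<alpha>) p = D (\<xi> \<alpha>) (\<eta> \<beta>) p"
    unfolding \<xi>_def \<eta>_def by (rule coordinate_D_sym[OF zc]) (simp add: p)
  have "K p (D (\<eta> \<beta>) (\<xi> \<alpha>) p) = D (\<eta> \<beta>) (\<lambda>q. K q (\<xi> \<alpha> q)) p"
    by (rule K_parallel[OF U_open \<eta>_VF \<xi>_VF p, symmetric])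
  also have "\<dots> = D (\<eta> \<beta>) (\<xi> \<alpha>) p"
    by (rule D_cong[OF U_open p \<eta>_VF \<xi>_VF refl K_\<xi>])
  finally have 1: "K p (D (\<eta> \<beta>) (\<xi> \<alpha>) p) = D (\<eta> \<beta>) (\<xi> \<alpha>) p" .
  have "K p (D (\<xi> \<alpha>) (\<eta> \<beta>) p) = D (\<xi> \<alpha>) (\<lambda>q. K q (\<eta> \<beta> q)) p"
    by (rule K_parallel[OF U_open \<xi>_VF \<eta>_VF p, symmetric])
  also have "\<dots> = D (\<xi> \<alpha>) (\<lambda>q. - \<eta> \<beta> q) p"
    by (rule D_cong[OF U_open p \<xi>_VF VF_uminus[OF \<eta>_VF] refl K_\<eta>])
  also have "\<dots> = - D (\<xi> \<alpha>) (\<eta> \<beta>) p"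
    by (rule D_uminus_right[OF U_open p \<xi>_VF \<eta>_VF])
  finally have "D (\<eta> \<beta>) (\<xi> \<alpha>) p = - D (\<eta> \<beta>) (\<xi> \<alpha>) p" using 1 sym by simp
  then have "D (\<eta> \<beta>) (\<xi> \<alpha>) p f = - D (\<eta> \<beta>) (\<xi> \<alpha>) p f" for f by (metis uminus_apply)
  then show "D (\<eta> \<beta>) (\<xi> \<alpha>) p = 0" by (auto simp: fun_eq_iff)
  then show "D (\<xi> \<alpha>) (\<eta> \<beta>) p = 0" using sym by simp
qed

text \<open>The Christoffel symbols of the connection on the eigenbundle of \<open>K\<close> spanned by the fields \<open>\<xi>\<close>.\<close>

definition \<Gamma> :: "'n \<Rightarrow> 'n \<Rightarrow> 'n \<Rightarrow> 'm \<Rightarrow> real" where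
  "\<Gamma> \<gamma> \<alpha> \<delta> q = D (\<xi> \<gamma>) (\<xi> \<alpha>) q (coord zc (ux \<delta>))"

lemma D_\<xi>_\<xi>_tangent: "p \<in> U \<Longrightarrow> D (\<xi> \<gamma>) (\<xi> \<alpha>) p \<in> tangent A p"
  by (rule VF_tangent[OF D_VF[OF U_open \<xi>_VF \<xi>_VF]])

lemma K_D_\<xi>_\<xi>:
  assumes p: "p \<in> U"
  shows "K p (D (\<xi> \<gamma>) (\<xi> \<alpha>) p) = D (\<xi> \<gamma>) (\<xi> \<alpha>) p"
proof -
  have "K p (D (\<xi> \<gamma>) (\<xi> \<alpha>) p) = D (\<xi> \<gamma>) (\<lambda>q. K q (\<xi> \<alpha> q)) p"
    by (rule K_parallel[OF U_open \<xi>_VF \<xi>_VF p, symmetric])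
  also have "\<dots> = D (\<xi> \<gamma>) (\<xi> \<alpha>) p"
    by (rule D_cong[OF U_open p \<xi>_VF \<xi>_VF refl K_\<xi>])
  finally show ?thesis .
qed

lemma D_\<xi>_\<xi>: "p \<in> U \<Longrightarrow> D (\<xi> \<gamma>) (\<xi> \<alpha>) p = (\<Sum>\<delta>\<in>UNIV. \<Gamma> \<gamma> \<alpha> \<delta> p *\<^sub>R \<xi> \<delta> p)"
  unfolding \<Gamma>_def by (rule plus_expand[OF _ D_\<xi>_\<xi>_tangent K_D_\<xi>_\<xi>])

lemma \<Gamma>_smooth: "smooth U (\<Gamma> \<gamma> \<alpha> \<delta>)"
  unfolding \<Gamma>_def using VF_coeff_smooth[OF zc U_open _ D_VF[OF U_open \<xi>_VF \<xi>_VF]] by simp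

text \<open>The factor 1/4 makes this the image of the matrix of the \<open>g(\<partial>/\<partial>z, \<partial>/\<partial>zbar)\<close> under the ring homomorphism
  \<open>a + e b \<mapsto> a + b\<close>.\<close>

definition h :: "'m \<Rightarrow> real^'n^'n" where
  "h q = (\<chi> \<alpha> \<beta>. g q (\<xi> \<alpha> q) (\<eta> \<beta> q) / 4)"

lemma h_smooth: "smooth U (\<lambda>q. h q $ \<alpha> $ \<beta>)"
  using smooth_fun_mult[OF U_open smooth_fun_const g_smooth[OF U_open \<xi>_VF \<eta>_VF], of "1/4"]
  by (simp add: h_def)

lemma g_sum_left:
  assumes "v \<in> tangent A p" "\<And>i. i \<in> I \<Longrightarrow> u i \<in> tangent A p" "finite I"
  shows "g p (\<Sum>i\<in>I. a i *\<^sub>R u i) v = (\<Sum>i\<in>I. a i * g p (u i) v)"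
  using assms(3,2)
proof (induction I rule: finite_induct)
  case empty
  have "g p 0 v = 0"
    using linear_withinD[OF g_linear_left[OF assms(1)] assms(1) assms(1), of 0 0] by simp
  then show ?case by (simp only: sum.empty)
next
  case (insert i I)
  have S: "(\<Sum>i\<in>I. a i *\<^sub>R u i) \<in> tangent A p"
    using insert by (intro subspace_sum subspace_scale tangent_subspace) auto
  have ui: "u i \<in> tangent A p" using insert.prems by simp
  have IH: "g p (\<Sum>i\<in>I. a i *\<^sub>R u i) v = (\<Sum>i\<in>I. a i * g p (u i) v)"
    by (rule insert.IH) (use insert.prems in auto)
  show ?case
    using linear_withinD[OF g_linear_left[OF assms(1)] ui S, of "a i" 1]
    by (simp only: sum.insert[OF insert.hyps] scaleR_one real_scaleR_def IH)
qed

text \<open>Since \<open>D\<^sub>\<xi> \<eta> = 0\<close>, the metric determines the connection as in the Kaehler case: \<open>\<Gamma> = (\<xi> h) h\<^sup>-\<^sup>1\<close>.\<close>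

lemma \<xi>_h:
  assumes p: "p \<in> U"
  shows "\<xi> \<gamma> p (\<lambda>q. h q $ \<alpha> $ \<beta>) = (\<Sum>\<delta>\<in>UNIV. \<Gamma> \<gamma> \<alpha> \<delta> p * h p $ \<delta> $ \<beta>)"
proof -
  have "\<xi> \<gamma> p (\<lambda>q. h q $ \<alpha> $ \<beta>) = (1/4) * \<xi> \<gamma> p (\<lambda>q. g q (\<xi> \<alpha> q) (\<eta> \<beta> q))"
    using tangent_cmult[OF \<xi>_tangent[OF p] smooth_nearI[OF U_open p g_smooth[OF U_open \<xi>_VF \<eta>_VF]], of \<gamma> "1/4"]
    by (simp add: h_def)
  also have "\<xi> \<gamma> p (\<lambda>q. g q (\<xi> \<alpha> q) (\<eta> \<beta> q)) = g p (D (\<xi> \<gamma>) (\<xi> \<alpha>) p) (\<eta> \<beta> p) + g p (\<xi> \<alpha> p) 0"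
    using metric_compatible[OF U_open p \<xi>_VF \<xi>_VF \<eta>_VF] by (simp add: D_\<eta>_\<xi>(2)[OF p])
  also have "g p (\<xi> \<alpha> p) 0 = 0"
    using linear_withinD[OF g_linear_right[OF \<xi>_tangent[OF p, of \<alpha>]] \<xi>_tangent[OF p, of \<alpha>] \<xi>_tangent[OF p, of \<alpha>], of 0 0]
    by simp
  also have "g p (D (\<xi> \<gamma>) (\<xi> \<alpha>) p) (\<eta> \<beta> p) = (\<Sum>\<delta>\<in>UNIV. \<Gamma> \<gamma> \<alpha> \<delta> p * g p (\<xi> \<delta> p) (\<eta> \<beta> p))"
    unfolding D_\<xi>_\<xi>[OF p] by (rule g_sum_left) (auto intro: \<xi>_tangent \<eta>_tangent p)
  finally show ?thesis by (simp add: h_def sum_distrib_left sum_divide_distrib)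
qed

lemma det_h_smooth: "smooth U (\<lambda>q. det (h q))"
  unfolding det_def
  by (intro smooth_fun_sum smooth_fun_mult smooth_fun_const smooth_fun_prod h_smooth U_open)

lemma \<xi>_det_h:
  assumes p: "p \<in> U"
  shows "\<xi> \<gamma> p (\<lambda>q. det (h q)) = (\<Sum>\<alpha>\<in>UNIV. \<Gamma> \<gamma> \<alpha> \<alpha> p) * det (h p)"
proof -
  note T = \<xi>_tangent[OF p, of \<gamma>]
  have sn: "smooth_near A p (\<lambda>q. h q $ \<alpha> $ \<beta>)" for \<alpha> \<beta>
    by (rule smooth_nearI[OF U_open p h_smooth])
  have "\<xi> \<gamma> p (\<lambda>q. det (h q)) = (\<Sum>\<sigma> | \<sigma> permutes UNIV. of_int (sign \<sigma>) *
      \<xi> \<gamma> p (\<lambda>q. \<Prod>i\<in>UNIV. h q $ i $ \<sigma> i))"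
    unfolding det_def
    by (subst tangent_sum[OF T]) (simp_all add: tangent_cmult[OF T] smooth_near_mult smooth_near_const smooth_near_prod sn)
  also have "\<dots> = (\<Sum>\<sigma> | \<sigma> permutes UNIV. of_int (sign \<sigma>) *
      (\<Sum>i\<in>UNIV. (\<Sum>k\<in>UNIV. \<Gamma> \<gamma> i k p * h p $ k $ \<sigma> i) * (\<Prod>j\<in>UNIV - {i}. h p $ j $ \<sigma> j)))"
    by (subst tangent_prod[OF T]) (simp_all add: sn \<xi>_h[OF p])
  also have "\<dots> = (\<Sum>\<alpha>\<in>UNIV. \<Gamma> \<gamma> \<alpha> \<alpha> p) * det (h p)"
    by (rule det_derivation)
  finally show ?thesis .
qed

text \<open>A vector \<open>x\<close> with \<open>x\<^sup>T h = 0\<close> yields the tangent vector \<open>\<Sum> x\<^sub>i \<xi>\<^sub>i\<close>, which is orthogonal to all \<open>\<eta>\<close>. It is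
  also orthogonal to all \<open>\<xi>\<close>, because the eigenspaces of the skew map \<open>K\<close> are isotropic. So it is 0.\<close>

lemma det_h_nonzero:
  assumes p: "p \<in> U"
  shows "det (h p) \<noteq> 0"
proof
  assume "det (h p) = 0"
  then have "\<not> inj ((*v) (transpose (h p)))"
    using det_nz_iff_inj[OF matrix_vector_mul_linear, of "transpose (h p)"]
    unfolding matrix_of_matrix_vector_mul det_transpose by blast
  then obtain x where x: "x \<noteq> 0" "transpose (h p) *v x = 0"
    using linear_injective_0[OF matrix_vector_mul_linear, of "transpose (h p)"] by blast
  let ?E = "\<lambda>w. chart_vec A zc w p"
  note T = frame_tangent[OF p]
  have pair_sum: "(a, b) = (\<Sum>i\<in>UNIV. a $ i *\<^sub>R ux i) + (\<Sum>i\<in>UNIV. b $ i *\<^sub>R uy i)"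
    for a b :: "real^'n"
    using euclidean_representation[of "(a, b)"] unfolding sum_Basis_pair by (simp add: inner_axis)
  have u: "?E (x, x) = (\<Sum>i\<in>UNIV. x $ i *\<^sub>R \<xi> i p)"
  proof -
    have "?E (x, x) (coord zc (ux i)) = x $ i" for i
      by (simp add: frame_coord[OF p] inner_axis)
    then show ?thesis
      using plus_expand[OF p T K_frame[OF p], of x] by (simp only:)
  qed
  have "g p (?E (x, x)) (\<eta> \<beta> p) = 0" for \<beta>
  proof -
    have "g p (?E (x, x)) (\<eta> \<beta> p) = (\<Sum>i\<in>UNIV. x $ i * g p (\<xi> i p) (\<eta> \<beta> p))"
      unfolding u by (rule g_sum_left) (auto intro: \<xi>_tangent \<eta>_tangent p)
    also have "\<dots> = 4 * (transpose (h p) *v x) $ \<beta>"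
      by (simp add: matrix_vector_mult_def transpose_def h_def sum_distrib_left mult.commute)
    finally show ?thesis unfolding x(2) by simp
  qed
  note \<eta>0 = this
  have gl: "linear (\<lambda>w. g p (?E (x, x)) (?E w))"
    using para_kaehler_curvature.G_linear(2)[OF curvature_tensor[OF zc], of p "(x, x)"] p by simp
  have "g p (?E (x, x)) (?E (s, s)) = 0" for s
    using K_skew[OF T T, of "(x, x)" "(s, s)"] by (simp add: K_frame[OF p])
  moreover have "g p (?E (x, x)) (?E (t, - t)) = 0" for t
  proof -
    have "(t, - t) = (\<Sum>i\<in>UNIV. t $ i *\<^sub>R (axis i 1, - axis i 1))"
      by (subst pair_sum) (simp add: sum.distrib[symmetric] scaleR_add_right[symmetric]
          scaleR_minus_right[symmetric] del: scaleR_minus_right)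
    then have "g p (?E (x, x)) (?E (t, - t)) = (\<Sum>i\<in>UNIV. t $ i * g p (?E (x, x)) (\<eta> i p))"
      by (simp only: linear_sum[OF gl] linear_cmul[OF gl] \<eta>_def real_scaleR_def)
    then show ?thesis by (simp add: \<eta>0)
  qed
  \<comment> \<open>decomposition of \<open>w\<close> into the eigenspaces of \<open>K\<close>\<close>
  moreover have "w = ((1/2) *\<^sub>R (fst w + snd w), (1/2) *\<^sub>R (fst w + snd w)) +
      ((1/2) *\<^sub>R (fst w - snd w), - ((1/2) *\<^sub>R (fst w - snd w)))" for w :: "(real^'n) \<times> (real^'n)"
    by (simp add: prod_eq_iff algebra_simps scaleR_half_double flip: scaleR_add_left)
  ultimately have "g p (?E (x, x)) (?E w) = 0" for w
    by (metis add.right_neutral linear_add[OF gl])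
  then have "?E (x, x) = 0"
    by (intro g_nondegenerate[OF T]) (metis chart_vec_components[OF zc] fst_zc p)
  then have "components zc (?E (x, x)) = 0" using linear_0[OF components_linear] by simp
  then show False using x(1) components_chart_vec[OF zc] p by (simp add: prod_eq_iff)
qed

definition L :: "'m \<Rightarrow> real" where
  "L q = ln \<bar>det (h q)\<bar>"

lemma L_smooth: "smooth U L"
  unfolding L_def[abs_def] by (rule smooth_fun_ln_abs[OF U_open det_h_smooth det_h_nonzero])

lemma \<xi>_L:
  assumes p: "p \<in> U"
  shows "\<xi> \<gamma> p L = (\<Sum>\<alpha>\<in>UNIV. \<Gamma> \<gamma> \<alpha> \<alpha> p)"
  using tangent_ln_abs[OF \<xi>_tangent[OF p] U_open p det_h_smooth det_h_nonzero] det_h_nonzero[OF p]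
  by (simp add: L_def[abs_def] \<xi>_det_h[OF p])

text \<open>As \<open>D\<^sub>\<eta> \<xi> = 0\<close>, only the derivative of the Christoffel symbols along \<open>\<eta>\<close> survives.\<close>

lemma curv_\<xi>_\<eta>_\<xi>:
  assumes p: "p \<in> U"
  shows "curv (\<xi> \<gamma>) (\<eta> \<beta>) (\<xi> \<alpha>) p (coord zc (ux \<alpha>)) = - \<eta> \<beta> p (\<Gamma> \<gamma> \<alpha> \<alpha>)"
proof -
  let ?Y = "D (\<xi> \<gamma>) (\<xi> \<alpha>)"
  have co: "\<xi> \<delta> p (coord zc (ux \<alpha>)) = (if \<delta> = \<alpha> then 1 else 0)" for \<delta>
    by (simp add: \<xi>_def frame_coord[OF p] inner_axis_axis)
  have "D (\<xi> \<gamma>) (D (\<eta> \<beta>) (\<xi> \<alpha>)) p = D (\<xi> \<gamma>) (\<lambda>q. 0) p"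
    by (rule D_cong[OF U_open p \<xi>_VF VF_zero]) (simp_all add: D_\<eta>_\<xi>)
  also have "\<dots> = 0" by (rule D_zero_right[OF U_open p \<xi>_VF])
  finally have 0: "D (\<xi> \<gamma>) (D (\<eta> \<beta>) (\<xi> \<alpha>)) p = 0" .
  have "curv (\<xi> \<gamma>) (\<eta> \<beta>) (\<xi> \<alpha>) p = - D (\<eta> \<beta>) ?Y p"
    using curv_coordinate[OF zc, of p "\<xi> \<alpha>" "(axis \<gamma> 1, axis \<gamma> 1)" "(axis \<beta> 1, - axis \<beta> 1)"] p \<xi>_VF 0
    by (simp add: \<xi>_def[symmetric] \<eta>_def[symmetric])
  also have "D (\<eta> \<beta>) ?Y p = D (\<eta> \<beta>) (\<lambda>q. \<Sum>\<delta>\<in>UNIV. \<Gamma> \<gamma> \<alpha> \<delta> q *\<^sub>R \<xi> \<delta> q) p"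
    by (rule D_cong[OF U_open p \<eta>_VF VF_sum[OF VF_scale[OF \<xi>_VF \<Gamma>_smooth]] refl]) (rule D_\<xi>_\<xi>)
  also have "\<dots> = (\<Sum>\<delta>\<in>UNIV. \<eta> \<beta> p (\<Gamma> \<gamma> \<alpha> \<delta>) *\<^sub>R \<xi> \<delta> p)"
    by (simp only: D_sum_right[OF U_open p \<eta>_VF \<xi>_VF \<Gamma>_smooth finite] D_\<eta>_\<xi>(1)[OF p]
        scaleR_zero_right add_0_right)
  finally show ?thesis
    by (simp add: sum_fun_apply co if_distrib cong: if_cong)
qed

text \<open>The curvature commutes with \<open>K\<close> and has trace 0, so its traces on the two eigenspaces of \<open>K\<close> are
  opposite and \<open>tr (K R) / 2\<close> is the trace on the span of the \<open>\<xi>\<close>. That trace is a derivative along \<open>\<eta>\<close> of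
  the trace of \<open>\<Gamma>\<close>, which is the logarithmic derivative of \<open>det h\<close>.\<close>

lemma ricci_form_\<xi>_\<eta>:
  assumes p: "p \<in> U"
  shows "ricci_form A K D p (\<xi> \<gamma> p) (\<eta> \<beta> p) = \<eta> \<beta> p (\<lambda>q. \<xi> \<gamma> q L)"
proof -
  note T = frame_tangent[OF p]
  define R where "R = (\<lambda>w. curv_at p (\<xi> \<gamma> p) (\<eta> \<beta> p) w)"
  let ?x = "\<lambda>\<alpha>. coord zc (ux \<alpha>)" and ?y = "\<lambda>\<alpha>. coord zc (uy \<alpha>)"
  have RT: "R w \<in> tangent A p" if "w \<in> tangent A p" for w
    unfolding R_def by (rule curvature_at_tangent[OF \<xi>_tangent[OF p] \<eta>_tangent[OF p] that])
  have R_curv: "R (X p) = curv (\<xi> \<gamma>) (\<eta> \<beta>) X p" if "X \<in> VF U" for X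
    unfolding R_def by (rule curvature_at_eq[OF U_open p \<xi>_VF \<eta>_VF that])
  have RK: "R (Fy \<alpha> p) = K p (R (Fx \<alpha> p))" for \<alpha>
    using curv_K[OF U_open p \<xi>_VF \<eta>_VF frame_VF, of \<gamma> \<beta> "ux \<alpha>"]
      R_curv[OF frame_VF, of "ux \<alpha>"] R_curv[OF K_VF[OF U_open frame_VF], of "ux \<alpha>"]
    by (simp add: K_frame[OF p])
  have Ry: "R (Fy \<alpha> p) (?x \<alpha>) = R (Fx \<alpha> p) (?y \<alpha>)" "R (Fy \<alpha> p) (?y \<alpha>) = R (Fx \<alpha> p) (?x \<alpha>)" for \<alpha>
    unfolding RK by (simp_all add: K_coord[OF p RT[OF T]])
  have tr0: "(\<Sum>\<alpha>\<in>UNIV. R (Fx \<alpha> p) (?x \<alpha>)) = 0"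
    using curvature_trace_zero[OF zc _ \<xi>_tangent[OF p] \<eta>_tangent[OF p], of \<gamma> \<beta>] p
    by (simp add: sum_Basis_pair R_def[symmetric] Ry)
  have R\<xi>: "R (\<xi> \<alpha> p) = R (Fx \<alpha> p) + R (Fy \<alpha> p)" for \<alpha>
    using linear_withinD[OF curvature_at_linear_3[OF \<xi>_tangent[OF p] \<eta>_tangent[OF p]] T T, of \<gamma> \<beta> 1 "ux \<alpha>" 1 "uy \<alpha>", simplified]
    by (simp add: R_def \<xi>_eq[OF p])
  have "ricci_form A K D p (\<xi> \<gamma> p) (\<eta> \<beta> p) = - (\<Sum>\<alpha>\<in>UNIV. R (Fx \<alpha> p) (?y \<alpha>))"
    using ricci_form_trace[OF zc _ \<xi>_tangent[OF p] \<eta>_tangent[OF p], of \<gamma> \<beta>] p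
    by (simp add: sum_Basis_pair R_def[symmetric] K_coord[OF p RT[OF T]] Ry)
  also have "(\<Sum>\<alpha>\<in>UNIV. R (Fx \<alpha> p) (?y \<alpha>)) = (\<Sum>\<alpha>\<in>UNIV. R (\<xi> \<alpha> p) (?x \<alpha>))"
    by (simp add: R\<xi> Ry sum.distrib tr0)
  also have "\<dots> = - (\<Sum>\<alpha>\<in>UNIV. \<eta> \<beta> p (\<Gamma> \<gamma> \<alpha> \<alpha>))"
    by (simp add: R_curv[OF \<xi>_VF] curv_\<xi>_\<eta>_\<xi>[OF p] sum_negf)
  also have "(\<Sum>\<alpha>\<in>UNIV. \<eta> \<beta> p (\<Gamma> \<gamma> \<alpha> \<alpha>)) = \<eta> \<beta> p (\<lambda>q. \<Sum>\<alpha>\<in>UNIV. \<Gamma> \<gamma> \<alpha> \<alpha> q)"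
    by (rule tangent_sum[OF \<eta>_tangent[OF p], symmetric]) (rule smooth_nearI[OF U_open p \<Gamma>_smooth])
  also have "\<dots> = \<eta> \<beta> p (\<lambda>q. \<xi> \<gamma> q L)"
    by (rule tangent_germ[OF \<eta>_tangent[OF p] U_open p]) (simp add: \<xi>_L)
  finally show ?thesis by simp
qed

end


section \<open>Para-complexified tangent vectors and forms of type (1,1)\<close>

lemma para_e_e [simp]: "para_e * para_e = 1"
  by (simp add: para_eq_iff)

lemma para_numeral [simp]: "para_re (numeral n) = numeral n" "para_im (numeral n) = 0"
  using para_of_real[of "numeral n"] by simp_all

lemma para_re_comb:
  "para_re \<circ> (\<lambda>f. a * W f + b * W' f) = (para_re a *\<^sub>R (para_re \<circ> W) + para_im a *\<^sub>R (para_im \<circ> W)) +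
    (para_re b *\<^sub>R (para_re \<circ> W') + para_im b *\<^sub>R (para_im \<circ> W'))"
  by (auto simp: fun_eq_iff)

lemma para_im_comb:
  "para_im \<circ> (\<lambda>f. a * W f + b * W' f) = (para_re a *\<^sub>R (para_im \<circ> W) + para_im a *\<^sub>R (para_re \<circ> W)) +
    (para_re b *\<^sub>R (para_im \<circ> W') + para_im b *\<^sub>R (para_re \<circ> W'))"
  by (auto simp: fun_eq_iff)

lemma ctvec_eqI: "para_re \<circ> W = para_re \<circ> W' \<Longrightarrow> para_im \<circ> W = para_im \<circ> W' \<Longrightarrow> W = W'"
  by (auto simp: fun_eq_iff para_eq_iff)

lemma clinear_ext_parts:
  "para_re \<circ> clinear_ext F W = F (para_re \<circ> W)" "para_im \<circ> clinear_ext F W = F (para_im \<circ> W)"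
  by (auto simp: fun_eq_iff clinear_ext_def)

context smooth_atlas
begin

lemma ctangentI: "para_re \<circ> W \<in> tangent A p \<Longrightarrow> para_im \<circ> W \<in> tangent A p \<Longrightarrow> W \<in> ctangent A p"
  by (simp add: ctangent_def)

lemma ctangentD: "W \<in> ctangent A p \<Longrightarrow> para_re \<circ> W \<in> tangent A p" "W \<in> ctangent A p \<Longrightarrow> para_im \<circ> W \<in> tangent A p"
  by (simp_all add: ctangent_def)

lemma ctangent_comb:
  assumes "W \<in> ctangent A p" "W' \<in> ctangent A p"
  shows "(\<lambda>f. a * W f + b * W' f) \<in> ctangent A p"
  by (rule ctangentI)
    (unfold para_re_comb para_im_comb, (intro subspace_add subspace_scale tangent_subspace ctangentD assms)+)

lemma ctangent_zero: "(\<lambda>f. 0) \<in> ctangent A p"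
  by (rule ctangentI) (use subspace_0[OF tangent_subspace] in \<open>simp_all add: o_def zero_fun_def\<close>)

lemma ctangent_sum:
  assumes "\<And>i. i \<in> I \<Longrightarrow> V i \<in> ctangent A p"
  shows "(\<lambda>f. \<Sum>i\<in>I. a i * V i f) \<in> ctangent A p"
  using assms
proof (induction I rule: infinite_finite_induct)
  case (insert i I)
  have "(\<lambda>f. a i * V i f + 1 * (\<Sum>i\<in>I. a i * V i f)) \<in> ctangent A p"
    by (rule ctangent_comb) (use insert in auto)
  then show ?case using insert by simp
qed (simp_all add: ctangent_zero)

lemma ctangent_real: "u \<in> tangent A p \<Longrightarrow> (\<lambda>f. of_real (u f)) \<in> ctangent A p"
  by (rule ctangentI) (use subspace_0[OF tangent_subspace] in \<open>simp_all add: o_def zero_fun_def\<close>)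

lemma ctangent_expand:
  assumes c: "c \<in> A" "p \<in> fst c" and W: "W \<in> ctangent A p"
  shows "W = (\<lambda>f. \<Sum>b\<in>Basis. W (coord c b) * of_real (chart_vec A c b p f))"
proof
  fix f
  have sums: "para_re (\<Sum>b\<in>I. F b) = (\<Sum>b\<in>I. para_re (F b))" "para_im (\<Sum>b\<in>I. F b) = (\<Sum>b\<in>I. para_im (F b))"
    for F :: "'e \<Rightarrow> para" and I
    by (induction I rule: infinite_finite_induct) simp_all
  have "para_re (W f) = (\<Sum>b\<in>Basis. para_re (W (coord c b)) * chart_vec A c b p f)"
    using fun_cong[OF tangent_expand[OF c ctangentD(1)[OF W]], of f] by (simp add: sum_fun_apply)
  moreover have "para_im (W f) = (\<Sum>b\<in>Basis. para_im (W (coord c b)) * chart_vec A c b p f)"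
    using fun_cong[OF tangent_expand[OF c ctangentD(2)[OF W]], of f] by (simp add: sum_fun_apply)
  ultimately show "W f = (\<Sum>b\<in>Basis. W (coord c b) * of_real (chart_vec A c b p f))"
    by (simp add: para_eq_iff sums)
qed

lemma cbilinear_ext_left:
  assumes t: "bilinear_within (tangent A p) t"
    and W: "W \<in> ctangent A p" and W': "W' \<in> ctangent A p" and V: "V \<in> ctangent A p"
  shows "cbilinear_ext t (\<lambda>f. a * W f + b * W' f) V = a * cbilinear_ext t W V + b * cbilinear_ext t W' V"
proof -
  let ?T = "tangent A p"
  have lin: "t (r *\<^sub>R u + s *\<^sub>R u') v = r * t u v + s * t u' v" if "u \<in> ?T" "u' \<in> ?T" "v \<in> ?T" for r s u u' v
    using t that by (simp add: bilinear_within_def linear_within_def)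
  have add: "t (u + u') v = t u v + t u' v" if "u \<in> ?T" "u' \<in> ?T" "v \<in> ?T" for u u' v
    using lin[OF that, of 1 1] by simp
  have comb: "r *\<^sub>R u + s *\<^sub>R u' \<in> ?T" if "u \<in> ?T" "u' \<in> ?T" for r s u u'
    using that by (intro subspace_add subspace_scale tangent_subspace)
  note T = ctangentD[OF W] ctangentD[OF W'] ctangentD[OF V]
  show ?thesis
    unfolding cbilinear_ext_def para_re_comb para_im_comb
    by (simp add: para_eq_iff add lin comb T) (simp add: algebra_simps)
qed

end

context para_kaehler_manifold
begin

abbreviation \<rho>C :: "'m \<Rightarrow> 'm ctvec \<Rightarrow> 'm ctvec \<Rightarrow> para" where
  "\<rho>C p \<equiv> cbilinear_ext (ricci_form A K D p)"

lemmas \<rho>C_left = cbilinear_ext_left[OF ricci_form_bilinear]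

lemma \<rho>C_skew:
  assumes W: "W \<in> ctangent A p" and V: "V \<in> ctangent A p"
  shows "\<rho>C p V W = - \<rho>C p W V"
proof -
  note s = ricci_form_skew[OF ctangentD(1)[OF V] ctangentD(1)[OF W]]
    ricci_form_skew[OF ctangentD(2)[OF V] ctangentD(2)[OF W]]
    ricci_form_skew[OF ctangentD(1)[OF V] ctangentD(2)[OF W]]
    ricci_form_skew[OF ctangentD(2)[OF V] ctangentD(1)[OF W]]
  show ?thesis unfolding cbilinear_ext_def s by (simp add: para_eq_iff)
qed

lemma \<rho>C_right:
  assumes W: "W \<in> ctangent A p" and W': "W' \<in> ctangent A p" and V: "V \<in> ctangent A p"
  shows "\<rho>C p V (\<lambda>f. a * W f + b * W' f) = a * \<rho>C p V W + b * \<rho>C p V W'"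
  using \<rho>C_left[OF W W' V, of a b] \<rho>C_skew[OF V W] \<rho>C_skew[OF V W']
    \<rho>C_skew[OF V ctangent_comb[OF W W'], of a b]
  by (simp add: algebra_simps)

lemma \<rho>C_sum_right:
  assumes "\<And>i. i \<in> I \<Longrightarrow> V i \<in> ctangent A p" and W: "W \<in> ctangent A p"
  shows "\<rho>C p W (\<lambda>f. \<Sum>i\<in>I. a i * V i f) = (\<Sum>i\<in>I. a i * \<rho>C p W (V i))"
  using assms(1)
proof (induction I rule: infinite_finite_induct)
  case (insert i I)
  have "\<rho>C p W (\<lambda>f. a i * V i f + 1 * (\<Sum>i\<in>I. a i * V i f)) =
      a i * \<rho>C p W (V i) + 1 * \<rho>C p W (\<lambda>f. \<Sum>i\<in>I. a i * V i f)"
    by (rule \<rho>C_right[OF _ ctangent_sum W]) (use insert in auto)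
  then show ?case using insert by simp
qed (use \<rho>C_right[OF ctangent_zero ctangent_zero W, of 0 0] in simp_all)

lemma \<rho>C_sum_left:
  assumes "\<And>i. i \<in> I \<Longrightarrow> V i \<in> ctangent A p" and W: "W \<in> ctangent A p"
  shows "\<rho>C p (\<lambda>f. \<Sum>i\<in>I. a i * V i f) W = (\<Sum>i\<in>I. a i * \<rho>C p (V i) W)"
  using \<rho>C_sum_right[of I V p W a] \<rho>C_skew[OF W ctangent_sum[of I V p a]] \<rho>C_skew[OF W, of "V _"] assms
  by (simp add: sum_negf)

abbreviation KC :: "'m \<Rightarrow> 'm ctvec \<Rightarrow> 'm ctvec" where
  "KC p \<equiv> clinear_ext (K p)"

lemma KC_ctangent: "W \<in> ctangent A p \<Longrightarrow> KC p W \<in> ctangent A p"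
  by (simp add: ctangent_def clinear_ext_parts K_tangent)

lemma KC_KC:
  assumes "W \<in> ctangent A p"
  shows "KC p (KC p W) = W"
  by (rule ctvec_eqI) (simp_all only: clinear_ext_parts K_K ctangentD[OF assms])

lemma KC_comb:
  assumes W: "W \<in> ctangent A p" and W': "W' \<in> ctangent A p"
  shows "KC p (\<lambda>f. a * W f + b * W' f) = (\<lambda>f. a * KC p W f + b * KC p W' f)"
proof -
  let ?T = "tangent A p"
  have comb: "r *\<^sub>R u + s *\<^sub>R u' \<in> ?T" if "u \<in> ?T" "u' \<in> ?T" for r s u u'
    using that by (intro subspace_add subspace_scale tangent_subspace)
  show ?thesis
    by (rule ctvec_eqI)
      (simp_all only: clinear_ext_parts para_re_comb para_im_comb K_add comb ctangentD[OF W] ctangentD[OF W']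
        linear_withinD[OF K_linear])
qed

lemma \<rho>C_K_K:
  assumes W: "W \<in> ctangent A p" and V: "V \<in> ctangent A p"
  shows "\<rho>C p (KC p W) (KC p V) = - \<rho>C p W V"
  unfolding cbilinear_ext_def clinear_ext_parts
  using ctangentD[OF W] ctangentD[OF V] by (simp add: ricci_form_K_K para_eq_iff)

text \<open>For \<open>s = e\<close> and \<open>s = -e\<close> these are the projections to the vectors of type (1,0) and (0,1), the
  eigenspaces of \<open>K\<close> with eigenvalue \<open>s\<close>.\<close>

definition eigen_part :: "para \<Rightarrow> 'm \<Rightarrow> 'm ctvec \<Rightarrow> 'm ctvec" where
  "eigen_part s p W = (\<lambda>f. of_real (1/2) * W f + (of_real (1/2) * s) * KC p W f)"

lemma eigen_part_ctangent: "W \<in> ctangent A p \<Longrightarrow> eigen_part s p W \<in> ctangent A p"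
  unfolding eigen_part_def by (intro ctangent_comb KC_ctangent)

lemma eigen_part_sum: "W = (\<lambda>f. 1 * eigen_part s p W f + 1 * eigen_part (- s) p W f)"
  by (auto simp: eigen_part_def fun_eq_iff para_eq_iff)

lemma eigen_part_comb:
  assumes "W \<in> ctangent A p" "W' \<in> ctangent A p"
  shows "eigen_part s p (\<lambda>f. a * W f + b * W' f) = (\<lambda>f. a * eigen_part s p W f + b * eigen_part s p W' f)"
  by (simp add: eigen_part_def KC_comb[OF assms] algebra_simps)

lemma eigen_part_K:
  assumes "W \<in> ctangent A p" "s * s = 1"
  shows "eigen_part s p (KC p W) = (\<lambda>f. s * eigen_part s p W f + 0 * W f)"
proof
  fix f
  have "s * (of_real (1/2) * s * KC p W f) = of_real (1/2) * (s * s) * KC p W f"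
    by (simp only: mult.assoc mult.left_commute mult.commute)
  then show "eigen_part s p (KC p W) f = s * eigen_part s p W f + 0 * W f"
    by (simp add: eigen_part_def KC_KC[OF assms(1)] assms(2) algebra_simps)
qed

text \<open>The Ricci form changes sign when \<open>K\<close> is applied to both arguments, whereas two eigenvectors with
  the same eigenvalue \<open>s\<close> contribute the factor \<open>s\<^sup>2 = 1\<close>.\<close>

lemma \<rho>C_eigen_part:
  assumes W: "W \<in> ctangent A p" and V: "V \<in> ctangent A p" and s: "s * s = 1"
  shows "\<rho>C p (eigen_part s p W) (eigen_part s p V) = 0"
proof -
  note KW = KC_ctangent[OF W] and KV = KC_ctangent[OF V]
  let ?h = "of_real (1/2) :: para"
  have 1: "\<rho>C p (KC p W) V = - \<rho>C p W (KC p V)"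
    using \<rho>C_K_K[OF W KV] by (simp add: KC_KC[OF V])
  have "\<rho>C p (eigen_part s p W) (eigen_part s p V) =
      ?h * (?h * \<rho>C p W V + (?h * s) * \<rho>C p W (KC p V)) +
      (?h * s) * (?h * \<rho>C p (KC p W) V + (?h * s) * \<rho>C p (KC p W) (KC p V))"
    unfolding eigen_part_def
    by (simp only: \<rho>C_left[OF W KW ctangent_comb[OF V KV]] \<rho>C_right[OF V KV W] \<rho>C_right[OF V KV KW])
  also have "\<dots> = ?h * ?h * (1 - s * s) * \<rho>C p W V"
  proof -
    have "h * (h * a + (h * s) * b) + (h * s) * (h * - b + (h * s) * - a) = h * h * (1 - s * s) * a"
      for h a b :: para
      by (simp add: algebra_simps)
    then show ?thesis unfolding 1 \<rho>C_K_K[OF W V] .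
  qed
  finally show ?thesis by (simp add: s)
qed

lemma \<rho>C_decompose:
  assumes W: "W \<in> ctangent A p" and V: "V \<in> ctangent A p"
  shows "\<rho>C p W V = \<rho>C p (eigen_part para_e p W) (eigen_part (- para_e) p V) -
    \<rho>C p (eigen_part para_e p V) (eigen_part (- para_e) p W)"
proof -
  note P = eigen_part_ctangent[OF W] and Q = eigen_part_ctangent[OF V]
  have ee: "(- para_e) * (- para_e) = 1" by simp
  have "\<rho>C p W V = \<rho>C p (\<lambda>f. 1 * eigen_part para_e p W f + 1 * eigen_part (- para_e) p W f)
      (\<lambda>f. 1 * eigen_part para_e p V f + 1 * eigen_part (- para_e) p V f)"
    by (rule arg_cong2[where f = "\<rho>C p", OF eigen_part_sum eigen_part_sum])
  also have "\<dots> = \<rho>C p (eigen_part para_e p W) (eigen_part (- para_e) p V) +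
      \<rho>C p (eigen_part (- para_e) p W) (eigen_part para_e p V)"
    by (simp only: \<rho>C_left[OF P P ctangent_comb[OF Q Q]] \<rho>C_right[OF Q Q P]
        \<rho>C_eigen_part[OF W V para_e_e] \<rho>C_eigen_part[OF W V ee]) simp
  finally show ?thesis
    using \<rho>C_skew[OF Q[of para_e] P[of "- para_e"]] by simp
qed

text \<open>The wedge products are formed from the two sides of the expansion of the (0,1)-part of a vector in
  the coordinate vectors \<open>V b\<close> of any chart: \<open>\<theta> b\<close> pairs the (1,0)-part with \<open>V b\<close>, and \<open>\<eta> b\<close> is the coefficient.\<close>

lemma ricci_form_type_1_1_at:
  "\<exists>(m::nat) \<theta> \<eta>. (\<forall>i<m. ccovector_type A K para_e p (\<theta> i) \<and> ccovector_type A K (- para_e) p (\<eta> i)) \<and>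
     (\<forall>W\<in>ctangent A p. \<forall>W'\<in>ctangent A p. \<rho>C p W W' = (\<Sum>i<m. wedge (\<theta> i) (\<eta> i) W W'))"
proof -
  obtain c where c: "c \<in> A" "p \<in> fst c" using charts_cover by blast
  obtain e where e: "bij_betw e {..<card (Basis :: 'e set)} (Basis :: 'e set)"
    using ex_bij_betw_nat_finite[of "Basis :: 'e set"] by (auto simp: atLeast0LessThan)
  define V where "V = (\<lambda>b f. of_real (chart_vec A c b p f) :: para)"
  have V: "V b \<in> ctangent A p" for b
    unfolding V_def by (rule ctangent_real[OF chart_vec_tangent[OF c]])
  define \<theta> where "\<theta> = (\<lambda>b W. \<rho>C p (eigen_part para_e p W) (V b))"
  define \<eta> where "\<eta> = (\<lambda>b W. eigen_part (- para_e) p W (coord c b))"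
  have ee: "(- para_e) * (- para_e) = 1" by simp
  have "\<theta> b (KC p W) = para_e * \<theta> b W" if W: "W \<in> ctangent A p" for b W
    using \<rho>C_left[OF eigen_part_ctangent[OF W] W V, of para_e para_e 0 b]
    unfolding \<theta>_def eigen_part_K[OF W para_e_e] by simp
  then have \<theta>: "ccovector_type A K para_e p (\<theta> b)" for b
    by (simp add: ccovector_type_def \<theta>_def eigen_part_comb \<rho>C_left[OF eigen_part_ctangent eigen_part_ctangent V])
  have \<eta>: "ccovector_type A K (- para_e) p (\<eta> b)" for b
    unfolding ccovector_type_def \<eta>_def using eigen_part_K[OF _ ee]
    by (auto simp: eigen_part_comb)
  have *: "\<rho>C p (eigen_part para_e p W) (eigen_part (- para_e) p W') = (\<Sum>b\<in>Basis. \<theta> b W * \<eta> b W')"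
    if W: "W \<in> ctangent A p" and W': "W' \<in> ctangent A p" for W W'
  proof -
    have "eigen_part (- para_e) p W' = (\<lambda>f. \<Sum>b\<in>Basis. \<eta> b W' * V b f)"
      unfolding \<eta>_def V_def by (rule ctangent_expand[OF c eigen_part_ctangent[OF W']])
    then show ?thesis
      using \<rho>C_sum_right[where V = V and I = Basis and a = "\<lambda>b. \<eta> b W'", OF V eigen_part_ctangent[OF W, of para_e]]
      by (simp add: \<theta>_def mult.commute[of "\<rho>C p _ _"])
  qed
  have "\<rho>C p W W' = (\<Sum>i<card (Basis :: 'e set). wedge (\<theta> (e i)) (\<eta> (e i)) W W')"
    if W: "W \<in> ctangent A p" and W': "W' \<in> ctangent A p" for W W'
  proof -
    have "\<rho>C p W W' = (\<Sum>b\<in>Basis. wedge (\<theta> b) (\<eta> b) W W')"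
      unfolding \<rho>C_decompose[OF W W'] *[OF W W'] *[OF W' W]
      by (simp add: wedge_def sum_subtractf)
    then show ?thesis using sum.reindex_bij_betw[OF e, of "\<lambda>b. wedge (\<theta> b) (\<eta> b) W W'"] by simp
  qed
  then show ?thesis
    using \<theta> \<eta> by (intro exI[of _ "card (Basis :: 'e set)"] exI[of _ "\<lambda>i. \<theta> (e i)"] exI[of _ "\<lambda>i. \<eta> (e i)"]) blast
qed

end


section \<open>The Ricci form as a second derivative of the volume density\<close>

text \<open>Applied to the two homomorphisms \<open>a + e b \<mapsto> a + b\<close> and \<open>a + e b \<mapsto> a - b\<close>, which reduce para-complex
  determinants to real ones.\<close>

lemma para_det_hom:
  fixes M :: "para^'n^'n" and \<phi> :: "para \<Rightarrow> real"
  assumes add: "\<And>a b. \<phi> (a + b) = \<phi> a + \<phi> b" and mult: "\<And>a b. \<phi> (a * b) = \<phi> a * \<phi> b"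
    and real: "\<And>r. \<phi> (of_real r) = r"
  shows "\<phi> (det M) = det (\<chi> i j. \<phi> (M $ i $ j))"
proof -
  have \<phi>_sum: "\<phi> (\<Sum>i\<in>I. f i) = (\<Sum>i\<in>I. \<phi> (f i))" for f :: "'i \<Rightarrow> para" and I
    by (induction I rule: infinite_finite_induct) (use real[of 0] in \<open>simp_all add: add\<close>)
  have \<phi>_prod: "\<phi> (\<Prod>i\<in>I. f i) = (\<Prod>i\<in>I. \<phi> (f i))" for f :: "'i \<Rightarrow> para" and I
    by (induction I rule: infinite_finite_induct) (use real[of 1] in \<open>simp_all add: mult\<close>)
  have \<phi>_int: "\<phi> (of_int k) = of_int k" for k
    using real[of "of_int k"] by simp
  show ?thesis
    by (simp add: det_def \<phi>_sum \<phi>_prod mult \<phi>_int)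
qed

context para_hol_chart
begin

abbreviation vz :: "'n \<Rightarrow> 'm \<Rightarrow> 'm ctvec" where
  "vz \<equiv> vec_z A U z"

abbreviation vzbar :: "'n \<Rightarrow> 'm \<Rightarrow> 'm ctvec" where
  "vzbar \<equiv> vec_zbar A U z"

abbreviation log_det :: "'m \<Rightarrow> para" where
  "log_det \<equiv> log_metric_det A U z g"

abbreviation ddbar :: "'n \<Rightarrow> 'n \<Rightarrow> 'm \<Rightarrow> para" where
  "ddbar \<alpha> \<beta> \<equiv> partial_z A U z \<alpha> (partial_zbar A U z \<beta> log_det)"

lemma vec_z_parts:
  "para_re \<circ> vz \<alpha> p = (1/2) *\<^sub>R Fx \<alpha> p" "para_im \<circ> vz \<alpha> p = (1/2) *\<^sub>R Fy \<alpha> p"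
  "para_re \<circ> vzbar \<alpha> p = (1/2) *\<^sub>R Fx \<alpha> p" "para_im \<circ> vzbar \<alpha> p = (- 1/2) *\<^sub>R Fy \<alpha> p"
  by (auto simp: fun_eq_iff vec_z_def vec_zbar_def)

lemma vec_z_ctangent:
  assumes p: "p \<in> U"
  shows "vz \<alpha> p \<in> ctangent A p" "vzbar \<alpha> p \<in> ctangent A p"
  unfolding ctangent_def mem_Collect_eq vec_z_parts
  by (intro conjI subspace_scale tangent_subspace frame_tangent[OF p])+

lemma form_scale:
  assumes t: "bilinear_within (tangent A p) t" and u: "u \<in> tangent A p" and v: "v \<in> tangent A p"
  shows "t (r *\<^sub>R u) (s *\<^sub>R v) = r * s * t u v"
  using bilinear_withinD[OF tangent_subspace t u u v v, of r 0 s 0] by simp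

text \<open>The two homomorphisms send the Hermitian matrix of the metric to \<open>h\<close> and its transpose. Hence its
  determinant is the real number \<open>det h\<close>.\<close>

lemma metric_det_eq:
  assumes p: "p \<in> U"
  shows "para_re (metric_det A U z g p) = det (h p)"
proof -
  define M where "M = (\<chi> \<alpha> \<beta>. cbilinear_ext (g p) (vz \<alpha> p) (vzbar \<beta> p))"
  note T = frame_tangent[OF p]
  have scale: "g p (r *\<^sub>R u) (s *\<^sub>R v) = r * s * g p u v" if "u \<in> tangent A p" "v \<in> tangent A p" for r s u v
    using form_scale[OF g_bilinear that] .
  have scale': "g p (r *\<^sub>R u) (- (s *\<^sub>R v)) = - (r * s * g p u v)"
    if "u \<in> tangent A p" "v \<in> tangent A p" for r s u v
    using scale[OF that, of r "- s"] by simp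
  have h: "h p $ \<alpha> $ \<beta> = (g p (Fx \<alpha> p) (Fx \<beta> p) - g p (Fx \<alpha> p) (Fy \<beta> p) + g p (Fy \<alpha> p) (Fx \<beta> p)
      - g p (Fy \<alpha> p) (Fy \<beta> p)) / 4" for \<alpha> \<beta>
    using bilinear_withinD[OF tangent_subspace g_bilinear T T T T,
        of 1 "ux \<alpha>" 1 "uy \<alpha>" 1 "ux \<beta>" "- 1" "uy \<beta>"]
    by (simp add: h_def \<xi>_eq[OF p] \<eta>_eq[OF p])
  have M: "para_re (M $ \<alpha> $ \<beta>) = (g p (Fx \<alpha> p) (Fx \<beta> p) - g p (Fy \<alpha> p) (Fy \<beta> p)) / 4"
    "para_im (M $ \<alpha> $ \<beta>) = (g p (Fy \<alpha> p) (Fx \<beta> p) - g p (Fx \<alpha> p) (Fy \<beta> p)) / 4" for \<alpha> \<beta>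
    by (simp_all add: M_def cbilinear_ext_def vec_z_parts scale scale' T)
  have "para_re (det M) + para_im (det M) = det (\<chi> \<alpha> \<beta>. para_re (M $ \<alpha> $ \<beta>) + para_im (M $ \<alpha> $ \<beta>))"
    by (rule para_det_hom[of "\<lambda>a. para_re a + para_im a"]) (simp_all add: algebra_simps)
  also have "\<dots> = det (h p)"
    by (rule arg_cong[of _ _ det]) (simp add: vec_eq_iff h M diff_divide_distrib add_divide_distrib)
  finally have 1: "para_re (det M) + para_im (det M) = det (h p)" .
  have conj: "para_re (M $ \<alpha> $ \<beta>) - para_im (M $ \<alpha> $ \<beta>) = h p $ \<beta> $ \<alpha>" for \<alpha> \<beta>
    unfolding h M
    using g_sym[OF T T, of "ux \<alpha>" "ux \<beta>"] g_sym[OF T T, of "ux \<alpha>" "uy \<beta>"]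
      g_sym[OF T T, of "uy \<alpha>" "ux \<beta>"] g_sym[OF T T, of "uy \<alpha>" "uy \<beta>"]
    by (simp add: field_simps)
  have "para_re (det M) - para_im (det M) = det (\<chi> \<alpha> \<beta>. para_re (M $ \<alpha> $ \<beta>) - para_im (M $ \<alpha> $ \<beta>))"
    by (rule para_det_hom[of "\<lambda>a. para_re a - para_im a"]) (simp_all add: algebra_simps)
  also have "\<dots> = det (transpose (h p))"
    by (rule arg_cong[of _ _ det]) (simp add: vec_eq_iff transpose_def conj)
  finally have 2: "para_re (det M) - para_im (det M) = det (h p)" by (simp only: det_transpose)
  show ?thesis
    using 1 2 by (simp add: metric_det_def M_def[symmetric])
qed

lemma log_metric_det_eq: "p \<in> U \<Longrightarrow> log_det p = of_real (L p)"
  by (simp add: log_metric_det_def metric_det_eq L_def)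

lemma capply_vec_z:
  "para_re (partial_z A U z \<alpha> f p) = (Fx \<alpha> p (para_re \<circ> f) + Fy \<alpha> p (para_im \<circ> f)) / 2"
  "para_im (partial_z A U z \<alpha> f p) = (Fy \<alpha> p (para_re \<circ> f) + Fx \<alpha> p (para_im \<circ> f)) / 2"
  "para_re (partial_zbar A U z \<alpha> f p) = (Fx \<alpha> p (para_re \<circ> f) - Fy \<alpha> p (para_im \<circ> f)) / 2"
  "para_im (partial_zbar A U z \<alpha> f p) = (Fx \<alpha> p (para_im \<circ> f) - Fy \<alpha> p (para_re \<circ> f)) / 2"
  by (simp_all add: partial_z_def partial_zbar_def capply_def vec_z_def vec_zbar_def field_simps)

lemma partial_z_germ:
  assumes p: "p \<in> U" and eq: "\<And>q. q \<in> U \<Longrightarrow> f q = f' q"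
  shows "partial_z A U z \<alpha> f p = partial_z A U z \<alpha> f' p" "partial_zbar A U z \<alpha> f p = partial_zbar A U z \<alpha> f' p"
proof -
  have "chart_vec A zc w p (para_re \<circ> f) = chart_vec A zc w p (para_re \<circ> f')"
    "chart_vec A zc w p (para_im \<circ> f) = chart_vec A zc w p (para_im \<circ> f')" for w
    by (rule tangent_germ[OF frame_tangent[OF p] U_open p]; simp add: eq)+
  then show "partial_z A U z \<alpha> f p = partial_z A U z \<alpha> f' p" "partial_zbar A U z \<alpha> f p = partial_zbar A U z \<alpha> f' p"
    by (simp_all add: para_eq_iff capply_vec_z)
qed

lemma partial_zbar_log:
  assumes q: "q \<in> U"
  shows "para_re (partial_zbar A U z \<beta> log_det q) = Fx \<beta> q L / 2"
    and "para_im (partial_zbar A U z \<beta> log_det q) = - Fy \<beta> q L / 2"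
proof -
  have "partial_zbar A U z \<beta> log_det q = partial_zbar A U z \<beta> (\<lambda>q. of_real (L q)) q"
    by (rule partial_z_germ(2)[OF q log_metric_det_eq])
  then show "para_re (partial_zbar A U z \<beta> log_det q) = Fx \<beta> q L / 2"
    "para_im (partial_zbar A U z \<beta> log_det q) = - Fy \<beta> q L / 2"
    by (simp_all add: capply_vec_z o_def tangent_const[OF frame_tangent[OF q]])
qed

abbreviation hess :: "(real^'n) \<times> (real^'n) \<Rightarrow> (real^'n) \<times> (real^'n) \<Rightarrow> 'm \<Rightarrow> real" where
  "hess v w p \<equiv> chart_vec A zc v p (\<lambda>q. chart_vec A zc w q L)"

lemma dd_near: "p \<in> U \<Longrightarrow> smooth_near A p (\<lambda>q. chart_vec A zc w q L)"
  by (rule VF_smooth_near[OF U_open frame_VF _ smooth_nearI[OF U_open _ L_smooth]])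

lemma dd_sym: "p \<in> U \<Longrightarrow> hess v w p = hess w v p"
  by (rule coordinate_fields_commute[OF zc]) (simp_all add: smooth_nearI[OF U_open _ L_smooth])

lemma partial_z_partial_zbar_log:
  assumes p: "p \<in> U"
  shows "para_re (ddbar \<alpha> \<beta> p) =
      (hess (ux \<alpha>) (ux \<beta>) p - hess (uy \<alpha>) (uy \<beta>) p) / 4"
    and "para_im (ddbar \<alpha> \<beta> p) =
      (hess (uy \<alpha>) (ux \<beta>) p - hess (ux \<alpha>) (uy \<beta>) p) / 4"
proof -
  have "chart_vec A zc w p (para_re \<circ> partial_zbar A U z \<beta> log_det) =
      chart_vec A zc w p (\<lambda>q. (1/2) * Fx \<beta> q L)" for w
    by (rule tangent_germ[OF frame_tangent[OF p] U_open p]) (simp add: partial_zbar_log)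
  then have re: "chart_vec A zc w p (para_re \<circ> partial_zbar A U z \<beta> log_det) =
      (1/2) * hess w (ux \<beta>) p" for w
    using tangent_cmult[OF frame_tangent[OF p] dd_near[OF p], where a = "1/2"] by simp
  have "chart_vec A zc w p (para_im \<circ> partial_zbar A U z \<beta> log_det) =
      chart_vec A zc w p (\<lambda>q. (- 1/2) * Fy \<beta> q L)" for w
    by (rule tangent_germ[OF frame_tangent[OF p] U_open p]) (simp add: partial_zbar_log)
  then have im: "chart_vec A zc w p (para_im \<circ> partial_zbar A U z \<beta> log_det) =
      (- 1/2) * hess w (uy \<beta>) p" for w
    using tangent_cmult[OF frame_tangent[OF p] dd_near[OF p], where a = "- 1/2"] by simp
  show "para_re (ddbar \<alpha> \<beta> p) =
      (hess (ux \<alpha>) (ux \<beta>) p - hess (uy \<alpha>) (uy \<beta>) p) / 4"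
    "para_im (ddbar \<alpha> \<beta> p) =
      (hess (uy \<alpha>) (ux \<beta>) p - hess (ux \<alpha>) (uy \<beta>) p) / 4"
    unfolding capply_vec_z re im by simp_all
qed

lemma dd_\<eta>_\<xi>:
  assumes p: "p \<in> U"
  shows "\<eta> \<beta> p (\<lambda>q. \<xi> \<alpha> q L) = hess (ux \<beta>) (ux \<alpha>) p + hess (ux \<beta>) (uy \<alpha>) p
    - hess (uy \<beta>) (ux \<alpha>) p - hess (uy \<beta>) (uy \<alpha>) p"
proof -
  have "chart_vec A zc w p (\<lambda>q. \<xi> \<alpha> q L) = hess w (ux \<alpha>) p + hess w (uy \<alpha>) p" for w
  proof -
    have "chart_vec A zc w p (\<lambda>q. \<xi> \<alpha> q L) = chart_vec A zc w p (\<lambda>q. Fx \<alpha> q L + Fy \<alpha> q L)"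
      by (rule tangent_germ[OF frame_tangent[OF p] U_open p]) (simp add: \<xi>_eq)
    then show ?thesis using tangent_add[OF frame_tangent[OF p] dd_near[OF p] dd_near[OF p]] by simp
  qed
  then show ?thesis by (simp add: \<eta>_eq[OF p])
qed

text \<open>Invariance of the Ricci form under \<open>K\<close> up to sign leaves two unknowns, the values at
  \<open>(\<partial>/\<partial>x\<^sup>\<alpha>, \<partial>/\<partial>x\<^sup>\<beta>)\<close> and \<open>(\<partial>/\<partial>y\<^sup>\<alpha>, \<partial>/\<partial>x\<^sup>\<beta>)\<close>. The values at \<open>(\<xi>\<^sup>\<alpha>, \<eta>\<^sup>\<beta>)\<close> and \<open>(\<xi>\<^sup>\<beta>, \<eta>\<^sup>\<alpha>)\<close> are twice their
  sum and twice their difference.\<close>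

lemma ricci_form_frame:
  assumes p: "p \<in> U"
  shows "ricci_form A K D p (Fx \<alpha> p) (Fx \<beta> p) =
      (hess (uy \<alpha>) (ux \<beta>) p - hess (ux \<alpha>) (uy \<beta>) p) / 2"
    and "ricci_form A K D p (Fy \<alpha> p) (Fx \<beta> p) =
      (hess (ux \<alpha>) (ux \<beta>) p - hess (uy \<alpha>) (uy \<beta>) p) / 2"
    and "ricci_form A K D p (Fy \<alpha> p) (Fy \<beta> p) = - ricci_form A K D p (Fx \<alpha> p) (Fx \<beta> p)"
    and "ricci_form A K D p (Fx \<alpha> p) (Fy \<beta> p) = - ricci_form A K D p (Fy \<alpha> p) (Fx \<beta> p)"
proof -
  let ?r = "ricci_form A K D p"
  note T = frame_tangent[OF p]
  have yy: "?r (Fy \<alpha> p) (Fy \<beta> p) = - ?r (Fx \<alpha> p) (Fx \<beta> p)" for \<alpha> \<beta>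
    using ricci_form_K_K[OF T T, of "ux \<alpha>" "ux \<beta>"] by (simp add: K_frame[OF p])
  have xy: "?r (Fx \<alpha> p) (Fy \<beta> p) = - ?r (Fy \<alpha> p) (Fx \<beta> p)" for \<alpha> \<beta>
    using ricci_form_K_K[OF T T, of "uy \<alpha>" "ux \<beta>"] by (simp add: K_frame[OF p])
  have skew: "?r (chart_vec A zc v p) (chart_vec A zc w p) = - ?r (chart_vec A zc w p) (chart_vec A zc v p)" for v w
    by (rule ricci_form_skew[OF T T])
  have main: "?r (Fx \<alpha> p) (Fx \<beta> p) - ?r (Fx \<alpha> p) (Fy \<beta> p) + ?r (Fy \<alpha> p) (Fx \<beta> p) - ?r (Fy \<alpha> p) (Fy \<beta> p) =
      hess (ux \<beta>) (ux \<alpha>) p + hess (ux \<beta>) (uy \<alpha>) p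
      - hess (uy \<beta>) (ux \<alpha>) p - hess (uy \<beta>) (uy \<alpha>) p" for \<alpha> \<beta>
    unfolding dd_\<eta>_\<xi>[OF p, symmetric] ricci_form_\<xi>_\<eta>[OF p, symmetric]
    using bilinear_withinD[OF tangent_subspace ricci_form_bilinear T T T T,
        of 1 "ux \<alpha>" 1 "uy \<alpha>" 1 "ux \<beta>" "- 1" "uy \<beta>"]
    by (simp add: \<xi>_eq[OF p] \<eta>_eq[OF p])
  note s = skew[of "ux \<beta>" "ux \<alpha>"] skew[of "uy \<beta>" "ux \<alpha>"]
  note d = dd_sym[OF p, of "ux \<beta>" "ux \<alpha>"] dd_sym[OF p, of "ux \<beta>" "uy \<alpha>"]
    dd_sym[OF p, of "uy \<beta>" "ux \<alpha>"] dd_sym[OF p, of "uy \<beta>" "uy \<alpha>"]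
  have sum: "2 * ?r (Fx \<alpha> p) (Fx \<beta> p) + 2 * ?r (Fy \<alpha> p) (Fx \<beta> p) =
      hess (ux \<alpha>) (ux \<beta>) p + hess (uy \<alpha>) (ux \<beta>) p
      - hess (ux \<alpha>) (uy \<beta>) p - hess (uy \<alpha>) (uy \<beta>) p"
    using main[of \<alpha> \<beta>] by (simp add: yy xy d)
  have difference: "2 * ?r (Fy \<alpha> p) (Fx \<beta> p) - 2 * ?r (Fx \<alpha> p) (Fx \<beta> p) =
      hess (ux \<alpha>) (ux \<beta>) p + hess (ux \<alpha>) (uy \<beta>) p
      - hess (uy \<alpha>) (ux \<beta>) p - hess (uy \<alpha>) (uy \<beta>) p"
    using main[of \<beta> \<alpha>] by (simp add: yy xy s)
  show "?r (Fy \<alpha> p) (Fy \<beta> p) = - ?r (Fx \<alpha> p) (Fx \<beta> p)" "?r (Fx \<alpha> p) (Fy \<beta> p) = - ?r (Fy \<alpha> p) (Fx \<beta> p)"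
    by (rule yy xy)+
  show "?r (Fx \<alpha> p) (Fx \<beta> p) = (hess (uy \<alpha>) (ux \<beta>) p - hess (ux \<alpha>) (uy \<beta>) p) / 2"
    "?r (Fy \<alpha> p) (Fx \<beta> p) = (hess (ux \<alpha>) (ux \<beta>) p - hess (uy \<alpha>) (uy \<beta>) p) / 2"
    using sum difference by (simp_all add: field_simps)
qed

lemma \<rho>C_vec:
  assumes p: "p \<in> U"
  shows "\<rho>C p (vz \<alpha> p) (vzbar \<beta> p) =
      para_e * ddbar \<alpha> \<beta> p"
    and "\<rho>C p (vz \<alpha> p) (vz \<beta> p) = 0"
    and "\<rho>C p (vzbar \<alpha> p) (vzbar \<beta> p) = 0"
  unfolding cbilinear_ext_def vec_z_parts form_scale[OF ricci_form_bilinear frame_tangent[OF p] frame_tangent[OF p]]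
  by (simp_all add: para_eq_iff partial_z_partial_zbar_log[OF p] ricci_form_frame[OF p])

lemma ricci_vec:
  assumes p: "p \<in> U"
  shows "cbilinear_ext (ricci A D p) (vz \<alpha> p) (vzbar \<beta> p) =
    - ddbar \<alpha> \<beta> p"
proof -
  have scale: "ricci A D p (r *\<^sub>R u) (s *\<^sub>R v) = r * s * ricci_form A K D p u (K p v)"
    if u: "u \<in> tangent A p" and v: "v \<in> tangent A p" for r s u v
    using form_scale[OF ricci_form_bilinear u K_tangent[OF v], of r s]
    by (simp add: ricci_form_def K_scale K_tangent K_K v subspace_scale[OF tangent_subspace])
  show ?thesis
    unfolding cbilinear_ext_def vec_z_parts scale[OF frame_tangent[OF p] frame_tangent[OF p]]
    by (simp add: K_frame[OF p] para_eq_iff partial_z_partial_zbar_log[OF p] ricci_form_frame[OF p])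
qed

lemma dz_real:
  assumes p: "p \<in> U" and W: "W \<in> ctangent A p"
  shows "dz z \<alpha> W = W (coord zc (ux \<alpha>)) + para_e * W (coord zc (uy \<alpha>))"
    and "dzbar z \<alpha> W = W (coord zc (ux \<alpha>)) - para_e * W (coord zc (uy \<alpha>))"
proof -
  show "dz z \<alpha> W = W (coord zc (ux \<alpha>)) + para_e * W (coord zc (uy \<alpha>))"
    by (simp add: dz_def capply_def coord_zc o_def)
  have neg: "u (\<lambda>q. - coord zc b q) = - u (coord zc b)" if "u \<in> tangent A p" for u b
    by (rule tangent_uminus[OF that coord_near[OF p]])
  have "W (\<lambda>q. - coord zc b q) = - W (coord zc b)" for b
    using neg[OF ctangentD(1)[OF W]] neg[OF ctangentD(2)[OF W]] by (simp add: para_eq_iff)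
  from this[of "uy \<alpha>"]
  show "dzbar z \<alpha> W = W (coord zc (ux \<alpha>)) - para_e * W (coord zc (uy \<alpha>))"
    by (simp add: dzbar_def capply_def coord_zc o_def para_cnj_def)
qed

lemma dz_vec:
  assumes p: "p \<in> U"
  shows "dz z \<alpha> (vz \<beta> p) = (if \<alpha> = \<beta> then 1 else 0)" "dzbar z \<alpha> (vz \<beta> p) = 0"
    "dz z \<alpha> (vzbar \<beta> p) = 0" "dzbar z \<alpha> (vzbar \<beta> p) = (if \<alpha> = \<beta> then 1 else 0)"
  by (simp_all add: dz_real[OF p] vec_z_ctangent[OF p])
    (simp_all add: vec_z_def vec_zbar_def frame_coord[OF p] inner_axis_axis para_eq_iff)

lemma ctangent_expand_z:
  assumes p: "p \<in> U" and W: "W \<in> ctangent A p"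
  shows "W = (\<lambda>f. 1 * (\<Sum>\<alpha>\<in>UNIV. dz z \<alpha> W * vz \<alpha> p f) +
    1 * (\<Sum>\<alpha>\<in>UNIV. dzbar z \<alpha> W * vzbar \<alpha> p f))"
proof
  fix f
  let ?x = "\<lambda>\<alpha>. coord zc (ux \<alpha>)" and ?y = "\<lambda>\<alpha>. coord zc (uy \<alpha>)"
  have "W f = (\<Sum>\<alpha>\<in>UNIV. W (?x \<alpha>) * of_real (Fx \<alpha> p f)) + (\<Sum>\<alpha>\<in>UNIV. W (?y \<alpha>) * of_real (Fy \<alpha> p f))"
    using fun_cong[OF ctangent_expand[OF zc _ W], of f] p unfolding sum_Basis_pair by simp
  also have "\<dots> = (\<Sum>\<alpha>\<in>UNIV. dz z \<alpha> W * vz \<alpha> p f + dzbar z \<alpha> W * vzbar \<alpha> p f)"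
    unfolding sum.distrib[symmetric]
    by (rule sum.cong[OF refl])
      (simp add: dz_real[OF p W] vec_z_def vec_zbar_def para_eq_iff field_simps)
  finally show "W f = 1 * (\<Sum>\<alpha>\<in>UNIV. dz z \<alpha> W * vz \<alpha> p f) +
      1 * (\<Sum>\<alpha>\<in>UNIV. dzbar z \<alpha> W * vzbar \<alpha> p f)"
    by (simp add: sum.distrib)
qed

lemma \<rho>C_expand:
  assumes p: "p \<in> U" and W: "W \<in> ctangent A p" and W': "W' \<in> ctangent A p"
  shows "\<rho>C p W W' = (\<Sum>\<alpha>\<in>UNIV. \<Sum>\<beta>\<in>UNIV. \<rho>C p (vz \<alpha> p) (vzbar \<beta> p) *
    wedge (dz z \<alpha>) (dzbar z \<beta>) W W')"
proof -
  let ?v = "\<lambda>\<alpha>. vz \<alpha> p" and ?w = "\<lambda>\<alpha>. vzbar \<alpha> p"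
  note v = vec_z_ctangent[OF p]
  define P where "P = (\<lambda>W f. \<Sum>\<alpha>\<in>UNIV. dz z \<alpha> W * ?v \<alpha> f)"
  define Q where "Q = (\<lambda>W f. \<Sum>\<alpha>\<in>UNIV. dzbar z \<alpha> W * ?w \<alpha> f)"
  have PT: "P W \<in> ctangent A p" and QT: "Q W \<in> ctangent A p" for W
    unfolding P_def Q_def by (intro ctangent_sum v)+
  have split: "W = (\<lambda>f. 1 * P W f + 1 * Q W f)" if "W \<in> ctangent A p" for W
    unfolding P_def Q_def by (rule ctangent_expand_z[OF p that])
  have Pl: "\<rho>C p (P W) V = (\<Sum>\<alpha>\<in>UNIV. dz z \<alpha> W * \<rho>C p (?v \<alpha>) V)" if "V \<in> ctangent A p" for W V
    unfolding P_def by (rule \<rho>C_sum_left[OF v(1) that])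
  have Ql: "\<rho>C p (Q W) V = (\<Sum>\<alpha>\<in>UNIV. dzbar z \<alpha> W * \<rho>C p (?w \<alpha>) V)" if "V \<in> ctangent A p" for W V
    unfolding Q_def by (rule \<rho>C_sum_left[OF v(2) that])
  have Pr: "\<rho>C p V (P W) = (\<Sum>\<alpha>\<in>UNIV. dz z \<alpha> W * \<rho>C p V (?v \<alpha>))" if "V \<in> ctangent A p" for W V
    unfolding P_def by (rule \<rho>C_sum_right[OF v(1) that])
  have Qr: "\<rho>C p V (Q W) = (\<Sum>\<alpha>\<in>UNIV. dzbar z \<alpha> W * \<rho>C p V (?w \<alpha>))" if "V \<in> ctangent A p" for W V
    unfolding Q_def by (rule \<rho>C_sum_right[OF v(2) that])
  have PP: "\<rho>C p (P W) (P W') = 0" and QQ: "\<rho>C p (Q W) (Q W') = 0" for W W'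
    by (simp_all only: Pl[OF PT] Pr[OF v(1)] Ql[OF QT] Qr[OF v(2)] \<rho>C_vec[OF p]) simp_all
  have PQ: "\<rho>C p (P W) (Q W') = (\<Sum>\<alpha>\<in>UNIV. \<Sum>\<beta>\<in>UNIV. \<rho>C p (?v \<alpha>) (?w \<beta>) * (dz z \<alpha> W * dzbar z \<beta> W'))" for W W'
    by (simp only: Pl[OF QT] Qr[OF v(1)] sum_distrib_left mult_ac)
  have "\<rho>C p W W' = \<rho>C p (\<lambda>f. 1 * P W f + 1 * Q W f) (\<lambda>f. 1 * P W' f + 1 * Q W' f)"
    by (rule arg_cong2[where f = "\<rho>C p", OF split[OF W] split[OF W']])
  also have "\<dots> = \<rho>C p (P W) (Q W') + \<rho>C p (Q W) (P W')"
    by (simp only: \<rho>C_left[OF PT QT ctangent_comb[OF PT QT]] \<rho>C_right[OF PT QT PT] \<rho>C_right[OF PT QT QT] PP QQ) simp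
  also have "\<dots> = \<rho>C p (P W) (Q W') - \<rho>C p (P W') (Q W)"
    using \<rho>C_skew[OF PT QT, of W W'] by simp
  finally show ?thesis
    unfolding PQ by (simp add: wedge_def sum_subtractf right_diff_distrib mult_ac)
qed

lemma del_delbar_log:
  assumes p: "p \<in> U"
  shows "del_form A U z (delbar_fun A U z log_det) p W W' =
    (\<Sum>\<alpha>\<in>UNIV. \<Sum>\<beta>\<in>UNIV. ddbar \<alpha> \<beta> p *
      wedge (dz z \<alpha>) (dzbar z \<beta>) W W')"
proof -
  let ?\<theta> = "delbar_fun A U z log_det"
  have 1: "partial_z A U z \<gamma> (\<lambda>q. ?\<theta> q (vz \<alpha> q)) p = 0" for \<alpha> \<gamma>
  proof -
    have "partial_z A U z \<gamma> (\<lambda>q. ?\<theta> q (vz \<alpha> q)) p = partial_z A U z \<gamma> (\<lambda>q. 0) p"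
      by (rule partial_z_germ(1)[OF p]) (simp add: delbar_fun_def dz_vec)
    then show ?thesis
      by (simp add: para_eq_iff capply_vec_z o_def tangent_const[OF frame_tangent[OF p]])
  qed
  have 2: "partial_z A U z \<gamma> (\<lambda>q. ?\<theta> q (vzbar \<beta> q)) p = ddbar \<gamma> \<beta> p" for \<beta> \<gamma>
    by (rule partial_z_germ(1)[OF p]) (simp add: delbar_fun_def dz_vec if_distrib cong: if_cong)
  have "del_form A U z ?\<theta> p W W' = (\<Sum>\<beta>\<in>UNIV. \<Sum>\<alpha>\<in>UNIV. ddbar \<alpha> \<beta> p * wedge (dz z \<alpha>) (dzbar z \<beta>) W W')"
    by (simp add: del_form_def del_fun_def wedge_def 1 2 sum_distrib_left sum_distrib_right
        right_diff_distrib sum_subtractf mult_ac)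
  then show ?thesis by (subst sum.swap)
qed

text \<open>The coefficients of \<open>dz\<^sup>\<alpha> \<and> dzbar\<^sup>\<beta>\<close> in the Ricci form.\<close>

lemma \<rho>C_smooth:
  "smooth U (para_re \<circ> (\<lambda>q. \<rho>C q (vz \<alpha> q) (vzbar \<beta> q)))"
  "smooth U (para_im \<circ> (\<lambda>q. \<rho>C q (vz \<alpha> q) (vzbar \<beta> q)))"
proof -
  have s: "smooth U (\<lambda>q. (1/2) * ricci_form A K D q (chart_vec A zc v q) (chart_vec A zc w q))" for v w
    using ricci_form_two_form frame_VF U_open
    by (intro smooth_fun_mult smooth_fun_const U_open) (simp add: two_form_def tensor_field2_def)
  have "para_re (\<rho>C q (vz \<alpha> q) (vzbar \<beta> q)) = (1/2) * ricci_form A K D q (Fx \<alpha> q) (Fx \<beta> q)"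
    "para_im (\<rho>C q (vz \<alpha> q) (vzbar \<beta> q)) = (1/2) * ricci_form A K D q (Fy \<alpha> q) (Fx \<beta> q)"
    if q: "q \<in> U" for q
    by (simp_all add: \<rho>C_vec[OF q] partial_z_partial_zbar_log[OF q] ricci_form_frame[OF q])
  then show "smooth U (para_re \<circ> (\<lambda>q. \<rho>C q (vz \<alpha> q) (vzbar \<beta> q)))"
    "smooth U (para_im \<circ> (\<lambda>q. \<rho>C q (vz \<alpha> q) (vzbar \<beta> q)))"
    by (auto intro: smooth_fun_cong[OF U_open _ s])
qed

end

lemma para_kaehler_manifoldI:
  assumes "para_kaehler A K \<omega> g D"
  shows "para_kaehler_manifold A D K g"
proof -
  have A: "smooth_structure A" and lc: "levi_civita A g D" and pc: "para_complex A K"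
    using assms by (auto simp: para_kaehler_def)
  show ?thesis
  proof unfold_locales
    show "is_chart c" if "c \<in> A" for c using A that by (auto simp: smooth_structure_def)
    show "\<exists>c\<in>A. p \<in> fst c" for p
    proof -
      have "p \<in> (\<Union>c\<in>A. fst c)" using A by (simp add: smooth_structure_def)
      then show ?thesis by blast
    qed
    show "compatible_charts c d" if "c \<in> A" "d \<in> A" for c d
      using A that by (auto simp: smooth_structure_def)
    show "affine_connection A D" using lc by (simp add: levi_civita_def)
    show "endo_field A K" using pc by (simp add: para_complex_def)
    show "K p (K p u) = u" if "u \<in> tangent A p" for u p using pc that by (simp add: para_complex_def)
  qed (use assms in \<open>auto simp: para_kaehler_def\<close>)
qed

theorem proposition5p6:
  fixes A :: "('m::{t2_space, second_countable_topology}, (real ^ 'n) \<times> (real ^ 'n)) chart set"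
    and K :: "'m \<Rightarrow> 'm tvec \<Rightarrow> 'm tvec"
    and \<omega> g :: "'m \<Rightarrow> 'm tvec \<Rightarrow> 'm tvec \<Rightarrow> real"
    and D :: "('m \<Rightarrow> 'm tvec) \<Rightarrow> ('m \<Rightarrow> 'm tvec) \<Rightarrow> 'm \<Rightarrow> 'm tvec"
  assumes "para_kaehler A K \<omega> g D"
  shows "closed_two_form A (ricci_form A K D) \<and>
    type_1_1 A K (ricci_form A K D) \<and>
    (\<forall>U z. para_hol_coords A K U z \<longrightarrow>
      (\<forall>p\<in>U.
        (\<forall>W\<in>ctangent A p. \<forall>W'\<in>ctangent A p.
          cbilinear_ext (ricci_form A K D p) W W' =
          para_e * del_form A U z (delbar_fun A U z (log_metric_det A U z g)) p W W') \<and>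
        (\<forall>\<alpha> \<beta>.
          cbilinear_ext (ricci A D p) (vec_z A U z \<alpha> p) (vec_zbar A U z \<beta> p) =
          - partial_z A U z \<alpha> (partial_zbar A U z \<beta> (log_metric_det A U z g)) p)))"
proof -
  interpret para_kaehler_manifold A D K g
    by (rule para_kaehler_manifoldI[OF assms])
  have chart: "para_hol_chart A D K g U z" if "para_hol_coords A K U z" for U z
    by unfold_locales (rule that)
  have coordinates: "\<exists>c. (\<forall>\<alpha> \<beta>. smooth U (para_re \<circ> c \<alpha> \<beta>) \<and> smooth U (para_im \<circ> c \<alpha> \<beta>)) \<and>
      (\<forall>p\<in>U. \<forall>W\<in>ctangent A p. \<forall>W'\<in>ctangent A p. \<rho>C p W W' =
        (\<Sum>\<alpha>\<in>UNIV. \<Sum>\<beta>\<in>UNIV. c \<alpha> \<beta> p * wedge (dz z \<alpha>) (dzbar z \<beta>) W W'))"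
    if "para_hol_coords A K U z" for U z
  proof -
    interpret C: para_hol_chart A D K g U z by (rule chart[OF that])
    show ?thesis
      using C.\<rho>C_smooth C.\<rho>C_expand
      by (intro exI[of _ "\<lambda>\<alpha> \<beta> q. \<rho>C q (vec_z A U z \<alpha> q) (vec_zbar A U z \<beta> q)"]) blast
  qed
  have potential: "\<rho>C p W W' = para_e * del_form A U z (delbar_fun A U z (log_metric_det A U z g)) p W W'"
    if "para_hol_coords A K U z" "p \<in> U" "W \<in> ctangent A p" "W' \<in> ctangent A p" for U z p W W'
  proof -
    interpret C: para_hol_chart A D K g U z by (rule chart[OF that(1)])
    show ?thesis
      unfolding C.del_delbar_log[OF that(2)] C.\<rho>C_expand[OF that(2-4)] C.\<rho>C_vec(1)[OF that(2)]
      by (simp add: sum_distrib_left mult.assoc)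
  qed
  have "type_1_1 A K (ricci_form A K D)"
    unfolding type_1_1_def using ricci_form_type_1_1_at coordinates by blast
  then show ?thesis
    using ricci_form_closed potential para_hol_chart.ricci_vec[OF chart] by blast
qed

end
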